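(* Let $d\ge 2$, let $\Omega\subset\mathbb R^d$ be a bounded polytopal domain, $\mu>0$, $\lambda>0$, $\iota\in(0,1]$ and $f\in L^2(\Omega;\mathbb R^d)$. There exists a unique pair $(\Phi,u)\in H^{-1}(\operatorname{div}\operatorname{div},\Omega;\mathbb S\otimes\mathbb R^d)\times H_0^1(\Omega;\mathbb R^d)$ such that $$\iota^{-2}(\widetilde{\mathcal A}\Phi,\Psi)-\langle \operatorname{div}\operatorname{div}\Psi,u\rangle=0\quad\forall\,\Psi\in H^{-1}(\operatorname{div}\operatorname{div},\Omega;\mathbb S\otimes\mathbb R^d),$$ $$-\langle \operatorname{div}\operatorname{div}\Phi,v\rangle-(\sigma(u),\varepsilon(v))=-(f,v)\quad\forall\,v\in H_0^1(\Omega;\mathbb R^d).$$ Moreover, $$\|\Phi\|_{H_{\mathcal A}^{-1}(\iota\operatorname{div}\operatorname{div})}+|\!|\!|u|\!|\!|_1\le C\,\|f\|_{-1,\mathcal A},$$ where the constant $C$ depends at most on $\Omega$, $d$ and $\mu$, and is independent of $\iota$ and $\lambda$.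
   Context: Notation. $\mathbb S$ is the space of symmetric real $d\times d$ matrices, $I$ the identity matrix. $\mathbb S\otimes\mathbb R^d$ is the space of third-order tensors $\Psi=(\Psi_{ijk})$ with $\Psi_{ijk}=\Psi_{jik}$; $(\tau\otimes v)_{ijk}=\tau_{ij}v_k$; the trace of $\Psi$ is the vector $\operatorname{tr}(\Psi)\in\mathbb R^d$ with $\operatorname{tr}(\Psi)_k=\sum_i\Psi_{iik}$. All tensor inner products are Frobenius inner products; $(\cdot,\cdot)$ is the $L^2(\Omega)$ inner product; $\langle\cdot,\cdot\rangle$ is the duality pairing between $H^{-1}(\Omega;\mathbb R^d)$ and $H^1_0(\Omega;\mathbb R^d)$. Differential operators: $\varepsilon_{ij}(v)=\tfrac12(\partial_jv_i+\partial_iv_j)$, $\sigma(v)=2\mu\,\varepsilon(v)+\lambda(\operatorname{div}v)I$, $(\operatorname{div}\tau)_i=\sum_j\partial_j\tau_{ij}$ for second-order tensors, $(\operatorname{div}\Psi)_{ij}=\sum_k\partial_k\Psi_{ijk}$ for third-order tensors (in the distributional sense). Compliance tensor: $\widetilde{\mathcal A}\Psi=\frac1{2\mu}\big(\Psi-\frac{\lambda}{2\mu+d\lambda}I\otimes\operatorname{tr}(\Psi)\big)$, and $\|\Psi\|_{\widetilde{\mathcal A}}^2=(\widetilde{\mathcal A}\Psi,\Psi)$. Space: $H^{-1}(\operatorname{div}\operatorname{div},\Omega;\mathbb S\otimes\mathbb R^d)=\{\Psi\in L^2(\Omega;\mathbb S\otimes\mathbb R^d):\operatorname{div}\operatorname{div}\Psi\in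 H^{-1}(\Omega;\mathbb R^d)\}$. Norms: for $v\in H_0^1(\Omega;\mathbb R^d)$, $|\!|\!|v|\!|\!|_1^2=(\sigma(v),\varepsilon(v))=2\mu\|\varepsilon(v)\|_0^2+\lambda\|\operatorname{div}v\|_0^2$; for $g\in H^{-1}(\Omega;\mathbb R^d)$, $\|g\|_{-1,\mathcal A}=\sup_{0\neq v\in H^1_0(\Omega;\mathbb R^d)}\frac{|\langle g,v\rangle|}{|\!|\!|v|\!|\!|_1}$; and $\|\Psi\|^2_{H_{\mathcal A}^{-1}(\iota\operatorname{div}\operatorname{div})}=\iota^{-2}\|\Psi\|^2_{\widetilde{\mathcal A}}+\|\operatorname{div}\operatorname{div}\Psi\|^2_{-1,\mathcal A}$. Here $\|\cdot\|_0$ is the $L^2(\Omega)$ norm. *)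

theory Defs
  imports "HOL-Analysis.Analysis"
begin

text \<open>
  The dimension \<open>d\<close> is \<open>CARD('n)\<close>. Second- and third-order tensors are elements of
  \<open>real^'n^'n\<close> and \<open>real^'n^'n^'n\<close>, with \<open>\<tau>\<^sub>i\<^sub>j = \<tau> $ i $ j\<close> and
  \<open>\<Psi>\<^sub>i\<^sub>j\<^sub>k = \<Psi> $ i $ j $ k\<close>; the library inner product \<open>\<bullet>\<close> on these types is the Frobenius
  inner product. Elements of Lebesgue and Sobolev spaces are represented by functions on the whole
  space of which only the values almost everywhere in \<open>\<Omega>\<close> matter.
\<close>

definition polytopal_domain :: "(real^'n) set \<Rightarrow> bool" where
  "polytopal_domain \<Omega> \<longleftrightarrow>
     open \<Omega> \<and> connected \<Omega> \<and> \<Omega> \<noteq> {} \<and>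
     (\<exists>\<P>. finite \<P> \<and> (\<forall>P\<in>\<P>. polytope P) \<and> \<Omega> = interior (\<Union>\<P>))"

subsection \<open>Tensors\<close>

definition sym_tensor3 :: "(real^'n^'n^'n) set" where
  "sym_tensor3 = {\<Psi>. \<forall>i j k. \<Psi> $ i $ j $ k = \<Psi> $ j $ i $ k}"

definition tensor_vec :: "real^'n^'n \<Rightarrow> real^'n \<Rightarrow> real^'n^'n^'n" where
  "tensor_vec \<tau> v = (\<chi> i j k. \<tau> $ i $ j * v $ k)"

definition trace3 :: "real^'n^'n^'n \<Rightarrow> real^'n" where
  "trace3 \<Psi> = (\<chi> k. \<Sum>i\<in>UNIV. \<Psi> $ i $ i $ k)"

definition compliance :: "real \<Rightarrow> real \<Rightarrow> real^'n^'n^'n \<Rightarrow> real^'n^'n^'n" where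
  "compliance \<mu> lam \<Psi> =
     (1 / (2 * \<mu>)) *\<^sub>R
       (\<Psi> - (lam / (2 * \<mu> + real CARD('n) * lam)) *\<^sub>R tensor_vec (mat 1) (trace3 \<Psi>))"

subsection \<open>Test functions and square-integrable functions\<close>

definition pderiv_at :: "'n \<Rightarrow> (real^'n \<Rightarrow> 'b::euclidean_space) \<Rightarrow> real^'n \<Rightarrow> 'b" where
  "pderiv_at k g x = frechet_derivative g (at x) (axis k 1)"

text \<open>\<open>C\<^sup>\<infinity>\<close>: every iterated partial derivative exists and is (totally) differentiable.\<close>

definition smooth_fun :: "(real^'n \<Rightarrow> 'b::euclidean_space) \<Rightarrow> bool" where
  "smooth_fun g \<longleftrightarrow> (\<forall>ks. foldr pderiv_at ks g differentiable_on UNIV)"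

definition test_funs :: "(real^'n) set \<Rightarrow> (real^'n \<Rightarrow> 'b::euclidean_space) set" where
  "test_funs \<Omega> =
     {\<phi>. smooth_fun \<phi> \<and> compact (closure {x. \<phi> x \<noteq> 0}) \<and> closure {x. \<phi> x \<noteq> 0} \<subseteq> \<Omega>}"

definition L2 :: "(real^'n) set \<Rightarrow> (real^'n \<Rightarrow> 'b::euclidean_space) set" where
  "L2 \<Omega> = {f. f \<in> borel_measurable (lebesgue_on \<Omega>) \<and>
                integrable (lebesgue_on \<Omega>) (\<lambda>x. (norm (f x))\<^sup>2)}"

definition L2_inner ::
    "(real^'n) set \<Rightarrow> (real^'n \<Rightarrow> 'b::euclidean_space) \<Rightarrow> (real^'n \<Rightarrow> 'b) \<Rightarrow> real" where
  "L2_inner \<Omega> f g = integral\<^sup>L (lebesgue_on \<Omega>) (\<lambda>x. f x \<bullet> g x)"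

subsection \<open>The spaces \<open>H\<^sup>1\<close>, \<open>H\<^sup>1\<^sub>0\<close> and the dual space\<close>

text \<open>\<open>G $ i $ j\<close> is the weak derivative \<open>\<partial>\<^sub>j v\<^sub>i\<close>.\<close>

definition is_weak_grad ::
    "(real^'n) set \<Rightarrow> (real^'n \<Rightarrow> real^'n) \<Rightarrow> (real^'n \<Rightarrow> real^'n^'n) \<Rightarrow> bool" where
  "is_weak_grad \<Omega> v G \<longleftrightarrow>
     (\<forall>\<phi>\<in>test_funs \<Omega>. \<forall>i j.
        integral\<^sup>L (lebesgue_on \<Omega>) (\<lambda>x. v x $ i * pderiv_at j \<phi> x) =
        - integral\<^sup>L (lebesgue_on \<Omega>) (\<lambda>x. G x $ i $ j * \<phi> x))"

definition H1 :: "(real^'n) set \<Rightarrow> (real^'n \<Rightarrow> real^'n) set" where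
  "H1 \<Omega> = {v \<in> L2 \<Omega>. \<exists>G\<in>L2 \<Omega>. is_weak_grad \<Omega> v G}"

text \<open>For \<open>v\<close> in \<open>H1 \<Omega>\<close> the weak gradient is determined up to a null subset of \<open>\<Omega>\<close>, and it is
  used below only under integrals over \<open>\<Omega>\<close>.\<close>

definition weak_grad :: "(real^'n) set \<Rightarrow> (real^'n \<Rightarrow> real^'n) \<Rightarrow> real^'n \<Rightarrow> real^'n^'n" where
  "weak_grad \<Omega> v = (SOME G. G \<in> L2 \<Omega> \<and> is_weak_grad \<Omega> v G)"

definition H1_norm :: "(real^'n) set \<Rightarrow> (real^'n \<Rightarrow> real^'n) \<Rightarrow> real" where
  "H1_norm \<Omega> v =
     sqrt (L2_inner \<Omega> v v + L2_inner \<Omega> (weak_grad \<Omega> v) (weak_grad \<Omega> v))"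

definition H10 :: "(real^'n) set \<Rightarrow> (real^'n \<Rightarrow> real^'n) set" where
  "H10 \<Omega> =
     {v \<in> H1 \<Omega>. \<forall>e>0. \<exists>\<phi>\<in>test_funs \<Omega>. H1_norm \<Omega> (\<lambda>x. v x - \<phi> x) < e}"

text \<open>Functionals are HOL functions on all functions; only their restriction to \<open>H10 \<Omega>\<close> matters.\<close>

definition Hm1 :: "(real^'n) set \<Rightarrow> ((real^'n \<Rightarrow> real^'n) \<Rightarrow> real) set" where
  "Hm1 \<Omega> =
     {g. (\<forall>v\<in>H10 \<Omega>. \<forall>w\<in>H10 \<Omega>. g (\<lambda>x. v x + w x) = g v + g w) \<and>
         (\<forall>c. \<forall>v\<in>H10 \<Omega>. g (\<lambda>x. c *\<^sub>R v x) = c * g v) \<and>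
         (\<exists>C. \<forall>v\<in>H10 \<Omega>. \<bar>g v\<bar> \<le> C * H1_norm \<Omega> v)}"

subsection \<open>Strain, stress and the distributional \<open>div div\<close>\<close>

definition strain :: "(real^'n) set \<Rightarrow> (real^'n \<Rightarrow> real^'n) \<Rightarrow> real^'n \<Rightarrow> real^'n^'n" where
  "strain \<Omega> v x =
     (\<chi> i j. (weak_grad \<Omega> v x $ i $ j + weak_grad \<Omega> v x $ j $ i) / 2)"

definition weak_div :: "(real^'n) set \<Rightarrow> (real^'n \<Rightarrow> real^'n) \<Rightarrow> real^'n \<Rightarrow> real" where
  "weak_div \<Omega> v x = (\<Sum>i\<in>UNIV. weak_grad \<Omega> v x $ i $ i)"

definition stress ::
    "(real^'n) set \<Rightarrow> real \<Rightarrow> real \<Rightarrow> (real^'n \<Rightarrow> real^'n) \<Rightarrow> real^'n \<Rightarrow> real^'n^'n" where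
  "stress \<Omega> \<mu> lam v x =
     (2 * \<mu>) *\<^sub>R strain \<Omega> v x + (lam * weak_div \<Omega> v x) *\<^sub>R mat 1"

text \<open>Tensor-valued distributions are functionals on test functions of the same tensor type.
  The divergence acts on the last index, hence is minus the transpose of
  \<open>\<tau> \<mapsto> (\<partial>\<^sub>k \<tau>\<^sub>i\<^sub>j)\<^sub>i\<^sub>j\<^sub>k\<close> respectively \<open>\<phi> \<mapsto> (\<partial>\<^sub>j \<phi>\<^sub>i)\<^sub>i\<^sub>j\<close>.\<close>

definition dist_div3 ::
    "((real^'n \<Rightarrow> real^'n^'n^'n) \<Rightarrow> real) \<Rightarrow> (real^'n \<Rightarrow> real^'n^'n) \<Rightarrow> real" where
  "dist_div3 T \<tau> = - T (\<lambda>x. \<chi> i j k. pderiv_at k \<tau> x $ i $ j)"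

definition dist_div2 ::
    "((real^'n \<Rightarrow> real^'n^'n) \<Rightarrow> real) \<Rightarrow> (real^'n \<Rightarrow> real^'n) \<Rightarrow> real" where
  "dist_div2 T \<phi> = - T (\<lambda>x. \<chi> i j. pderiv_at j \<phi> x $ i)"

definition is_divdiv ::
    "(real^'n) set \<Rightarrow> (real^'n \<Rightarrow> real^'n^'n^'n) \<Rightarrow> ((real^'n \<Rightarrow> real^'n) \<Rightarrow> real) \<Rightarrow> bool" where
  "is_divdiv \<Omega> \<Psi> g \<longleftrightarrow>
     (\<forall>\<phi>\<in>test_funs \<Omega>. g \<phi> = dist_div2 (dist_div3 (L2_inner \<Omega> \<Psi>)) \<phi>)"

text \<open>The space of symmetric \<open>\<Psi>\<close> in \<open>L\<^sup>2\<close> with \<open>div div \<Psi>\<close> in the dual of \<open>H\<^sup>1\<^sub>0\<close>.\<close>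

definition Hdivdiv :: "(real^'n) set \<Rightarrow> (real^'n \<Rightarrow> real^'n^'n^'n) set" where
  "Hdivdiv \<Omega> =
     {\<Psi> \<in> L2 \<Omega>. (AE x in lebesgue_on \<Omega>. \<Psi> x \<in> sym_tensor3) \<and>
                  (\<exists>g\<in>Hm1 \<Omega>. is_divdiv \<Omega> \<Psi> g)}"

text \<open>By density of the test functions, the functional chosen here is unique on \<open>H10 \<Omega>\<close>;
  \<open>divdiv \<Omega> \<Psi> v\<close> is the duality pairing of \<open>div div \<Psi>\<close> with \<open>v\<close>.\<close>

definition divdiv ::
    "(real^'n) set \<Rightarrow> (real^'n \<Rightarrow> real^'n^'n^'n) \<Rightarrow> (real^'n \<Rightarrow> real^'n) \<Rightarrow> real" where
  "divdiv \<Omega> \<Psi> = (SOME g. g \<in> Hm1 \<Omega> \<and> is_divdiv \<Omega> \<Psi> g)"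

subsection \<open>Parameter-dependent norms\<close>

definition energy_norm ::
    "(real^'n) set \<Rightarrow> real \<Rightarrow> real \<Rightarrow> (real^'n \<Rightarrow> real^'n) \<Rightarrow> real" where
  "energy_norm \<Omega> \<mu> lam v = sqrt (L2_inner \<Omega> (stress \<Omega> \<mu> lam v) (strain \<Omega> v))"

definition dual_norm ::
    "(real^'n) set \<Rightarrow> real \<Rightarrow> real \<Rightarrow> ((real^'n \<Rightarrow> real^'n) \<Rightarrow> real) \<Rightarrow> real" where
  "dual_norm \<Omega> \<mu> lam g =
     Sup {\<bar>g v\<bar> / energy_norm \<Omega> \<mu> lam v | v.
            v \<in> H10 \<Omega> \<and> \<not> (AE x in lebesgue_on \<Omega>. v x = 0)}"

definition compliance_norm ::
    "(real^'n) set \<Rightarrow> real \<Rightarrow> real \<Rightarrow> (real^'n \<Rightarrow> real^'n^'n^'n) \<Rightarrow> real" where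
  "compliance_norm \<Omega> \<mu> lam \<Psi> = sqrt (L2_inner \<Omega> (\<lambda>x. compliance \<mu> lam (\<Psi> x)) \<Psi>)"

definition Hdivdiv_norm ::
    "(real^'n) set \<Rightarrow> real \<Rightarrow> real \<Rightarrow> real \<Rightarrow> (real^'n \<Rightarrow> real^'n^'n^'n) \<Rightarrow> real" where
  "Hdivdiv_norm \<Omega> \<mu> lam \<iota> \<Psi> =
     sqrt ((compliance_norm \<Omega> \<mu> lam \<Psi>)\<^sup>2 / \<iota>\<^sup>2 + (dual_norm \<Omega> \<mu> lam (divdiv \<Omega> \<Psi>))\<^sup>2)"

subsection \<open>The mixed problem\<close>

definition mixed_solution ::
    "(real^'n) set \<Rightarrow> real \<Rightarrow> real \<Rightarrow> real \<Rightarrow> (real^'n \<Rightarrow> real^'n) \<Rightarrow>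
     (real^'n \<Rightarrow> real^'n^'n^'n) \<Rightarrow> (real^'n \<Rightarrow> real^'n) \<Rightarrow> bool" where
  "mixed_solution \<Omega> \<mu> lam \<iota> f \<Phi> u \<longleftrightarrow>
     \<Phi> \<in> Hdivdiv \<Omega> \<and> u \<in> H10 \<Omega> \<and>
     (\<forall>\<Psi>\<in>Hdivdiv \<Omega>.
        L2_inner \<Omega> (\<lambda>x. compliance \<mu> lam (\<Phi> x)) \<Psi> / \<iota>\<^sup>2 - divdiv \<Omega> \<Psi> u = 0) \<and>
     (\<forall>v\<in>H10 \<Omega>.
        - divdiv \<Omega> \<Phi> v - L2_inner \<Omega> (stress \<Omega> \<mu> lam u) (strain \<Omega> v) = - L2_inner \<Omega> f v)"

end

theory Submission imports Defs begin

text \<open>On \<open>H\<^sup>1\<^sub>0\<close> write \<open>e(v, w) = (\<sigma>(v), \<epsilon>(w))\<close> for the energy inner product. Integration by parts gives the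
  inequalities of Poincare and Korn for test functions, and by density the energy norm is equivalent
  to the \<open>H\<^sup>1\<close> norm on \<open>H\<^sup>1\<^sub>0\<close>. So \<open>H\<^sup>1\<^sub>0\<close> with \<open>e\<close> is a Hilbert space, every functional in the dual
  is \<open>e(w, \<cdot>)\<close> for some \<open>w\<close> (\<open>Hm1_Riesz\<close>), and its dual norm is the energy norm of \<open>w\<close>
  (\<open>dual_norm_eq_energy_norm\<close>).

  Let \<open>T \<Psi>\<close> represent \<open>div div \<Psi>\<close> in this way and let \<open>F\<close> represent \<open>f\<close>. With
  \<open>a(\<Phi>, \<Psi>) = \<iota>\<^sup>-\<^sup>2 (A \<Phi>, \<Psi>)\<close>, where \<open>A\<close> is the compliance tensor, the mixed problem reads
  \<open>a(\<Phi>, \<Psi>) = e(T \<Psi>, u)\<close> for all \<open>\<Psi>\<close>, and \<open>T \<Phi> + u = F\<close>. Eliminating \<open>u = F - T \<Phi>\<close> leaves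
  \<open>a(\<Phi>, \<Psi>) + e(T \<Phi>, T \<Psi>) = e(F, T \<Psi>)\<close> for all \<open>\<Psi>\<close>. The left-hand side is the inner product that
  belongs to the norm of the theorem. It is complete, because the compliance is coercive and
  \<open>div div\<close>, being defined by duality, is a closed operator. The Riesz theorem therefore gives \<open>\<Phi>\<close>,
  with norm at most that of \<open>F\<close>; hence the energy norm of \<open>u = F - T \<Phi>\<close> is at most twice that of
  \<open>F\<close>, and \<open>C = 3\<close> works for all parameters. Uniqueness follows by testing the difference of
  two solutions with itself: \<open>a(\<delta>\<Phi>, \<delta>\<Phi>) + e(\<delta>u, \<delta>u) = 0\<close>.

  Elements of the function spaces are functions, identified only almost everywhere. The Hilbert space
  arguments are therefore made for sets of functions with a possibly degenerate inner product, and
  weak gradients, which are chosen arbitrarily in their class, are linear only almost everywhere. That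
  they are determined almost everywhere is the fundamental lemma of the calculus of variations, for
  which smooth bump functions are constructed from \<open>exp (-1/t)\<close>.\<close>

section \<open>Riesz representation in semi-inner product spaces of functions\<close>

lemma parabola_slope_zero:
  fixes a b :: real
  assumes q: "\<And>c. 0 \<le> 2 * c * a + c\<^sup>2 * b" and "0 \<le> b"
  shows "a = 0"
proof -
  define c where "c = - a / (b + 1)"
  have a: "a = - c * (b + 1)"
    using \<open>0 \<le> b\<close> by (simp add: c_def)
  have "0 \<le> 2 * c * a + c\<^sup>2 * b" by (rule q)
  also have "\<dots> = - (c\<^sup>2 * (b + 2))"
    unfolding a by (simp add: algebra_simps power2_eq_square)
  finally have "c\<^sup>2 * (b + 2) \<le> 0" by simp
  then have "c = 0"
    using \<open>0 \<le> b\<close> by (simp add: mult_le_0_iff)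
  then show ?thesis by (simp add: a)
qed

text \<open>The form may vanish on nonzero functions, as the \<open>L\<^sup>2\<close> inner product does on functions that vanish
  almost everywhere; passing to quotients is avoided. Closure under \<open>f + c g\<close> and linearity
  in that combination express everything about the linear structure in one law each.\<close>

locale semi_inner =
  fixes X :: "('a \<Rightarrow> 'b::real_vector) set" and B :: "('a \<Rightarrow> 'b) \<Rightarrow> ('a \<Rightarrow> 'b) \<Rightarrow> real"
  assumes nonempty: "X \<noteq> {}"
    and closed_axpy: "\<lbrakk>f \<in> X; g \<in> X\<rbrakk> \<Longrightarrow> (\<lambda>x. f x + c *\<^sub>R g x) \<in> X"
    and axpy_left: "\<lbrakk>f \<in> X; g \<in> X; h \<in> X\<rbrakk> \<Longrightarrow> B (\<lambda>x. f x + c *\<^sub>R g x) h = B f h + c * B g h"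
    and sym: "\<lbrakk>f \<in> X; g \<in> X\<rbrakk> \<Longrightarrow> B f g = B g f"
    and nonneg: "f \<in> X \<Longrightarrow> 0 \<le> B f f"
begin

definition nrm :: "('a \<Rightarrow> 'b) \<Rightarrow> real" where
  "nrm f = sqrt (B f f)"

lemma nrm_nonneg: "f \<in> X \<Longrightarrow> 0 \<le> nrm f"
  by (simp add: nrm_def nonneg)

lemma nrm_power2: "f \<in> X \<Longrightarrow> (nrm f)\<^sup>2 = B f f"
  by (simp add: nrm_def nonneg)

lemma closed_add: "\<lbrakk>f \<in> X; g \<in> X\<rbrakk> \<Longrightarrow> (\<lambda>x. f x + g x) \<in> X"
  using closed_axpy[of f g 1] by simp

lemma closed_diff: "\<lbrakk>f \<in> X; g \<in> X\<rbrakk> \<Longrightarrow> (\<lambda>x. f x - g x) \<in> X"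
  using closed_axpy[of f g "-1"] by simp

lemma closed_zero: "(\<lambda>x. 0) \<in> X"
proof -
  obtain f where "f \<in> X" using nonempty by blast
  then show ?thesis using closed_diff[of f f] by simp
qed

lemma closed_scale: "f \<in> X \<Longrightarrow> (\<lambda>x. c *\<^sub>R f x) \<in> X"
  using closed_axpy[OF closed_zero, of f c] by simp

lemma diff_left: "\<lbrakk>f \<in> X; g \<in> X; h \<in> X\<rbrakk> \<Longrightarrow> B (\<lambda>x. f x - g x) h = B f h - B g h"
  using axpy_left[of f g h "-1"] by simp

lemma zero_left: "h \<in> X \<Longrightarrow> B (\<lambda>x. 0) h = 0"
  using axpy_left[OF closed_zero closed_zero, of h 1] by simp

lemma axpy_right:
  "\<lbrakk>f \<in> X; g \<in> X; h \<in> X\<rbrakk> \<Longrightarrow> B h (\<lambda>x. f x + c *\<^sub>R g x) = B h f + c * B h g"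
  using axpy_left[of f g h c] by (simp add: sym closed_axpy)

lemma diff_right: "\<lbrakk>f \<in> X; g \<in> X; h \<in> X\<rbrakk> \<Longrightarrow> B h (\<lambda>x. f x - g x) = B h f - B h g"
  using axpy_right[of f g h "-1"] by simp

lemma axpy_axpy:
  assumes "f \<in> X" "g \<in> X"
  shows "B (\<lambda>x. f x + c *\<^sub>R g x) (\<lambda>x. f x + c *\<^sub>R g x) = B f f + 2 * c * B f g + c\<^sup>2 * B g g"
  using assms
  by (simp add: axpy_left axpy_right closed_axpy sym[of g f] power2_eq_square algebra_simps)

lemma Cauchy_Schwarz:
  assumes "f \<in> X" "g \<in> X"
  shows "\<bar>B f g\<bar> \<le> nrm f * nrm g"
proof -
  have q: "0 \<le> B f f + 2 * c * B f g + c\<^sup>2 * B g g" for c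
    using nonneg[OF closed_axpy[OF assms, of c]] by (simp add: axpy_axpy assms)
  have "(B f g)\<^sup>2 \<le> B f f * B g g"
  proof (cases "B g g = 0")
    case True
    have "B f g = 0"
    proof (rule ccontr)
      assume nz: "B f g \<noteq> 0"
      show False
        using q[of "- (B f f + 1) / (2 * B f g)"] nz True by (simp add: field_simps)
    qed
    then show ?thesis
      using assms nonneg True by simp
  next
    case False
    then have "B g g > 0"
      using nonneg[OF assms(2)] by simp
    then show ?thesis
      using q[of "- B f g / B g g"] by (simp add: field_simps power2_eq_square)
  qed
  then have "sqrt ((B f g)\<^sup>2) \<le> sqrt (B f f * B g g)"
    using real_sqrt_le_iff by blast
  then show ?thesis
    by (simp add: nrm_def real_sqrt_mult)
qed

lemma nrm_add_le:
  assumes "f \<in> X" "g \<in> X"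
  shows "nrm (\<lambda>x. f x + g x) \<le> nrm f + nrm g"
proof (rule power2_le_imp_le)
  have "(nrm (\<lambda>x. f x + g x))\<^sup>2 = B f f + 2 * B f g + B g g"
    using axpy_axpy[OF assms, of 1] by (simp add: nrm_power2 closed_add assms)
  also have "\<dots> \<le> (nrm f + nrm g)\<^sup>2"
    using Cauchy_Schwarz[OF assms] by (simp add: power2_sum nrm_power2 assms)
  finally show "(nrm (\<lambda>x. f x + g x))\<^sup>2 \<le> (nrm f + nrm g)\<^sup>2" .
qed (simp add: assms nrm_nonneg)

lemma nrm_scale:
  assumes "f \<in> X"
  shows "nrm (\<lambda>x. c *\<^sub>R f x) = \<bar>c\<bar> * nrm f"
proof -
  have "B (\<lambda>x. c *\<^sub>R f x) (\<lambda>x. c *\<^sub>R f x) = c\<^sup>2 * B f f"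
    using axpy_axpy[OF closed_zero assms, of c] by (simp add: zero_left closed_zero assms)
  then show ?thesis
    by (simp add: nrm_def real_sqrt_mult)
qed

lemma nrm_diff_le:
  assumes "f \<in> X" "g \<in> X"
  shows "nrm (\<lambda>x. f x - g x) \<le> nrm f + nrm g"
  using nrm_add_le[OF assms(1) closed_scale[OF assms(2), of "-1"]] nrm_scale[OF assms(2), of "-1"]
  by simp

lemma nrm_minus_commute:
  "\<lbrakk>f \<in> X; g \<in> X\<rbrakk> \<Longrightarrow> nrm (\<lambda>x. f x - g x) = nrm (\<lambda>x. g x - f x)"
  using nrm_scale[OF closed_diff, of f g "-1"] by simp

lemma tendsto_left:
  assumes s: "\<And>n. s n \<in> X" and "f \<in> X" "g \<in> X"
    and lim: "(\<lambda>n. nrm (\<lambda>x. s n x - f x)) \<longlonglongrightarrow> 0"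
  shows "(\<lambda>n. B (s n) g) \<longlonglongrightarrow> B f g"
proof (rule LIM_zero_cancel, rule Lim_null_comparison)
  show "(\<lambda>n. nrm (\<lambda>x. s n x - f x) * nrm g) \<longlonglongrightarrow> 0"
    using tendsto_mult_right[OF lim, of "nrm g"] by simp
  show "\<forall>\<^sub>F n in sequentially. norm (B (s n) g - B f g) \<le> nrm (\<lambda>x. s n x - f x) * nrm g"
    using Cauchy_Schwarz[OF closed_diff[OF s \<open>f \<in> X\<close>] \<open>g \<in> X\<close>]
    by (simp add: diff_left assms)
qed

end

locale complete_semi_inner = semi_inner +
  assumes complete:
    "\<And>s. \<lbrakk>\<And>n. s n \<in> X; \<And>e. e > 0 \<Longrightarrow> \<exists>N. \<forall>m\<ge>N. \<forall>n\<ge>N. nrm (\<lambda>x. s m x - s n x) < e\<rbrakk>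
       \<Longrightarrow> \<exists>f\<in>X. (\<lambda>n. nrm (\<lambda>x. s n x - f x)) \<longlonglongrightarrow> 0"
begin

text \<open>The representative minimises \<open>B f f - 2 l f\<close>. A minimising sequence is Cauchy by the parallelogram
  identity, so completeness provides a minimiser, and the derivative of the functional vanishes there
  in every direction.\<close>

theorem Riesz:
  assumes lin: "\<And>f g c. \<lbrakk>f \<in> X; g \<in> X\<rbrakk> \<Longrightarrow> l (\<lambda>x. f x + c *\<^sub>R g x) = l f + c * l g"
    and bdd: "\<And>f. f \<in> X \<Longrightarrow> \<bar>l f\<bar> \<le> K * nrm f"
  obtains u where "u \<in> X" "\<And>v. v \<in> X \<Longrightarrow> B u v = l v"
proof -
  define J where "J f = B f f - 2 * l f" for f
  have J_lower: "- K\<^sup>2 \<le> J f" if "f \<in> X" for f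
  proof -
    have "0 \<le> (nrm f - K)\<^sup>2" by simp
    then show ?thesis
      using bdd[OF that] by (simp add: J_def power2_diff nrm_power2 that abs_le_iff mult.commute)
  qed
  define m where "m = Inf (J ` X)"
  have bddJ: "bdd_below (J ` X)"
    using J_lower by (intro bdd_belowI[of _ "- K\<^sup>2"]) auto
  have m_le: "m \<le> J f" if "f \<in> X" for f
    unfolding m_def using that bddJ by (intro cInf_lower) auto
  have "\<exists>f\<in>X. J f < m + 1 / real (Suc n)" for n
    using cInf_lessD[of "J ` X" "m + 1 / real (Suc n)"] nonempty unfolding m_def by auto
  then obtain s where s: "\<And>n. s n \<in> X" "\<And>n. J (s n) < m + 1 / real (Suc n)"
    by metis
  have J_axpy: "J (\<lambda>x. f x + c *\<^sub>R g x) = J f + 2 * c * (B f g - l g) + c\<^sup>2 * B g g"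
    if "f \<in> X" "g \<in> X" for f g c
    using that by (simp add: J_def axpy_axpy lin algebra_simps)
  \<comment> \<open>The parallelogram identity applied to the midpoint of \<open>f\<close> and \<open>g\<close>.\<close>
  have para: "B (\<lambda>x. f x - g x) (\<lambda>x. f x - g x) \<le> 2 * (J f - m) + 2 * (J g - m)"
    if fg: "f \<in> X" "g \<in> X" for f g
  proof -
    have d: "(\<lambda>x. g x - f x) \<in> X"
      using fg by (simp add: closed_diff)
    have "J g = J f + 2 * (B f (\<lambda>x. g x - f x) - l (\<lambda>x. g x - f x))
        + B (\<lambda>x. g x - f x) (\<lambda>x. g x - f x)"
      using J_axpy[OF fg(1) d, of 1] by simp
    moreover have "m \<le> J f + (B f (\<lambda>x. g x - f x) - l (\<lambda>x. g x - f x))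
        + B (\<lambda>x. g x - f x) (\<lambda>x. g x - f x) / 4"
      using m_le[OF closed_axpy[OF fg(1) d, of "1/2"]] J_axpy[OF fg(1) d, of "1/2"]
      by (simp add: power2_eq_square)
    moreover have "B (\<lambda>x. g x - f x) (\<lambda>x. g x - f x) = B (\<lambda>x. f x - g x) (\<lambda>x. f x - g x)"
      using nrm_minus_commute[OF fg]
      by (simp add: closed_diff fg flip: nrm_power2)
    ultimately show ?thesis by simp
  qed
  have "\<exists>u\<in>X. (\<lambda>n. nrm (\<lambda>x. s n x - u x)) \<longlonglongrightarrow> 0"
  proof (rule complete[OF s(1)])
    fix e :: real assume "e > 0"
    obtain N where "4 / e\<^sup>2 < real N"
      using reals_Archimedean2 by blast
    then have N: "4 / e\<^sup>2 < real (Suc N)" by simp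
    define d where "d = 1 / real (Suc N)"
    show "\<exists>N. \<forall>m\<ge>N. \<forall>n\<ge>N. nrm (\<lambda>x. s m x - s n x) < e"
    proof (intro exI allI impI)
      fix i j assume "N \<le> i" "N \<le> j"
      then have "1 / real (Suc i) \<le> d" "1 / real (Suc j) \<le> d"
        by (simp_all add: d_def frac_le)
      then have "J (s i) - m < d" "J (s j) - m < d"
        using s(2)[of i] s(2)[of j] by linarith+
      then have "2 * (J (s i) - m) + 2 * (J (s j) - m) < 4 * d"
        by argo
      then have "(nrm (\<lambda>x. s i x - s j x))\<^sup>2 < 4 * d"
        using para[OF s(1)[of i] s(1)[of j]] nrm_power2[OF closed_diff[OF s(1)[of i] s(1)[of j]]]
        by linarith
      also have "\<dots> < e\<^sup>2"
        using N \<open>e > 0\<close> by (simp add: d_def field_simps)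
      finally show "nrm (\<lambda>x. s i x - s j x) < e"
        using \<open>e > 0\<close> power2_less_imp_less by fastforce
    qed
  qed
  then obtain u where u: "u \<in> X" "(\<lambda>n. nrm (\<lambda>x. s n x - u x)) \<longlonglongrightarrow> 0" by blast
  have Ju: "J u \<le> m"
  proof -
    have "(\<lambda>n. B (s n) u) \<longlonglongrightarrow> B u u"
      using tendsto_left s u by blast
    moreover have "(\<lambda>n. l (s n)) \<longlonglongrightarrow> l u"
    proof (rule LIM_zero_cancel, rule Lim_null_comparison)
      show "(\<lambda>n. K * nrm (\<lambda>x. s n x - u x)) \<longlonglongrightarrow> 0"
        using tendsto_mult_left[OF u(2), of K] by simp
      have "l (\<lambda>x. s n x - u x) = l (s n) - l u" for n
        using lin[OF s(1)[of n] u(1), of "-1"] by simp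
      then show "\<forall>\<^sub>F n in sequentially. norm (l (s n) - l u) \<le> K * nrm (\<lambda>x. s n x - u x)"
        using bdd[OF closed_diff[OF s(1) u(1)]] by (intro always_eventually) (metis real_norm_def)
    qed
    moreover have "(\<lambda>n. 1 / real (Suc n)) \<longlonglongrightarrow> 0"
      using LIMSEQ_inverse_real_of_nat by (simp add: inverse_eq_divide)
    ultimately have "(\<lambda>n. 2 * B (s n) u - 2 * l (s n) - (m + 1 / real (Suc n)))
        \<longlonglongrightarrow> 2 * B u u - 2 * l u - (m + 0)"
      by (intro tendsto_intros)
    \<comment> \<open>This follows from \<open>0 \<le> B (s n - u) (s n - u)\<close> and \<open>J (s n) < m + 1 / (n + 1)\<close>.\<close>
    moreover have "2 * B (s n) u - 2 * l (s n) - (m + 1 / real (Suc n)) \<le> B u u" for n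
    proof -
      have "0 \<le> B (s n) (s n) - 2 * B (s n) u + B u u"
        using nonneg[OF closed_axpy[OF s(1)[of n] u(1), of "-1"]]
          axpy_axpy[OF s(1)[of n] u(1), of "-1"] by simp
      then show ?thesis
        using s(2)[of n] unfolding J_def by linarith
    qed
    ultimately have "2 * B u u - 2 * l u - (m + 0) \<le> B u u"
      by (meson LIMSEQ_le_const2)
    then show ?thesis by (simp add: J_def)
  qed
  have "B u v = l v" if v: "v \<in> X" for v
  proof -
    define a where "a = B u v - l v"
    have q: "0 \<le> 2 * c * a + c\<^sup>2 * B v v" for c
      using m_le[OF closed_axpy[OF u(1) v, of c]] Ju J_axpy[OF u(1) v, of c]
      by (simp add: a_def)
    \<comment> \<open>The nonnegative parabola vanishes at \<open>0\<close>, so its slope there is zero.\<close>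
    have "a = 0"
      using q nonneg[OF v] by (rule parabola_slope_zero)
    then show ?thesis by (simp add: a_def)
  qed
  with u(1) show ?thesis by (rule that)
qed

end

section \<open>Square-integrable functions\<close>

lemma L2_measurable [measurable_dest]: "f \<in> L2 \<Omega> \<Longrightarrow> f \<in> borel_measurable (lebesgue_on \<Omega>)"
  by (simp add: L2_def)

lemma L2_square_integrable: "f \<in> L2 \<Omega> \<Longrightarrow> integrable (lebesgue_on \<Omega>) (\<lambda>x. (norm (f x))\<^sup>2)"
  by (simp add: L2_def)

lemma integrable_L2_inner:
  assumes f: "f \<in> L2 \<Omega>" and g: "g \<in> L2 \<Omega>"
  shows "integrable (lebesgue_on \<Omega>) (\<lambda>x. f x \<bullet> g x)"
proof (rule Bochner_Integration.integrable_bound)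
  show "integrable (lebesgue_on \<Omega>) (\<lambda>x. (norm (f x))\<^sup>2 + (norm (g x))\<^sup>2)"
    using f g by (intro Bochner_Integration.integrable_add L2_square_integrable)
  show "(\<lambda>x. f x \<bullet> g x) \<in> borel_measurable (lebesgue_on \<Omega>)"
    using f g by measurable
  have "\<bar>a \<bullet> b\<bar> \<le> (norm a)\<^sup>2 + (norm b)\<^sup>2" for a b :: 'b
  proof -
    have "\<bar>a \<bullet> b\<bar> \<le> norm a * norm b" by (rule Cauchy_Schwarz_ineq2)
    also have "2 * (norm a * norm b) \<le> (norm a)\<^sup>2 + (norm b)\<^sup>2"
      using sum_squares_bound[of "norm a" "norm b"] by simp
    finally show ?thesis by (smt (verit) mult_nonneg_nonneg norm_ge_zero)
  qed
  then show "AE x in lebesgue_on \<Omega>. norm (f x \<bullet> g x) \<le> norm ((norm (f x))\<^sup>2 + (norm (g x))\<^sup>2)"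
    by simp
qed

lemma L2_I_bound:
  assumes "f \<in> borel_measurable (lebesgue_on \<Omega>)" "integrable (lebesgue_on \<Omega>) w"
    and "\<And>x. x \<in> \<Omega> \<Longrightarrow> (norm (f x))\<^sup>2 \<le> w x"
  shows "f \<in> L2 \<Omega>"
proof -
  have "integrable (lebesgue_on \<Omega>) (\<lambda>x. (norm (f x))\<^sup>2)"
  proof (rule Bochner_Integration.integrable_bound)
    show "AE x in lebesgue_on \<Omega>. norm ((norm (f x))\<^sup>2) \<le> norm (w x)"
    proof (rule AE_I2)
      fix x assume "x \<in> space (lebesgue_on \<Omega>)"
      then have "(norm (f x))\<^sup>2 \<le> w x" using assms(3) by (simp add: space_restrict_space)
      then show "norm ((norm (f x))\<^sup>2) \<le> norm (w x)" by simp
    qed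
  qed (use assms in auto)
  then show ?thesis using assms by (simp add: L2_def)
qed

lemma L2_axpy:
  assumes f: "f \<in> L2 \<Omega>" and g: "g \<in> L2 \<Omega>"
  shows "(\<lambda>x. f x + c *\<^sub>R g x) \<in> L2 \<Omega>"
proof (rule L2_I_bound)
  show "integrable (lebesgue_on \<Omega>)
      (\<lambda>x. (norm (f x))\<^sup>2 + 2 * c * (f x \<bullet> g x) + c\<^sup>2 * (norm (g x))\<^sup>2)"
    using L2_square_integrable[OF f] L2_square_integrable[OF g] integrable_L2_inner[OF f g] by simp
  show "(norm (f x + c *\<^sub>R g x))\<^sup>2 \<le> (norm (f x))\<^sup>2 + 2 * c * (f x \<bullet> g x) + c\<^sup>2 * (norm (g x))\<^sup>2"
    for x
    by (simp only: power2_norm_eq_inner)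
      (simp add: inner_add_left inner_add_right power2_eq_square algebra_simps inner_commute)
qed (use f g in measurable)

definition L2_norm :: "(real^'n) set \<Rightarrow> (real^'n \<Rightarrow> 'b::euclidean_space) \<Rightarrow> real" where
  "L2_norm \<Omega> f = sqrt (L2_inner \<Omega> f f)"

lemma semi_inner_L2: "semi_inner (L2 \<Omega>) (L2_inner \<Omega>)"
proof
  have "(\<lambda>x. 0) \<in> L2 \<Omega>" by (simp add: L2_def)
  then show "L2 \<Omega> \<noteq> {}" by blast
  show "L2_inner \<Omega> f g = L2_inner \<Omega> g f" for f g
    by (simp add: L2_inner_def inner_commute)
  show "0 \<le> L2_inner \<Omega> f f" for f
    by (simp add: L2_inner_def)
  show "L2_inner \<Omega> (\<lambda>x. f x + c *\<^sub>R g x) h = L2_inner \<Omega> f h + c * L2_inner \<Omega> g h"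
    if "f \<in> L2 \<Omega>" "g \<in> L2 \<Omega>" "h \<in> L2 \<Omega>" for f g h c
    using that by (simp add: L2_inner_def inner_add_left integrable_L2_inner)
qed (rule L2_axpy)

interpretation L2: semi_inner "L2 \<Omega>" "L2_inner \<Omega>"
  rewrites "semi_inner.nrm (L2_inner \<Omega>) = L2_norm \<Omega>" for \<Omega>
proof -
  show "semi_inner (L2 \<Omega>) (L2_inner \<Omega>)" by (rule semi_inner_L2)
  show "semi_inner.nrm (L2_inner \<Omega>) = L2_norm \<Omega>"
    by (rule ext) (simp add: semi_inner.nrm_def[OF semi_inner_L2] L2_norm_def)
qed

lemma L2_inner_cong_AE:
  assumes "AE x in lebesgue_on \<Omega>. f x = f' x" "AE x in lebesgue_on \<Omega>. g x = g' x"
    and "f \<in> L2 \<Omega>" "f' \<in> L2 \<Omega>" "g \<in> L2 \<Omega>" "g' \<in> L2 \<Omega>"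
  shows "L2_inner \<Omega> f g = L2_inner \<Omega> f' g'"
  unfolding L2_inner_def
  by (rule integral_cong_AE)
    (use assms in \<open>auto intro!: borel_measurable_inner L2_measurable\<close>)

lemma L2_norm_power2_integral: "(L2_norm \<Omega> f)\<^sup>2 = integral\<^sup>L (lebesgue_on \<Omega>) (\<lambda>x. (norm (f x))\<^sup>2)"
  by (simp add: L2_norm_def L2_inner_def power2_norm_eq_inner)

lemma L2_norm_eq_0_iff:
  assumes "f \<in> L2 \<Omega>"
  shows "L2_norm \<Omega> f = 0 \<longleftrightarrow> (AE x in lebesgue_on \<Omega>. f x = 0)"
proof -
  have "L2_norm \<Omega> f = 0 \<longleftrightarrow> integral\<^sup>L (lebesgue_on \<Omega>) (\<lambda>x. (norm (f x))\<^sup>2) = 0"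
    by (simp flip: L2_norm_power2_integral)
  also have "\<dots> \<longleftrightarrow> (AE x in lebesgue_on \<Omega>. (norm (f x))\<^sup>2 = 0)"
    using assms by (intro integral_nonneg_eq_0_iff_AE L2_square_integrable) auto
  finally show ?thesis by simp
qed

lemma
  assumes h: "bounded_linear h" and f: "f \<in> L2 \<Omega>"
    and K: "\<And>y. norm (h y) \<le> K * norm y" "0 \<le> K"
  shows L2_bounded_linear: "(\<lambda>x. h (f x)) \<in> L2 \<Omega>"
    and L2_norm_bounded_linear: "L2_norm \<Omega> (\<lambda>x. h (f x)) \<le> K * L2_norm \<Omega> f"
proof -
  have le: "(norm (h (f x)))\<^sup>2 \<le> K\<^sup>2 * (norm (f x))\<^sup>2" for x
    using K(1)[of "f x"] by (metis norm_ge_zero power_mono power_mult_distrib)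
  show mem: "(\<lambda>x. h (f x)) \<in> L2 \<Omega>"
  proof (rule L2_I_bound)
    have "h \<in> borel_measurable borel"
      using h by (simp add: borel_measurable_continuous_onI linear_continuous_on)
    then show "(\<lambda>x. h (f x)) \<in> borel_measurable (lebesgue_on \<Omega>)"
      using f by measurable
    show "integrable (lebesgue_on \<Omega>) (\<lambda>x. K\<^sup>2 * (norm (f x))\<^sup>2)"
      using L2_square_integrable[OF f] by simp
  qed (rule le)
  have "(L2_norm \<Omega> (\<lambda>x. h (f x)))\<^sup>2 \<le> (K * L2_norm \<Omega> f)\<^sup>2"
    unfolding L2_norm_power2_integral power_mult_distrib
      Bochner_Integration.integral_mult_right_zero[symmetric]
    using le mem f by (intro integral_mono) (auto intro!: L2_square_integrable)
  then show "L2_norm \<Omega> (\<lambda>x. h (f x)) \<le> K * L2_norm \<Omega> f"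
    by (rule power2_le_imp_le) (simp add: K L2.nrm_nonneg f)
qed

lemma L2_linear:
  fixes h :: "'b::euclidean_space \<Rightarrow> 'c::euclidean_space"
  assumes "linear h" "f \<in> L2 \<Omega>"
  shows "(\<lambda>x. h (f x)) \<in> L2 \<Omega>"
proof -
  have h: "bounded_linear h" using assms(1) linear_linear by blast
  obtain K where "\<And>y. norm (h y) \<le> norm y * K" "0 \<le> K"
    using bounded_linear.nonneg_bounded[OF h] by blast
  then show ?thesis
    using L2_bounded_linear[OF h assms(2), of K] by (simp add: mult.commute)
qed

lemma L2_norm_component_le:
  fixes f :: "real^'n \<Rightarrow> ('b::euclidean_space)^'m"
  assumes "f \<in> L2 \<Omega>"
  shows "(\<lambda>x. f x $ i) \<in> L2 \<Omega>" "L2_norm \<Omega> (\<lambda>x. f x $ i) \<le> L2_norm \<Omega> f"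
proof -
  have "norm (y $ i) \<le> 1 * norm y" for y :: "'b^'m"
    by (simp add: Finite_Cartesian_Product.norm_nth_le)
  then show "(\<lambda>x. f x $ i) \<in> L2 \<Omega>" "L2_norm \<Omega> (\<lambda>x. f x $ i) \<le> L2_norm \<Omega> f"
    using L2_bounded_linear[OF bounded_linear_vec_nth assms]
      L2_norm_bounded_linear[OF bounded_linear_vec_nth assms, of _ 1]
    by (fastforce, simp)
qed

text \<open>The Cauchy-Schwarz inequality against the constant function \<open>1\<close>.\<close>

lemma
  assumes fin: "finite_measure (lebesgue_on \<Omega>)" and f: "f \<in> L2 \<Omega>"
  shows L2_imp_integrable: "integrable (lebesgue_on \<Omega>) f"
    and integral_norm_le_L2_norm:
      "integral\<^sup>L (lebesgue_on \<Omega>) (\<lambda>x. norm (f x)) \<le> L2_norm \<Omega> f * L2_norm \<Omega> (\<lambda>x. 1::real)"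
proof -
  interpret finite_measure "lebesgue_on \<Omega>" by (rule fin)
  have one: "(\<lambda>x. 1::real) \<in> L2 \<Omega>"
    by (simp add: L2_def)
  have nf: "(\<lambda>x. norm (f x)) \<in> L2 \<Omega>"
    unfolding L2_def using L2_square_integrable[OF f] L2_measurable[OF f] by simp
  have "integrable (lebesgue_on \<Omega>) (\<lambda>x. norm (f x))"
    using integrable_L2_inner[OF nf one] by simp
  then show "integrable (lebesgue_on \<Omega>) f"
    by (rule integrable_norm_cancel) (rule L2_measurable[OF f])
  have "L2_norm \<Omega> (\<lambda>x. norm (f x)) = L2_norm \<Omega> f"
    by (simp add: L2_norm_def L2_inner_def dot_square_norm power2_eq_square)
  then show "integral\<^sup>L (lebesgue_on \<Omega>) (\<lambda>x. norm (f x)) \<le> L2_norm \<Omega> f * L2_norm \<Omega> (\<lambda>x. 1::real)"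
    using L2.Cauchy_Schwarz[OF nf one] by (simp add: L2_inner_def)
qed

text \<open>An \<open>L\<^sup>2\<close> Cauchy sequence is \<open>L\<^sup>1\<close> Cauchy, as the measure is finite, so a subsequence converges almost
  everywhere; Fatou's lemma shows that its pointwise limit is the \<open>L\<^sup>2\<close> limit. Being a pointwise limit,
  it inherits membership in closed sets, which is used for the symmetry of tensors.\<close>

lemma L2_complete:
  fixes s :: "nat \<Rightarrow> real^'n \<Rightarrow> 'b::euclidean_space"
  assumes fin: "finite_measure (lebesgue_on \<Omega>)" and s: "\<And>n. s n \<in> L2 \<Omega>"
    and Cau: "\<And>e. e > 0 \<Longrightarrow> \<exists>N. \<forall>m\<ge>N. \<forall>n\<ge>N. L2_norm \<Omega> (\<lambda>x. s m x - s n x) < e"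
  obtains f where "f \<in> L2 \<Omega>" "(\<lambda>n. L2_norm \<Omega> (\<lambda>x. s n x - f x)) \<longlonglongrightarrow> 0"
    "\<And>S. \<lbrakk>closed S; \<And>n. AE x in lebesgue_on \<Omega>. s n x \<in> S\<rbrakk> \<Longrightarrow> AE x in lebesgue_on \<Omega>. f x \<in> S"
proof -
  let ?M = "lebesgue_on \<Omega>"
  have [measurable]: "s n \<in> borel_measurable ?M" for n
    using s by (rule L2_measurable)
  define V where "V = L2_norm \<Omega> (\<lambda>x. 1::real)"
  have V: "0 \<le> V" by (simp add: V_def L2_norm_def L2_inner_def)
  have "\<exists>N. \<forall>i\<ge>N. \<forall>j\<ge>N. (LINT x|?M. norm (s i x - s j x)) < e" if "e > 0" for e
  proof -
    have "e / (V + 1) > 0" using V that by simp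
    then obtain N where N: "\<And>i j. \<lbrakk>i \<ge> N; j \<ge> N\<rbrakk> \<Longrightarrow> L2_norm \<Omega> (\<lambda>x. s i x - s j x) < e / (V + 1)"
      using Cau by blast
    have "(LINT x|?M. norm (s i x - s j x)) < e" if "i \<ge> N" "j \<ge> N" for i j
    proof -
      have "(LINT x|?M. norm (s i x - s j x)) \<le> L2_norm \<Omega> (\<lambda>x. s i x - s j x) * V"
        unfolding V_def using s by (intro integral_norm_le_L2_norm fin L2.closed_diff)
      also have "\<dots> \<le> e / (V + 1) * V"
        using N[OF that] V by (intro mult_right_mono) auto
      also have "\<dots> < e"
        using \<open>e > 0\<close> V by (simp add: field_simps)
      finally show ?thesis .
    qed
    then show ?thesis by blast
  qed
  then obtain r where r: "strict_mono r" "AE x in ?M. Cauchy (\<lambda>i. s (r i) x)"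
    using cauchy_L1_AE_cauchy_subseq[of ?M s] L2_imp_integrable[OF fin s] by blast
  define f where "f x = lim (\<lambda>i. s (r i) x)" for x
  have [measurable]: "f \<in> borel_measurable ?M"
    unfolding f_def by (intro borel_measurable_lim_metric) simp
  have lim: "AE x in ?M. (\<lambda>i. s (r i) x) \<longlonglongrightarrow> f x"
    using r(2) by eventually_elim (simp add: f_def Cauchy_convergent_iff convergent_LIMSEQ_iff)
  have sq: "(\<integral>\<^sup>+x. ennreal ((norm (s i x - s j x))\<^sup>2) \<partial>?M) = ennreal ((L2_norm \<Omega> (\<lambda>x. s i x - s j x))\<^sup>2)"
    for i j
    unfolding L2_norm_power2_integral
    by (rule nn_integral_eq_integral) (use s in \<open>auto intro!: L2_square_integrable L2.closed_diff\<close>)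
  \<comment> \<open>Fatou's lemma along the almost everywhere convergent subsequence.\<close>
  have fatou: "(\<integral>\<^sup>+x. ennreal ((norm (s n x - f x))\<^sup>2) \<partial>?M) \<le> ennreal (e\<^sup>2)"
    if N: "\<And>m. m \<ge> N \<Longrightarrow> L2_norm \<Omega> (\<lambda>x. s n x - s m x) \<le> e" for n N and e :: real
  proof -
    have "AE x in ?M. ennreal ((norm (s n x - f x))\<^sup>2)
        = liminf (\<lambda>i. ennreal ((norm (s n x - s (r i) x))\<^sup>2))"
      using lim
    proof eventually_elim
      case (elim x)
      then have "(\<lambda>i. ennreal ((norm (s n x - s (r i) x))\<^sup>2)) \<longlonglongrightarrow> ennreal ((norm (s n x - f x))\<^sup>2)"
        by (intro tendsto_intros)
      then show ?case
        using lim_imp_Liminf[OF sequentially_bot] by fastforce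
    qed
    then have "(\<integral>\<^sup>+x. ennreal ((norm (s n x - f x))\<^sup>2) \<partial>?M)
        = (\<integral>\<^sup>+x. liminf (\<lambda>i. ennreal ((norm (s n x - s (r i) x))\<^sup>2)) \<partial>?M)"
      by (rule nn_integral_cong_AE)
    also have "\<dots> \<le> liminf (\<lambda>i. \<integral>\<^sup>+x. ennreal ((norm (s n x - s (r i) x))\<^sup>2) \<partial>?M)"
      by (rule nn_integral_liminf) simp
    also have "\<dots> \<le> ennreal (e\<^sup>2)"
    proof (rule Liminf_le)
      have "L2_norm \<Omega> (\<lambda>x. s n x - s (r i) x) \<le> e" if "i \<ge> N" for i
        using N seq_suble[OF r(1), of i] that by force
      then have "(\<integral>\<^sup>+x. ennreal ((norm (s n x - s (r i) x))\<^sup>2) \<partial>?M) \<le> ennreal (e\<^sup>2)" if "i \<ge> N" for i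
        unfolding sq using that L2.nrm_nonneg[OF L2.closed_diff[OF s[of n] s[of "r i"]]]
        by (intro ennreal_leI power_mono) auto
      then show "\<forall>\<^sub>F i in sequentially. (\<integral>\<^sup>+x. ennreal ((norm (s n x - s (r i) x))\<^sup>2) \<partial>?M) \<le> ennreal (e\<^sup>2)"
        unfolding eventually_sequentially by blast
    qed simp
    finally show ?thesis .
  qed
  have L2_diff: "(\<lambda>x. s n x - f x) \<in> L2 \<Omega> \<and> L2_norm \<Omega> (\<lambda>x. s n x - f x) \<le> e"
    if N: "\<And>m. m \<ge> N \<Longrightarrow> L2_norm \<Omega> (\<lambda>x. s n x - s m x) \<le> e" and e: "e > 0" for n N and e :: real
  proof
    have fin: "(\<integral>\<^sup>+x. ennreal (norm ((norm (s n x - f x))\<^sup>2)) \<partial>?M) < \<infinity>"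
      using le_less_trans[OF fatou[OF N] ennreal_less_top] by simp
    then have "integrable ?M (\<lambda>x. (norm (s n x - f x))\<^sup>2)"
      unfolding integrable_iff_bounded by simp
    then show mem: "(\<lambda>x. s n x - f x) \<in> L2 \<Omega>"
      by (simp add: L2_def)
    have "ennreal ((L2_norm \<Omega> (\<lambda>x. s n x - f x))\<^sup>2) \<le> ennreal (e\<^sup>2)"
      unfolding L2_norm_power2_integral using fatou[OF N] L2_square_integrable[OF mem]
      by (subst nn_integral_eq_integral[symmetric]) auto
    then show "L2_norm \<Omega> (\<lambda>x. s n x - f x) \<le> e"
      using e by - (rule power2_le_imp_le, simp_all)
  qed
  have conv: "\<exists>N. \<forall>n\<ge>N. (\<lambda>x. s n x - f x) \<in> L2 \<Omega> \<and> L2_norm \<Omega> (\<lambda>x. s n x - f x) \<le> e"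
    if "e > 0" for e
  proof -
    obtain N where N: "\<And>i j. \<lbrakk>i \<ge> N; j \<ge> N\<rbrakk> \<Longrightarrow> L2_norm \<Omega> (\<lambda>x. s i x - s j x) < e"
      using Cau \<open>e > 0\<close> by blast
    then show ?thesis using L2_diff[of N _ e] \<open>e > 0\<close> by (meson less_imp_le)
  qed
  obtain n where "(\<lambda>x. s n x - f x) \<in> L2 \<Omega>"
    using conv[of 1] by auto
  then have f: "f \<in> L2 \<Omega>"
    using L2.closed_diff[OF s[of n], of "\<lambda>x. s n x - f x"] by simp
  show ?thesis
  proof (rule that[OF f])
    show "(\<lambda>n. L2_norm \<Omega> (\<lambda>x. s n x - f x)) \<longlonglongrightarrow> 0"
    proof (rule LIMSEQ_I)
      fix e :: real assume "e > 0"
      then obtain N where "\<And>n. n \<ge> N \<Longrightarrow> L2_norm \<Omega> (\<lambda>x. s n x - f x) \<le> e / 2"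
        using conv[of "e / 2"] by auto
      then show "\<exists>N. \<forall>n\<ge>N. norm (L2_norm \<Omega> (\<lambda>x. s n x - f x) - 0) < e"
        using \<open>e > 0\<close> L2.nrm_nonneg[OF L2.closed_diff[OF s f]] by force
    qed
    show "AE x in ?M. f x \<in> S" if S: "closed S" "\<And>n. AE x in ?M. s n x \<in> S" for S
    proof -
      have "AE x in ?M. \<forall>n. s n x \<in> S"
        using S(2) by (simp add: AE_all_countable)
      then show ?thesis
        using lim by eventually_elim (metis S(1) closed_sequentially)
    qed
  qed
qed

section \<open>Smooth functions and test functions\<close>

lemma pderiv_at_has_derivative:
  "(g has_derivative g') (at x) \<Longrightarrow> pderiv_at k g x = g' (axis k 1)"
  using frechet_derivative_at[of g g' x] by (simp add: pderiv_at_def)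

lemma smooth_fun_differentiable: "smooth_fun g \<Longrightarrow> g differentiable (at x)"
  unfolding smooth_fun_def differentiable_on_def by (metis foldr_Nil id_apply UNIV_I)

lemma smooth_fun_pderiv_at:
  assumes "smooth_fun g" shows "smooth_fun (pderiv_at k g)"
  unfolding smooth_fun_def
proof
  fix ks
  have "foldr pderiv_at (ks @ [k]) g differentiable_on UNIV"
    using assms unfolding smooth_fun_def by blast
  then show "foldr pderiv_at ks (pderiv_at k g) differentiable_on UNIV" by simp
qed

lemma continuous_on_smooth_fun: "smooth_fun g \<Longrightarrow> continuous_on S g"
  by (meson continuous_at_imp_continuous_on differentiable_imp_continuous_within
      smooth_fun_differentiable)

text \<open>Smoothness quantifies over iterated partial derivatives, so it is enough to find a family of
  differentiable functions that is closed under partial differentiation.\<close>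

lemma smooth_fun_coinduct:
  assumes S: "\<And>g. g \<in> S \<Longrightarrow> (\<forall>x. g differentiable (at x)) \<and> (\<forall>k. pderiv_at k g \<in> S)"
    and g: "g \<in> S"
  shows "smooth_fun g"
proof -
  have "foldr pderiv_at ks g \<in> S" for ks
    by (induction ks) (use S g in auto)
  then show ?thesis
    using S by (auto simp: smooth_fun_def differentiable_on_def)
qed

lemma pderiv_at_axpy:
  assumes "f differentiable (at x)" "g differentiable (at x)"
  shows "pderiv_at k (\<lambda>x. f x + c *\<^sub>R g x) x = pderiv_at k f x + c *\<^sub>R pderiv_at k g x"
proof -
  have "((\<lambda>x. f x + c *\<^sub>R g x) has_derivative
      (\<lambda>y. frechet_derivative f (at x) y + c *\<^sub>R frechet_derivative g (at x) y)) (at x)"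
    using assms by (intro derivative_intros) (simp_all add: frechet_derivative_works)
  then show ?thesis
    by (simp add: pderiv_at_has_derivative) (simp add: pderiv_at_def)
qed

lemma pderiv_at_mult:
  fixes f g :: "real^'n \<Rightarrow> real"
  assumes "f differentiable (at x)" "g differentiable (at x)"
  shows "pderiv_at k (\<lambda>x. f x * g x) x = f x * pderiv_at k g x + pderiv_at k f x * g x"
proof -
  have "((\<lambda>x. f x * g x) has_derivative
      (\<lambda>y. f x * frechet_derivative g (at x) y + frechet_derivative f (at x) y * g x)) (at x)"
    using assms by (intro derivative_intros) (simp_all add: frechet_derivative_works)
  then show ?thesis
    by (simp add: pderiv_at_has_derivative) (simp add: pderiv_at_def)
qed

lemma pderiv_at_linear:
  assumes "linear h" "g differentiable (at x)"
  shows "pderiv_at k (\<lambda>x. h (g x)) x = h (pderiv_at k g x)"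
proof -
  have h: "bounded_linear h"
    using assms(1) linear_linear by blast
  have "((\<lambda>x. h (g x)) has_derivative (\<lambda>y. h (frechet_derivative g (at x) y))) (at x)"
    using assms(2) by (intro bounded_linear.has_derivative[OF h]) (simp add: frechet_derivative_works)
  then show ?thesis
    by (simp add: pderiv_at_has_derivative) (simp add: pderiv_at_def)
qed

lemma differentiable_linear:
  fixes h :: "'b::euclidean_space \<Rightarrow> 'c::real_normed_vector"
  assumes "linear h" "g differentiable (at x)"
  shows "(\<lambda>x. h (g x)) differentiable (at x)"
proof -
  have h: "bounded_linear h"
    using assms(1) linear_linear by blast
  show ?thesis
    using bounded_linear.has_derivative[OF h] assms(2) unfolding differentiable_def by blast
qed

lemma smooth_fun_axpy:
  assumes "smooth_fun f" "smooth_fun g"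
  shows "smooth_fun (\<lambda>x. f x + c *\<^sub>R g x)"
proof (rule smooth_fun_coinduct)
  show "(\<lambda>x. f x + c *\<^sub>R g x) \<in> {\<lambda>x. f x + c *\<^sub>R g x |f g. smooth_fun f \<and> smooth_fun g}"
    using assms by blast
next
  fix h assume "h \<in> {\<lambda>x. f x + c *\<^sub>R g x |f g. smooth_fun f \<and> smooth_fun g}"
  then obtain f g where h: "h = (\<lambda>x. f x + c *\<^sub>R g x)" and fg: "smooth_fun f" "smooth_fun g"
    by blast
  have "pderiv_at k h = (\<lambda>x. pderiv_at k f x + c *\<^sub>R pderiv_at k g x)" for k
    unfolding h by (rule ext) (intro pderiv_at_axpy smooth_fun_differentiable fg)
  moreover have "h differentiable (at x)" for x
    unfolding h using fg by (intro derivative_intros smooth_fun_differentiable)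
  ultimately show "(\<forall>x. h differentiable (at x)) \<and>
      (\<forall>k. pderiv_at k h \<in> {\<lambda>x. f x + c *\<^sub>R g x |f g. smooth_fun f \<and> smooth_fun g})"
    using smooth_fun_pderiv_at[OF fg(1)] smooth_fun_pderiv_at[OF fg(2)] by blast
qed

lemma smooth_fun_linear:
  fixes h :: "'b::euclidean_space \<Rightarrow> 'c::euclidean_space" and g :: "real^'n \<Rightarrow> 'b"
  assumes h: "linear h" and "smooth_fun g"
  shows "smooth_fun (\<lambda>x. h (g x))"
proof (rule smooth_fun_coinduct)
  show "(\<lambda>x. h (g x)) \<in> {\<lambda>x. h (g x) |g. smooth_fun g}"
    using assms by blast
next
  fix f assume "f \<in> {\<lambda>x. h (g x) |g. smooth_fun (g :: real^'n \<Rightarrow> 'b)}"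
  then obtain g :: "real^'n \<Rightarrow> 'b" where f: "f = (\<lambda>x. h (g x))" and g: "smooth_fun g"
    by blast
  have "pderiv_at k f = (\<lambda>x. h (pderiv_at k g x))" for k
    unfolding f by (rule ext) (rule pderiv_at_linear[OF h smooth_fun_differentiable[OF g]])
  moreover have "f differentiable (at x)" for x
    unfolding f by (rule differentiable_linear[OF h smooth_fun_differentiable[OF g]])
  ultimately show "(\<forall>x. f differentiable (at x)) \<and>
      (\<forall>k. pderiv_at k f \<in> {\<lambda>x. h (g x) |g. smooth_fun g})"
    using smooth_fun_pderiv_at[OF g] by blast
qed

lemma test_funs_smooth: "\<phi> \<in> test_funs \<Omega> \<Longrightarrow> smooth_fun \<phi>"
  by (simp add: test_funs_def)

lemma test_funs_mono: "\<phi> \<in> test_funs \<Omega> \<Longrightarrow> \<Omega> \<subseteq> \<Omega>' \<Longrightarrow> \<phi> \<in> test_funs \<Omega>'"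
  by (auto simp: test_funs_def)

lemma test_funs_outside: "\<phi> \<in> test_funs \<Omega> \<Longrightarrow> x \<notin> \<Omega> \<Longrightarrow> \<phi> x = 0"
  unfolding test_funs_def using closure_subset[of "{x. \<phi> x \<noteq> 0}"] by blast

lemma test_funsI_support:
  assumes "smooth_fun g" "compact K" "K \<subseteq> \<Omega>" "\<And>x. x \<notin> K \<Longrightarrow> g x = 0"
  shows "g \<in> test_funs \<Omega>"
proof -
  have "closure {x. g x \<noteq> 0} \<subseteq> K"
    using assms by (intro closure_minimal compact_imp_closed) auto
  moreover from this have "compact (closure {x. g x \<noteq> 0})"
    using assms(2) by (metis closed_closure compact_Int_closed inf.absorb_iff2)
  ultimately show ?thesis
    using assms by (auto simp: test_funs_def)
qed

lemma test_funs_support: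
  assumes "\<phi> \<in> test_funs \<Omega>"
  obtains K where "compact K" "closed K" "K \<subseteq> \<Omega>" "\<And>x. x \<notin> K \<Longrightarrow> \<phi> x = 0"
proof (rule that)
  show "x \<notin> closure {x. \<phi> x \<noteq> 0} \<Longrightarrow> \<phi> x = 0" for x
    using closure_subset[of "{x. \<phi> x \<noteq> 0}"] by blast
qed (use assms in \<open>auto simp: test_funs_def\<close>)

lemma test_funs_zero: "(\<lambda>x. 0) \<in> test_funs \<Omega>"
proof (rule test_funsI_support[of _ "{}"])
  have *: "pderiv_at k (\<lambda>x. 0) = (\<lambda>x. 0)" for k
    by (rule ext) (subst pderiv_at_has_derivative[OF has_derivative_const], simp)
  show "smooth_fun (\<lambda>x. 0)"
    by (rule smooth_fun_coinduct[of "{\<lambda>x. 0}"]) (auto simp: *)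
qed auto

lemma test_funs_axpy:
  assumes "f \<in> test_funs \<Omega>" "g \<in> test_funs \<Omega>"
  shows "(\<lambda>x. f x + c *\<^sub>R g x) \<in> test_funs \<Omega>"
proof -
  obtain K L where "compact K" "closed K" "K \<subseteq> \<Omega>" "\<And>x. x \<notin> K \<Longrightarrow> f x = 0"
    "compact L" "closed L" "L \<subseteq> \<Omega>" "\<And>x. x \<notin> L \<Longrightarrow> g x = 0"
    using assms by (metis test_funs_support)
  then show ?thesis
    using assms by (intro test_funsI_support[of _ "K \<union> L"] smooth_fun_axpy)
      (auto simp: test_funs_smooth)
qed

lemma test_funs_linear:
  assumes "linear h" "g \<in> test_funs \<Omega>"
  shows "(\<lambda>x. h (g x)) \<in> test_funs \<Omega>"
proof -
  obtain K where "compact K" "closed K" "K \<subseteq> \<Omega>" "\<And>x. x \<notin> K \<Longrightarrow> g x = 0"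
    using assms(2) by (metis test_funs_support)
  moreover have "smooth_fun (\<lambda>x. h (g x))"
    by (rule smooth_fun_linear[OF assms(1) test_funs_smooth[OF assms(2)]])
  ultimately show ?thesis
    using linear_0[OF assms(1)] by (intro test_funsI_support[of _ K]) auto
qed

lemma test_funs_component: "\<phi> \<in> test_funs \<Omega> \<Longrightarrow> (\<lambda>x. \<phi> x $ i) \<in> test_funs \<Omega>"
  by (rule test_funs_linear[of "\<lambda>y. y $ i"]) (auto intro: linearI)

lemma pderiv_at_component:
  "\<phi> differentiable (at x) \<Longrightarrow> pderiv_at k (\<lambda>x. \<phi> x $ i) x = pderiv_at k \<phi> x $ i"
  by (rule pderiv_at_linear[of "\<lambda>y. y $ i"]) (auto intro: linearI)

lemma pderiv_at_locally_zero:
  assumes "open U" "x \<in> U" "\<And>y. y \<in> U \<Longrightarrow> g y = 0"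
  shows "pderiv_at k g x = 0"
proof -
  have "(g has_derivative (\<lambda>_. 0)) (at x)"
    using assms by (intro has_derivative_transform_within_open[OF has_derivative_const[of 0]]) auto
  then show ?thesis
    by (simp add: pderiv_at_has_derivative)
qed

lemma test_funs_pderiv_at:
  assumes "\<phi> \<in> test_funs \<Omega>" shows "pderiv_at k \<phi> \<in> test_funs \<Omega>"
proof -
  obtain K where K: "compact K" "closed K" "K \<subseteq> \<Omega>" "\<And>x. x \<notin> K \<Longrightarrow> \<phi> x = 0"
    using assms by (metis test_funs_support)
  have "pderiv_at k \<phi> x = 0" if "x \<notin> K" for x
    using K that by (intro pderiv_at_locally_zero[of "- K"]) auto
  then show ?thesis
    using K assms by (intro test_funsI_support[of _ K] smooth_fun_pderiv_at)
      (auto simp: test_funs_smooth)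
qed

lemma test_funs_bounded_support:
  assumes "\<phi> \<in> test_funs \<Omega>"
  obtains R where "\<And>x. norm x > R \<Longrightarrow> \<phi> x = 0"
proof -
  obtain K where "compact K" "\<And>x. x \<notin> K \<Longrightarrow> \<phi> x = 0"
    using assms by (metis test_funs_support)
  moreover then obtain R where "\<And>x. x \<in> K \<Longrightarrow> norm x \<le> R"
    using compact_imp_bounded bounded_iff by metis
  ultimately show ?thesis
    using that by (metis not_less)
qed

subsection \<open>Compactly supported bump functions\<close>

lemma poly_mult_exp_minus_tendsto_0:
  "((\<lambda>x::real. x ^ k * poly p x * exp (- x)) \<longlongrightarrow> 0) at_top"
proof (induction p arbitrary: k)
  case (pCons a p)
  have "((\<lambda>x. a * (x ^ k / exp x) + x ^ Suc k * poly p x * exp (- x)) \<longlongrightarrow> a * 0 + 0) at_top"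
    by (intro tendsto_intros tendsto_power_div_exp_0 pCons.IH)
  then show ?case
    by (simp add: exp_minus field_simps)
qed simp

text \<open>The derivative of \<open>t \<mapsto> p (1/t) exp (-1/t)\<close> on \<open>t > 0\<close> is of the same form, with the
  polynomial \<open>X\<^sup>2 (p - p')\<close>; keeping \<open>p\<close> arbitrary makes the family closed under differentiation.\<close>

definition exp_profile :: "real poly \<Rightarrow> real \<Rightarrow> real" where
  "exp_profile p t = (if t > 0 then poly p (1 / t) * exp (- (1 / t)) else 0)"

lemma exp_profile_has_derivative:
  "(exp_profile p has_field_derivative exp_profile (monom 1 2 * (p - pderiv p)) t) (at t)"
proof -
  consider "t > 0" | "t < 0" | "t = 0" by linarith
  then show ?thesis
  proof cases
    case 1
    have "((\<lambda>t. poly p (1 / t) * exp (- (1 / t))) has_field_derivative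
        exp_profile (monom 1 2 * (p - pderiv p)) t) (at t)"
      using 1 by (auto intro!: derivative_eq_intros DERIV_chain2[OF poly_DERIV]
          simp: exp_profile_def poly_monom field_simps power2_eq_square)
    then show ?thesis
      by (rule has_field_derivative_transform_within_open[of _ _ _ "{0<..}"])
        (use 1 in \<open>auto simp: exp_profile_def\<close>)
  next
    case 2
    have "((\<lambda>t. 0) has_field_derivative exp_profile (monom 1 2 * (p - pderiv p)) t) (at t)"
      using 2 by (simp add: exp_profile_def)
    then show ?thesis
      by (rule has_field_derivative_transform_within_open[of _ _ _ "{..<0}"])
        (use 2 in \<open>auto simp: exp_profile_def\<close>)
  next
    case 3
    have "((\<lambda>h. exp_profile p h / h) \<longlongrightarrow> 0) (at 0)"
    proof (rule filterlim_split_at)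
      have "\<forall>\<^sub>F h::real in at_left 0. 0 = exp_profile p h / h"
        unfolding eventually_at_left_field by (intro exI[of _ "-1"]) (auto simp: exp_profile_def)
      then show "((\<lambda>h. exp_profile p h / h) \<longlongrightarrow> 0) (at_left 0)"
        by (rule Lim_transform_eventually[OF tendsto_const])
      have "\<forall>\<^sub>F x::real in at_top. x ^ 1 * poly p x * exp (- x) = exp_profile p (inverse x) / inverse x"
        using eventually_gt_at_top[of 0]
        by eventually_elim (simp add: exp_profile_def field_simps)
      then have "((\<lambda>x. exp_profile p (inverse x) / inverse x) \<longlongrightarrow> 0) at_top"
        by (rule Lim_transform_eventually[OF poly_mult_exp_minus_tendsto_0])
      then show "((\<lambda>h. exp_profile p h / h) \<longlongrightarrow> 0) (at_right 0)"
        by (simp add: filterlim_at_right_to_top)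
    qed
    then show ?thesis
      using 3 by (simp add: has_field_derivative_iff exp_profile_def)
  qed
qed

text \<open>The family to which \<open>smooth_fun_coinduct\<close> is applied: products of profiles in single coordinates
  are what is wanted, and closing under sums and products makes it stable under the product rule.\<close>

inductive_set bump_algebra :: "(real^'n \<Rightarrow> real) set" where
  const: "(\<lambda>x. c) \<in> bump_algebra"
| profile: "(\<lambda>x. exp_profile p (\<alpha> * x $ k + \<beta>)) \<in> bump_algebra"
| add: "\<lbrakk>f \<in> bump_algebra; g \<in> bump_algebra\<rbrakk> \<Longrightarrow> (\<lambda>x. f x + g x) \<in> bump_algebra"
| mult: "\<lbrakk>f \<in> bump_algebra; g \<in> bump_algebra\<rbrakk> \<Longrightarrow> (\<lambda>x. f x * g x) \<in> bump_algebra"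

lemma bump_algebra_smooth: "g \<in> bump_algebra \<Longrightarrow> smooth_fun g"
proof (rule smooth_fun_coinduct[of bump_algebra])
  fix g :: "real^'n \<Rightarrow> real" assume "g \<in> bump_algebra"
  then show "(\<forall>x. g differentiable (at x)) \<and> (\<forall>k. pderiv_at k g \<in> bump_algebra)"
  proof induction
    case (const c)
    have "pderiv_at k (\<lambda>x. c) = (\<lambda>x. 0)" for k :: 'n
      by (rule ext) (subst pderiv_at_has_derivative[OF has_derivative_const], simp)
    then show ?case by (simp add: bump_algebra.const)
  next
    case (profile p \<alpha> k \<beta>)
    let ?q = "monom 1 2 * (p - pderiv p)"
    have d: "((\<lambda>x. exp_profile p (\<alpha> * x $ k + \<beta>)) has_derivative
        (\<lambda>y. exp_profile ?q (\<alpha> * x $ k + \<beta>) * (\<alpha> * y $ k))) (at x)" for x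
    proof -
      have "((\<lambda>x. \<alpha> * x $ k + \<beta>) has_derivative (\<lambda>y. \<alpha> * y $ k)) (at x)"
        by (auto intro!: derivative_eq_intros bounded_linear_imp_has_derivative bounded_linear_vec_nth)
      from has_derivative_compose[OF this
          exp_profile_has_derivative[unfolded has_field_derivative_def]]
      show ?thesis by simp
    qed
    have "pderiv_at j (\<lambda>x. exp_profile p (\<alpha> * x $ k + \<beta>)) =
        (\<lambda>x. exp_profile ?q (\<alpha> * x $ k + \<beta>) * (\<alpha> * axis j 1 $ k))" for j
      by (rule ext) (rule pderiv_at_has_derivative[OF d])
    then show ?case
      using d by (auto simp: differentiable_def intro!: bump_algebra.intros)
  next
    case (add f g)
    have "pderiv_at k (\<lambda>x. f x + g x) = (\<lambda>x. pderiv_at k f x + pderiv_at k g x)" for k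
      using pderiv_at_axpy[of f _ g k 1] add by auto
    then show ?case
      using add by (auto intro!: bump_algebra.add)
  next
    case (mult f g)
    have "pderiv_at k (\<lambda>x. f x * g x) = (\<lambda>x. f x * pderiv_at k g x + pderiv_at k f x * g x)" for k
      using pderiv_at_mult[of f _ g k] mult by auto
    then show ?case
      using mult by (auto intro!: bump_algebra.add bump_algebra.mult)
  qed
qed

lemma bump_algebra_prod:
  "finite I \<Longrightarrow> (\<And>i. i \<in> I \<Longrightarrow> f i \<in> bump_algebra) \<Longrightarrow> (\<lambda>x. \<Prod>i\<in>I. f i x) \<in> bump_algebra"
proof (induction I rule: finite_induct)
  case (insert i I)
  then show ?case
    by (simp add: bump_algebra.mult)
qed (simp add: bump_algebra.const)

text \<open>As \<open>m\<close> grows, these functions increase to the indicator function of the open box.\<close>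

definition box_bump :: "real^'n \<Rightarrow> real^'n \<Rightarrow> real \<Rightarrow> real^'n \<Rightarrow> real" where
  "box_bump a b m x =
     (\<Prod>k\<in>UNIV. exp_profile 1 (m * (x $ k - a $ k)) * exp_profile 1 (m * (b $ k - x $ k)))"

lemma exp_profile_1_bounds: "0 \<le> exp_profile 1 t" "exp_profile 1 t \<le> 1"
  by (auto simp: exp_profile_def)

lemma box_bump_bounds: "0 \<le> box_bump a b m x" "box_bump a b m x \<le> 1"
  unfolding box_bump_def
  by (auto intro!: prod_nonneg prod_le_1 mult_le_one simp: exp_profile_1_bounds)

lemma box_bump_pos: "m > 0 \<Longrightarrow> x \<in> box a b \<Longrightarrow> box_bump a b m x > 0"
  unfolding box_bump_def mem_box_cart by (intro prod_pos) (auto simp: exp_profile_def)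

lemma box_bump_outside: "m > 0 \<Longrightarrow> x \<notin> box a b \<Longrightarrow> box_bump a b m x = 0"
proof -
  assume "m > 0" "x \<notin> box a b"
  then obtain k where "x $ k \<le> a $ k \<or> b $ k \<le> x $ k"
    by (auto simp: mem_box_cart not_less)
  then have "exp_profile 1 (m * (x $ k - a $ k)) * exp_profile 1 (m * (b $ k - x $ k)) = 0"
    using \<open>m > 0\<close> by (auto simp: exp_profile_def zero_less_mult_iff)
  then show ?thesis
    unfolding box_bump_def by (intro prod_zero) auto
qed

lemma box_bump_test_fun:
  assumes "m > 0" "cbox a b \<subseteq> \<Omega>"
  shows "box_bump a b m \<in> test_funs \<Omega>"
proof (rule test_funsI_support[of _ "cbox a b"])
  have "(\<lambda>x. exp_profile 1 (m * x $ k + - (m * a $ k)) * exp_profile 1 ((- m) * x $ k + m * b $ k))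
      \<in> bump_algebra" for k
    by (intro bump_algebra.intros)
  then have "(\<lambda>x. exp_profile 1 (m * (x $ k - a $ k)) * exp_profile 1 (m * (b $ k - x $ k)))
      \<in> bump_algebra" for k
    by (simp add: right_diff_distrib)
  then show "smooth_fun (box_bump a b m)"
    unfolding box_bump_def by (intro bump_algebra_smooth bump_algebra_prod) auto
  show "box_bump a b m x = 0" if "x \<notin> cbox a b" for x
    using box_bump_outside[OF assms(1)] that box_subset_cbox by blast
qed (use assms in \<open>auto simp: compact_cbox\<close>)

text \<open>On the open box each factor \<open>exp (-1/(m t))\<close> tends to \<open>1\<close>, because scaling the argument by \<open>m\<close> amounts to
  taking an \<open>m\<close>-th root.\<close>

lemma box_bump_tendsto: "(\<lambda>n. box_bump a b (real (Suc n)) x) \<longlonglongrightarrow> indicator (box a b) x"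
proof (cases "x \<in> box a b")
  case True
  have "(\<lambda>n. exp_profile 1 (real (Suc n) * t)) \<longlonglongrightarrow> 1" if "t > 0" for t
  proof -
    have "(\<lambda>n. exp (- (inverse (real (Suc n)) * (1 / t)))) \<longlonglongrightarrow> exp (- (0 * (1 / t)))"
      by (intro tendsto_intros LIMSEQ_inverse_real_of_nat)
    then show ?thesis
      using that by (simp add: exp_profile_def inverse_eq_divide zero_less_mult_iff)
  qed
  then have "(\<lambda>n. box_bump a b (real (Suc n)) x) \<longlonglongrightarrow> (\<Prod>k\<in>(UNIV::'a set). 1 * 1)"
    unfolding box_bump_def using True by (intro tendsto_prod tendsto_mult) (auto simp: mem_box_cart)
  then show ?thesis
    using True by simp
qed (simp add: box_bump_outside)

section \<open>The fundamental lemma of the calculus of variations\<close>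

lemma finite_measure_open_bounded:
  fixes \<Omega> :: "(real^'n) set"
  assumes "open \<Omega>" "bounded \<Omega>" shows "finite_measure (lebesgue_on \<Omega>)"
  using assms by (intro finite_measure_lebesgue_on bounded_set_imp_lmeasurable) auto

lemma integral_box_eq_0:
  fixes g :: "real^'n \<Rightarrow> real"
  assumes g: "integrable (lebesgue_on \<Omega>) g" and \<Omega>: "\<Omega> \<in> sets lebesgue"
    and ortho: "\<And>\<phi>. \<phi> \<in> test_funs \<Omega> \<Longrightarrow> integral\<^sup>L (lebesgue_on \<Omega>) (\<lambda>x. g x * \<phi> x) = 0"
    and sub: "cbox a b \<subseteq> \<Omega>"
  shows "integral (cbox a b) g = 0"
proof -
  have sub': "box a b \<subseteq> \<Omega>"
    using sub box_subset_cbox by blast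
  have meas: "box_bump a b (real (Suc n)) \<in> borel_measurable (lebesgue_on \<Omega>)" for n
  proof -
    have "box_bump a b (real (Suc n)) \<in> test_funs \<Omega>"
      by (intro box_bump_test_fun sub) simp
    then show ?thesis
      by (intro continuous_imp_measurable_on_sets_lebesgue continuous_on_smooth_fun \<Omega>)
        (auto simp: test_funs_smooth)
  qed
  have ind: "indicat_real (box a b) \<in> borel_measurable (lebesgue_on \<Omega>)"
    by (intro measurable_restrict_space1 borel_measurable_indicator) auto
  have "(\<lambda>n. integral\<^sup>L (lebesgue_on \<Omega>) (\<lambda>x. g x * box_bump a b (real (Suc n)) x))
      \<longlonglongrightarrow> integral\<^sup>L (lebesgue_on \<Omega>) (\<lambda>x. g x * indicator (box a b) x)"
  proof (rule integral_dominated_convergence[where w = "\<lambda>x. norm (g x)"])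
    show "AE x in lebesgue_on \<Omega>. (\<lambda>n. g x * box_bump a b (real (Suc n)) x)
        \<longlonglongrightarrow> g x * indicator (box a b) x"
      by (intro AE_I2 tendsto_mult tendsto_const box_bump_tendsto)
    show "AE x in lebesgue_on \<Omega>. norm (g x * box_bump a b (real (Suc n)) x) \<le> norm (g x)" for n
      by (intro AE_I2) (simp add: abs_mult box_bump_bounds mult_left_le)
  qed (use g meas ind in auto)
  moreover have "integral\<^sup>L (lebesgue_on \<Omega>) (\<lambda>x. g x * box_bump a b (real (Suc n)) x) = 0" for n
    by (intro ortho box_bump_test_fun sub) simp
  ultimately have 0: "integral\<^sup>L (lebesgue_on \<Omega>) (\<lambda>x. g x * indicator (box a b) x) = 0"
    by (simp add: LIMSEQ_const_iff)
  have "integrable (lebesgue_on \<Omega>) (\<lambda>x. g x * indicator (box a b) x)"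
    by (rule Bochner_Integration.integrable_bound[OF g borel_measurable_times[OF _ ind]])
      (use g in \<open>auto simp: indicator_def\<close>)
  then have "((\<lambda>x. g x * indicator (box a b) x) has_integral 0) \<Omega>"
    using has_integral_integral_lebesgue_on[OF _ \<Omega>] 0 by metis
  moreover have "(\<lambda>x. g x * indicator (box a b) x) = (\<lambda>x. if x \<in> box a b then g x else 0)"
    by (auto simp: indicator_def)
  ultimately have "(g has_integral 0) (box a b)"
    using has_integral_restrict[OF sub', of g 0] by simp
  then show ?thesis
    by (simp add: has_integral_open_interval integral_unique)
qed

text \<open>A function orthogonal to all test functions has integral zero over every cube in \<open>\<Omega>\<close>,
  because the indicator function of an open box is a bounded limit of test functions; by Lebesgue
  differentiation along shrinking cubes it vanishes almost everywhere.\<close>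

lemma fundamental_lemma_of_calculus_of_variations:
  fixes g :: "real^'n \<Rightarrow> real"
  assumes "open \<Omega>" and g: "integrable (lebesgue_on \<Omega>) g"
    and ortho: "\<And>\<phi>. \<phi> \<in> test_funs \<Omega> \<Longrightarrow> integral\<^sup>L (lebesgue_on \<Omega>) (\<lambda>x. g x * \<phi> x) = 0"
  shows "AE x in lebesgue_on \<Omega>. g x = 0"
proof -
  have \<Omega>: "\<Omega> \<in> sets lebesgue"
    using \<open>open \<Omega>\<close> by auto
  define G where "G x = (if x \<in> \<Omega> then g x else 0)" for x
  have "g integrable_on \<Omega>"
    using g \<Omega> by (rule integrable_on_lebesgue_on)
  then have "G integrable_on UNIV"
    unfolding G_def by (simp add: Henstock_Kurzweil_Integration.integrable_restrict_UNIV)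
  then have "G integrable_on cbox a b" for a b
    by (rule integrable_on_subcbox) auto
  then obtain N where N: "negligible N"
    "\<And>x e. \<lbrakk>x \<notin> N; 0 < e\<rbrakk> \<Longrightarrow> \<exists>d>0. \<forall>h. 0 < h \<and> h < d \<longrightarrow>
       norm (integral (cbox x (x + h *\<^sub>R One)) G /\<^sub>R h ^ DIM(real^'n) - G x) < e"
    using integrable_ccontinuous_explicit[of G] by blast
  have "g x = 0" if x: "x \<in> \<Omega>" "x \<notin> N" for x
  proof (rule ccontr)
    assume "g x \<noteq> 0"
    then have "\<bar>g x\<bar> > 0" by simp
    then obtain d where d: "d > 0" "\<And>h. \<lbrakk>0 < h; h < d\<rbrakk> \<Longrightarrow>
       norm (integral (cbox x (x + h *\<^sub>R One)) G /\<^sub>R h ^ DIM(real^'n) - G x) < \<bar>g x\<bar>"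
      using N(2)[OF x(2)] by blast
    obtain r where r: "r > 0" "ball x r \<subseteq> \<Omega>"
      using \<open>open \<Omega>\<close> x(1) open_contains_ball by blast
    define c where "c = norm (One :: real^'n) + 1"
    have c: "c > 0" by (simp add: c_def add_nonneg_pos)
    \<comment> \<open>Small enough for the differentiation theorem and for the cube to stay inside \<open>ball x r\<close>.\<close>
    define h where "h = min (d / 2) (r / c)"
    have h: "0 < h" "h < d" "h * c \<le> r"
      using d(1) r(1) c by (auto simp: h_def min_def field_simps)
    have "cbox x (x + h *\<^sub>R One) \<subseteq> ball x r"
    proof
      fix y assume y: "y \<in> cbox x (x + h *\<^sub>R One)"
      have "norm (y - x) \<le> norm (h *\<^sub>R (One :: real^'n))"
      proof (rule norm_le_componentwise)
        fix b :: "real^'n" assume "b \<in> Basis"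
        then have "x \<bullet> b \<le> y \<bullet> b" "y \<bullet> b \<le> x \<bullet> b + h"
          using y by (auto simp: mem_box inner_add_left)
        then show "\<bar>(y - x) \<bullet> b\<bar> \<le> \<bar>(h *\<^sub>R One) \<bullet> b\<bar>"
          using \<open>b \<in> Basis\<close> h(1) by (simp add: inner_diff_left)
      qed
      also have "\<dots> < h * c"
        using h(1) by (simp add: c_def)
      finally show "y \<in> ball x r"
        using h(3) by (simp add: dist_norm norm_minus_commute)
    qed
    then have sub: "cbox x (x + h *\<^sub>R One) \<subseteq> \<Omega>"
      using r(2) by blast
    have "integral (cbox x (x + h *\<^sub>R One)) G = integral (cbox x (x + h *\<^sub>R One)) g"
      using sub by (intro Henstock_Kurzweil_Integration.integral_cong) (auto simp: G_def)
    also have "\<dots> = 0"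
      by (rule integral_box_eq_0[OF g \<Omega> ortho sub])
    finally show False
      using d(2)[OF h(1,2)] x(1) by (simp add: G_def)
  qed
  then have "AE x in lebesgue. x \<in> \<Omega> \<longrightarrow> g x = 0"
    using N(1) by (auto simp: negligible_iff_null_sets dest!: AE_not_in elim!: eventually_mono)
  then show ?thesis
    using \<Omega> by (simp add: AE_restrict_space_iff)
qed

section \<open>Integration by parts for compactly supported functions\<close>

definition C1_fun :: "(real^'n \<Rightarrow> real) \<Rightarrow> bool" where
  "C1_fun g \<longleftrightarrow> (\<forall>x. g differentiable (at x)) \<and> (\<forall>k. continuous_on UNIV (pderiv_at k g))"

lemma smooth_fun_C1_fun: "smooth_fun g \<Longrightarrow> C1_fun g"
  by (simp add: C1_fun_def smooth_fun_differentiable continuous_on_smooth_fun smooth_fun_pderiv_at)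

lemma C1_fun_continuous: "C1_fun g \<Longrightarrow> continuous_on S g"
  by (meson C1_fun_def continuous_at_imp_continuous_on differentiable_imp_continuous_within)

lemma C1_fun_mult:
  assumes "C1_fun f" "C1_fun g" shows "C1_fun (\<lambda>x. f x * g x)"
proof -
  have "pderiv_at k (\<lambda>x. f x * g x) = (\<lambda>x. f x * pderiv_at k g x + pderiv_at k f x * g x)" for k
    using assms by (intro ext pderiv_at_mult) (auto simp: C1_fun_def)
  then show ?thesis
    using assms C1_fun_continuous[OF assms(1), of UNIV] C1_fun_continuous[OF assms(2), of UNIV]
    unfolding C1_fun_def by (auto intro!: continuous_intros)
qed

lemma pderiv_at_coordinate: "pderiv_at k (\<lambda>x. x $ j) x = (if j = k then 1 else 0)"
  by (subst pderiv_at_has_derivative[OF bounded_linear_imp_has_derivative[OF bounded_linear_vec_nth]])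
    (simp add: axis_def)

lemma C1_fun_coordinate: "C1_fun (\<lambda>x. x $ j)"
proof -
  have "(\<lambda>x::real^'a. x $ j) differentiable (at x)" for x
    unfolding differentiable_def
    using bounded_linear_imp_has_derivative[OF bounded_linear_vec_nth] by blast
  moreover have "pderiv_at k (\<lambda>x. x $ j) = (\<lambda>x. if j = k then 1 else 0)" for k
    by (rule ext) (rule pderiv_at_coordinate)
  ultimately show ?thesis
    unfolding C1_fun_def by auto
qed

lemma differentiable_translate:
  "g differentiable (at (x + c)) \<Longrightarrow> (\<lambda>x. g (x + c)) differentiable (at x)"
  "g differentiable (at (x + c)) \<Longrightarrow> pderiv_at k (\<lambda>x. g (x + c)) x = pderiv_at k g (x + c)"
proof -
  assume "g differentiable (at (x + c))"
  then have g: "(g has_derivative frechet_derivative g (at (x + c))) (at (x + c))"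
    by (simp add: frechet_derivative_works)
  have "((\<lambda>x. x + c) has_derivative (\<lambda>y. y)) (at x)"
    by (auto intro!: derivative_eq_intros)
  from has_derivative_compose[OF this g]
  have "((\<lambda>x. g (x + c)) has_derivative frechet_derivative g (at (x + c))) (at x)" .
  then show "(\<lambda>x. g (x + c)) differentiable (at x)"
    "pderiv_at k (\<lambda>x. g (x + c)) x = pderiv_at k g (x + c)"
    using pderiv_at_has_derivative by (auto simp: differentiable_def pderiv_at_def[of k g])
qed

lemma continuous_on_translate:
  fixes f :: "'a::real_normed_vector \<Rightarrow> 'b::topological_space"
  assumes "continuous_on UNIV f" shows "continuous_on UNIV (\<lambda>x. f (x + c))"
  by (rule continuous_on_compose2[OF assms]) (auto intro: continuous_intros)

lemma C1_fun_translate: "C1_fun g \<Longrightarrow> C1_fun (\<lambda>x. g (x + c))"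
proof -
  assume g: "C1_fun g"
  then have "pderiv_at k (\<lambda>x. g (x + c)) = (\<lambda>x. pderiv_at k g (x + c))" for k
    by (intro ext differentiable_translate) (simp add: C1_fun_def)
  moreover have "continuous_on UNIV (\<lambda>x. pderiv_at k g (x + c))" for k
    using g by (intro continuous_on_translate) (simp add: C1_fun_def)
  ultimately show ?thesis
    using g by (auto simp: C1_fun_def intro!: differentiable_translate)
qed

lemma C1_fun_line_derivative:
  assumes "g differentiable (at (x + t *\<^sub>R axis k 1))"
  shows "((\<lambda>t. g (x + t *\<^sub>R axis k 1)) has_field_derivative pderiv_at k g (x + t *\<^sub>R axis k 1)) (at t)"
proof -
  have g: "(g has_derivative frechet_derivative g (at (x + t *\<^sub>R axis k 1))) (at (x + t *\<^sub>R axis k 1))"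
    using assms by (simp add: frechet_derivative_works)
  have "((\<lambda>t. x + t *\<^sub>R axis k 1) has_derivative (\<lambda>s. s *\<^sub>R axis k 1)) (at t)"
    by (auto intro!: derivative_eq_intros)
  from has_derivative_compose[OF this g] show ?thesis
    unfolding has_field_derivative_def pderiv_at_def
    by (simp add: linear_cmul[OF has_derivative_linear[OF g]] mult_commute_abs)
qed

definition diff_quotient :: "'n \<Rightarrow> nat \<Rightarrow> (real^'n \<Rightarrow> real) \<Rightarrow> real^'n \<Rightarrow> real" where
  "diff_quotient k n g x = real (Suc n) * (g (x + (1 / real (Suc n)) *\<^sub>R axis k 1) - g x)"

lemma diff_quotient_tendsto:
  assumes "C1_fun g" shows "(\<lambda>n. diff_quotient k n g x) \<longlonglongrightarrow> pderiv_at k g x"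
proof -
  have "((\<lambda>t. g (x + t *\<^sub>R axis k 1)) has_field_derivative pderiv_at k g x) (at 0)"
    using C1_fun_line_derivative[of g x 0 k] assms by (simp add: C1_fun_def)
  then have "((\<lambda>h. (g (x + h *\<^sub>R axis k 1) - g x) / h) \<longlongrightarrow> pderiv_at k g x) (at 0)"
    by (simp add: DERIV_def)
  moreover have "filterlim (\<lambda>n. 1 / real (Suc n)) (at 0) sequentially"
    using LIMSEQ_inverse_real_of_nat
    by (intro filterlim_atI) (auto simp: inverse_eq_divide)
  ultimately have "(\<lambda>n. (g (x + (1 / real (Suc n)) *\<^sub>R axis k 1) - g x) / (1 / real (Suc n)))
      \<longlonglongrightarrow> pderiv_at k g x"
    by (rule filterlim_compose)
  then show ?thesis
    by (simp add: diff_quotient_def[abs_def] mult.commute)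
qed

lemma diff_quotient_bound:
  assumes g: "C1_fun g" and M: "\<And>y. \<bar>pderiv_at k g y\<bar> \<le> M"
  shows "\<bar>diff_quotient k n g x\<bar> \<le> M"
proof -
  define h where "h = 1 / real (Suc n)"
  have h: "h > 0" by (simp add: h_def)
  have "\<exists>z. 0 < z \<and> z < h \<and> g (x + h *\<^sub>R axis k 1) - g (x + 0 *\<^sub>R axis k 1)
      = (h - 0) * pderiv_at k g (x + z *\<^sub>R axis k 1)"
    using g h by (intro MVT2 C1_fun_line_derivative) (auto simp: C1_fun_def)
  then obtain z where "g (x + h *\<^sub>R axis k 1) - g x = h * pderiv_at k g (x + z *\<^sub>R axis k 1)"
    by auto
  then have "diff_quotient k n g x = pderiv_at k g (x + z *\<^sub>R axis k 1)"
    unfolding diff_quotient_def by (simp add: h_def)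
  then show ?thesis using M by simp
qed

lemma diff_quotient_outside:
  assumes "\<And>x. norm x > R \<Longrightarrow> g x = 0" "norm x > R + 1"
  shows "diff_quotient k n g x = 0"
proof -
  have "norm ((1 / real (Suc n)) *\<^sub>R axis k (1::real)) \<le> 1"
    by (simp add: norm_axis_1)
  then have "norm (x + (1 / real (Suc n)) *\<^sub>R axis k 1) > R"
    using norm_diff_ineq[of x "(1 / real (Suc n)) *\<^sub>R axis k 1"] assms(2) by linarith
  then show ?thesis
    using assms by (simp add: diff_quotient_def)
qed

lemma integrable_bounded_support:
  fixes f :: "real^'n \<Rightarrow> real"
  assumes "continuous_on UNIV f" "\<And>x. norm x > R \<Longrightarrow> f x = 0"
  shows "integrable lborel f"
proof -
  have "integrable lborel (\<lambda>x. indicator (cball 0 R) x *\<^sub>R f x)"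
    using assms(1) by (intro borel_integrable_compact) (auto intro: continuous_on_subset)
  moreover have "(\<lambda>x. indicator (cball 0 R) x *\<^sub>R f x) = f"
    by (rule ext) (use assms(2) in \<open>auto simp: indicator_def not_le\<close>)
  ultimately show ?thesis by simp
qed

lemma bounded_on_cball:
  fixes f :: "real^'n \<Rightarrow> real"
  assumes "continuous_on UNIV f"
  obtains M where "0 \<le> M" "\<And>x. norm x \<le> R \<Longrightarrow> \<bar>f x\<bar> \<le> M"
proof -
  have "bounded (f ` cball 0 R)"
    using assms by (intro compact_imp_bounded compact_continuous_image)
      (auto intro: continuous_on_subset)
  then obtain M where "\<forall>x\<in>cball 0 R. \<bar>f x\<bar> \<le> M"
    by (auto simp: bounded_iff)
  then have "\<And>x. norm x \<le> R \<Longrightarrow> \<bar>f x\<bar> \<le> \<bar>M\<bar>"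
    by (metis abs_ge_self mem_cball_0 order_trans)
  then show ?thesis using that[of "\<bar>M\<bar>"] by simp
qed

lemma pderiv_at_outside:
  assumes "\<And>x. norm x > R \<Longrightarrow> g x = 0" "norm x > R"
  shows "pderiv_at k g x = 0"
proof (rule pderiv_at_locally_zero[of "- cball 0 R"])
  show "open (- cball 0 R :: (real^'a) set)"
    using closed_cball open_Compl by blast
qed (use assms in \<open>auto simp: not_le\<close>)

text \<open>Dominated convergence: by the mean value theorem the difference quotients are bounded by the maximum
  of the partial derivative, and they all vanish outside the ball of radius \<open>R + 1\<close>.\<close>

lemma integral_diff_quotient_tendsto:
  assumes g: "C1_fun g" and supp: "\<And>x. norm x > R \<Longrightarrow> g x = 0" and \<psi>: "continuous_on UNIV \<psi>"
  shows "(\<lambda>n. LINT x|lborel. diff_quotient k n g x * \<psi> x)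
           \<longlonglongrightarrow> (LINT x|lborel. pderiv_at k g x * \<psi> x)"
proof -
  have meas: "\<psi> \<in> borel_measurable lborel" "g \<in> borel_measurable lborel"
    "pderiv_at k g \<in> borel_measurable lborel"
    using g \<psi> C1_fun_continuous[OF g]
    by (auto simp: C1_fun_def intro!: borel_measurable_continuous_onI)
  obtain M where M: "0 \<le> M" "\<And>x. norm x \<le> R \<Longrightarrow> \<bar>pderiv_at k g x\<bar> \<le> M"
    using bounded_on_cball g unfolding C1_fun_def by metis
  then have M': "\<bar>pderiv_at k g x\<bar> \<le> M" for x
    using pderiv_at_outside[of R g x k] supp by (cases "norm x \<le> R") auto
  obtain L where L: "0 \<le> L" "\<And>x. norm x \<le> R + 1 \<Longrightarrow> \<bar>\<psi> x\<bar> \<le> L"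
    using bounded_on_cball \<psi> by metis
  have shift: "(\<lambda>x. g (x + c)) \<in> borel_measurable lborel" for c
    using C1_fun_continuous[OF C1_fun_translate[OF g]]
    by (auto intro!: borel_measurable_continuous_onI)
  show ?thesis
  proof (rule integral_dominated_convergence[where w = "\<lambda>x. indicator (cball 0 (R + 1)) x *\<^sub>R (M * L)"])
    show "integrable lborel (\<lambda>x. indicator (cball 0 (R + 1)) x *\<^sub>R (M * L))"
      by (intro borel_integrable_compact) auto
    show "AE x in lborel. (\<lambda>n. diff_quotient k n g x * \<psi> x) \<longlonglongrightarrow> pderiv_at k g x * \<psi> x"
      by (intro AE_I2 tendsto_mult tendsto_const diff_quotient_tendsto g)
    show "AE x in lborel. norm (diff_quotient k n g x * \<psi> x)
        \<le> indicator (cball 0 (R + 1)) x *\<^sub>R (M * L)" for n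
    proof (rule AE_I2)
      fix x
      show "norm (diff_quotient k n g x * \<psi> x) \<le> indicator (cball 0 (R + 1)) x *\<^sub>R (M * L)"
      proof (cases "norm x \<le> R + 1")
        case True
        have "\<bar>diff_quotient k n g x\<bar> * \<bar>\<psi> x\<bar> \<le> M * L"
          using diff_quotient_bound[OF g M'] L M(1) True by (intro mult_mono) auto
        then show ?thesis
          using True by (simp add: abs_mult)
      qed (use diff_quotient_outside[of R g x k n] supp in \<open>auto simp: indicator_def\<close>)
    qed
    show "(\<lambda>x. diff_quotient k n g x * \<psi> x) \<in> borel_measurable lborel" for n
      unfolding diff_quotient_def using meas shift by (intro borel_measurable_times) auto
  qed (use meas in auto)
qed

lemma integral_translate:
  fixes g :: "real^'n \<Rightarrow> real"
  shows "g \<in> borel_measurable borel \<Longrightarrow> (LINT x|lborel. g (x + c)) = (LINT x|lborel. g x)"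
  using integral_distr[of "(+) c" lborel borel g] by (simp add: lborel_distr_plus add.commute)

text \<open>The integral of every difference quotient vanishes by translation invariance.\<close>

lemma integral_pderiv_at_eq_0:
  assumes g: "C1_fun g" and supp: "\<And>x. norm x > R \<Longrightarrow> g x = 0"
  shows "(LINT x|lborel. pderiv_at k g x) = 0"
proof -
  have int: "integrable lborel g"
    by (rule integrable_bounded_support[OF C1_fun_continuous[OF g] supp])
  have int': "integrable lborel (\<lambda>x. g (x + c))" for c
  proof (rule integrable_bounded_support[OF C1_fun_continuous[OF C1_fun_translate[OF g]]])
    fix x :: "real^'a" assume "norm x > R + norm c"
    then show "g (x + c) = 0"
      using norm_diff_ineq[of x c] by (intro supp) linarith
  qed
  have "(LINT x|lborel. diff_quotient k n g x * 1) = 0" for n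
    using int int' integral_translate[OF borel_measurable_integrable[OF int, simplified]]
    by (simp add: diff_quotient_def)
  then show ?thesis
    using integral_diff_quotient_tendsto[OF g supp, where \<psi> = "\<lambda>x. 1" and k = k]
    by (simp add: LIMSEQ_const_iff)
qed

text \<open>Only the products need bounded support, so that \<open>f\<close> may be a coordinate function (Poincare) as well as a
  component of a test function (weak gradients).\<close>

lemma integration_by_parts:
  assumes f: "C1_fun f" and g: "C1_fun g" and supp: "\<And>x. norm x > R \<Longrightarrow> f x * g x = 0"
    and supp_f: "\<And>x. norm x > R \<Longrightarrow> pderiv_at k f x * g x = 0"
  shows "(LINT x|lborel. f x * pderiv_at k g x) = - (LINT x|lborel. pderiv_at k f x * g x)"
proof -
  have eq: "pderiv_at k (\<lambda>x. f x * g x) = (\<lambda>x. f x * pderiv_at k g x + pderiv_at k f x * g x)"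
    using f g by (intro ext pderiv_at_mult) (auto simp: C1_fun_def)
  have supp_g: "f x * pderiv_at k g x = 0" if "norm x > R" for x
    using pderiv_at_outside[of R "\<lambda>x. f x * g x" x k] supp that
    unfolding eq supp_f[OF that] add_0_right by blast
  have "integrable lborel (\<lambda>x. f x * pderiv_at k g x)"
    using f g C1_fun_continuous[OF f] by (intro integrable_bounded_support[OF _ supp_g])
      (auto simp: C1_fun_def intro!: continuous_intros)
  moreover have "integrable lborel (\<lambda>x. pderiv_at k f x * g x)"
    using f g C1_fun_continuous[OF g] by (intro integrable_bounded_support[OF _ supp_f])
      (auto simp: C1_fun_def intro!: continuous_intros)
  ultimately show ?thesis
    using integral_pderiv_at_eq_0[OF C1_fun_mult[OF f g], of R k] supp by (simp add: eq)
qed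

text \<open>After one integration by parts this is the symmetry of second derivatives, in weak form. One
  of the two derivatives is taken as a limit of difference quotients, since these commute with the
  other derivative.\<close>

lemma integral_pderiv_at_swap:
  fixes f g :: "real^'n \<Rightarrow> real"
  assumes f: "f \<in> test_funs UNIV" and g: "g \<in> test_funs UNIV"
  shows "(LINT x|lborel. pderiv_at j f x * pderiv_at i g x)
       = (LINT x|lborel. pderiv_at i f x * pderiv_at j g x)"
proof -
  obtain R where R: "\<And>x. norm x > R \<Longrightarrow> f x = 0"
    using f test_funs_bounded_support by blast
  have C: "C1_fun f" "C1_fun g" "C1_fun (pderiv_at i f)" "C1_fun (pderiv_at i g)"
    using test_funs_smooth[OF f] test_funs_smooth[OF g]
    by (simp_all add: smooth_fun_C1_fun smooth_fun_pderiv_at)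
  have R1: "pderiv_at i f x = 0" if "norm x > R" for x
    using pderiv_at_outside[of R f x i] R that by blast
  have R2: "pderiv_at j (pderiv_at i f) x = 0" if "norm x > R" for x
    using pderiv_at_outside[of R "pderiv_at i f" x j] R1 that by blast
  have dq: "C1_fun (diff_quotient j n f)"
    "pderiv_at i (diff_quotient j n f) = diff_quotient j n (pderiv_at i f)" for n
  proof -
    define c where "c = (1 / real (Suc n)) *\<^sub>R axis j (1::real)"
    have eq: "diff_quotient j n f = (\<lambda>x. real (Suc n) *\<^sub>R (f (x + c) + (-1) *\<^sub>R f x))"
      by (rule ext) (simp add: diff_quotient_def c_def)
    have lin: "linear (\<lambda>y::real. real (Suc n) *\<^sub>R y)"
      by (rule linear_scaleR)
    have df: "f differentiable (at x)" "(\<lambda>x. f (x + c)) differentiable (at x)"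
      "(\<lambda>x. f (x + c) + (-1) *\<^sub>R f x) differentiable (at x)" for x
      using C(1) by (auto simp: C1_fun_def intro!: derivative_intros differentiable_translate)
    have pd: "pderiv_at k (diff_quotient j n f) x
        = real (Suc n) *\<^sub>R (pderiv_at k f (x + c) + (-1) *\<^sub>R pderiv_at k f x)" for k x
      unfolding eq pderiv_at_linear[OF lin df(3)] pderiv_at_axpy[OF df(2) df(1)]
      using df(1) by (simp add: differentiable_translate(2))
    show "pderiv_at i (diff_quotient j n f) = diff_quotient j n (pderiv_at i f)"
      by (rule ext) (simp add: pd diff_quotient_def[of _ _ "pderiv_at i f"] c_def)
    have "diff_quotient j n f differentiable (at x)" for x
      unfolding eq by (rule differentiable_linear[OF lin df(3)])
    moreover have "continuous_on UNIV (\<lambda>x. pderiv_at k f (x + c))" for k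
      using C(1) by (intro continuous_on_translate) (simp add: C1_fun_def)
    ultimately show "C1_fun (diff_quotient j n f)"
      using C(1) unfolding C1_fun_def pd[abs_def] by (auto intro!: continuous_intros)
  qed
  have "(\<lambda>n. LINT x|lborel. diff_quotient j n f x * pderiv_at i g x)
      \<longlonglongrightarrow> (LINT x|lborel. pderiv_at j f x * pderiv_at i g x)"
    using C by (intro integral_diff_quotient_tendsto[OF _ R]) (auto intro: C1_fun_continuous)
  moreover have "(\<lambda>n. - (LINT x|lborel. diff_quotient j n (pderiv_at i f) x * g x))
      \<longlonglongrightarrow> - (LINT x|lborel. pderiv_at j (pderiv_at i f) x * g x)"
    using C pderiv_at_outside[OF R]
    by (intro tendsto_minus integral_diff_quotient_tendsto[of _ R]) (auto intro: C1_fun_continuous)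
  moreover have "(LINT x|lborel. diff_quotient j n f x * pderiv_at i g x)
      = - (LINT x|lborel. diff_quotient j n (pderiv_at i f) x * g x)" for n
    unfolding dq(2)[symmetric]
    by (rule integration_by_parts[OF dq(1) C(2), of "R + 1"])
      (auto simp: dq(2) diff_quotient_outside[OF R] diff_quotient_outside[OF pderiv_at_outside[OF R]])
  moreover have "- (LINT x|lborel. pderiv_at j (pderiv_at i f) x * g x)
      = (LINT x|lborel. pderiv_at i f x * pderiv_at j g x)"
    by (rule integration_by_parts[OF C(3) C(2), of R, symmetric])
      (simp_all add: R1 R2)
  ultimately show ?thesis
    using LIMSEQ_unique by fastforce
qed

section \<open>Weak gradients\<close>

lemma test_funs_sum:
  "finite I \<Longrightarrow> (\<And>i. i \<in> I \<Longrightarrow> f i \<in> test_funs \<Omega>) \<Longrightarrow> (\<lambda>x. \<Sum>i\<in>I. f i x) \<in> test_funs \<Omega>"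
proof (induction I rule: finite_induct)
  case (insert i I)
  then show ?case
    using test_funs_axpy[of "f i" \<Omega> "\<lambda>x. \<Sum>i\<in>I. f i x" 1] by simp
qed (simp add: test_funs_zero)

locale bounded_open =
  fixes \<Omega> :: "(real^'n) set"
  assumes open_domain: "open \<Omega>" and bounded_domain: "bounded \<Omega>"
begin

lemma domain_lebesgue: "\<Omega> \<in> sets lebesgue"
  using open_domain by auto

lemma finite_measure_domain: "finite_measure (lebesgue_on \<Omega>)"
  using open_domain bounded_domain by (rule finite_measure_open_bounded)

lemma test_funs_L2: "\<phi> \<in> test_funs \<Omega> \<Longrightarrow> \<phi> \<in> L2 \<Omega>"
proof -
  assume \<phi>: "\<phi> \<in> test_funs \<Omega>"
  interpret finite_measure "lebesgue_on \<Omega>" by (rule finite_measure_domain)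
  have cont: "continuous_on S \<phi>" for S
    using \<phi> by (intro continuous_on_smooth_fun test_funs_smooth)
  have "bounded (\<phi> ` closure \<Omega>)"
    using bounded_domain by (intro compact_imp_bounded compact_continuous_image cont) simp
  then obtain M where M: "\<And>x. x \<in> closure \<Omega> \<Longrightarrow> norm (\<phi> x) \<le> M"
    by (auto simp: bounded_iff)
  show ?thesis
  proof (rule L2_I_bound)
    show "\<phi> \<in> borel_measurable (lebesgue_on \<Omega>)"
      by (rule continuous_imp_measurable_on_sets_lebesgue[OF cont domain_lebesgue])
    show "(norm (\<phi> x))\<^sup>2 \<le> M\<^sup>2" if "x \<in> \<Omega>" for x
      using M[of x] that closure_subset by (intro power_mono) auto
  qed simp
qed

lemma integral_domain_eq_lborel:
  fixes f :: "real^'n \<Rightarrow> real"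
  assumes "continuous_on UNIV f" "\<And>x. x \<notin> \<Omega> \<Longrightarrow> f x = 0"
  shows "integral\<^sup>L (lebesgue_on \<Omega>) f = (LINT x|lborel. f x)"
proof -
  have "integral\<^sup>L (lebesgue_on \<Omega>) f = integral\<^sup>L lebesgue (\<lambda>x. if x \<in> \<Omega> then f x else 0)"
    by (rule Lebesgue_Measure.integral_restrict_UNIV[OF domain_lebesgue, symmetric])
  also have "(\<lambda>x. if x \<in> \<Omega> then f x else 0) = f"
    using assms(2) by auto
  also have "integral\<^sup>L lebesgue f = (LINT x|lborel. f x)"
    using assms(1) by (intro integral_completion) (simp add: borel_measurable_continuous_onI)
  finally show ?thesis .
qed

lemma L2_inner_test_funs:
  fixes f g :: "real^'n \<Rightarrow> real"
  assumes "continuous_on UNIV f" "g \<in> test_funs \<Omega>"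
  shows "L2_inner \<Omega> f g = (LINT x|lborel. f x * g x)"
    "L2_inner \<Omega> g f = (LINT x|lborel. g x * f x)"
  using assms(1) continuous_on_smooth_fun[OF test_funs_smooth[OF assms(2)]]
    test_funs_outside[OF assms(2)]
  unfolding L2_inner_def inner_real_def
  by (auto intro!: integral_domain_eq_lborel continuous_intros)

lemma is_weak_grad_iff:
  "is_weak_grad \<Omega> v G \<longleftrightarrow> (\<forall>\<phi>\<in>test_funs \<Omega>. \<forall>i j.
     L2_inner \<Omega> (\<lambda>x. v x $ i) (pderiv_at j \<phi>) = - L2_inner \<Omega> (\<lambda>x. G x $ i $ j) \<phi>)"
  by (simp add: is_weak_grad_def L2_inner_def)

lemma L2_component2:
  fixes G :: "real^'n \<Rightarrow> real^'a^'b"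
  shows "G \<in> L2 \<Omega> \<Longrightarrow> (\<lambda>x. G x $ i $ j) \<in> L2 \<Omega>"
  using L2_norm_component_le(1)[OF L2_norm_component_le(1)[of G \<Omega> i], of j] by simp

text \<open>The components of the difference are orthogonal to all test functions.\<close>

lemma is_weak_grad_unique:
  assumes "is_weak_grad \<Omega> v G" "is_weak_grad \<Omega> v G'" and G: "G \<in> L2 \<Omega>" "G' \<in> L2 \<Omega>"
  shows "AE x in lebesgue_on \<Omega>. G x = G' x"
proof -
  have "AE x in lebesgue_on \<Omega>. G x $ i $ j - G' x $ i $ j = 0" for i j
  proof (rule fundamental_lemma_of_calculus_of_variations[OF open_domain])
    have d: "(\<lambda>x. G x $ i $ j - G' x $ i $ j) \<in> L2 \<Omega>"
      using G by (intro L2.closed_diff L2_component2)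
    then show "integrable (lebesgue_on \<Omega>) (\<lambda>x. G x $ i $ j - G' x $ i $ j)"
      by (rule L2_imp_integrable[OF finite_measure_domain])
    fix \<phi> :: "real^'n \<Rightarrow> real" assume \<phi>: "\<phi> \<in> test_funs \<Omega>"
    have "L2_inner \<Omega> (\<lambda>x. G x $ i $ j - G' x $ i $ j) \<phi> = 0"
      using assms(1,2) \<phi> test_funs_L2[OF \<phi>] G
      by (simp add: L2.diff_left L2_component2 is_weak_grad_iff)
    then show "integral\<^sup>L (lebesgue_on \<Omega>) (\<lambda>x. (G x $ i $ j - G' x $ i $ j) * \<phi> x) = 0"
      by (simp add: L2_inner_def)
  qed
  then have "AE x in lebesgue_on \<Omega>. \<forall>i j. G x $ i $ j - G' x $ i $ j = 0"
    by (simp add: AE_all_countable)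
  then show ?thesis
    by eventually_elim (simp add: vec_eq_iff)
qed

lemma is_weak_grad_axpy:
  assumes "is_weak_grad \<Omega> v G" "is_weak_grad \<Omega> w H"
    and "v \<in> L2 \<Omega>" "w \<in> L2 \<Omega>" "G \<in> L2 \<Omega>" "H \<in> L2 \<Omega>"
  shows "is_weak_grad \<Omega> (\<lambda>x. v x + c *\<^sub>R w x) (\<lambda>x. G x + c *\<^sub>R H x)"
  unfolding is_weak_grad_iff
proof (intro ballI allI)
  fix \<phi> :: "real^'n \<Rightarrow> real" and i j assume \<phi>: "\<phi> \<in> test_funs \<Omega>"
  have mem: "\<phi> \<in> L2 \<Omega>" "pderiv_at j \<phi> \<in> L2 \<Omega>"
    "(\<lambda>x. v x $ i) \<in> L2 \<Omega>" "(\<lambda>x. w x $ i) \<in> L2 \<Omega>"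
    "(\<lambda>x. G x $ i $ j) \<in> L2 \<Omega>" "(\<lambda>x. H x $ i $ j) \<in> L2 \<Omega>"
    using \<phi> assms test_funs_L2 test_funs_pderiv_at L2_component2 L2_norm_component_le(1) by blast+
  have "L2_inner \<Omega> (\<lambda>x. v x $ i + c *\<^sub>R w x $ i) (pderiv_at j \<phi>)
      = - L2_inner \<Omega> (\<lambda>x. G x $ i $ j + c *\<^sub>R H x $ i $ j) \<phi>"
    using assms(1,2) \<phi> by (simp only: L2.axpy_left mem) (simp add: is_weak_grad_iff)
  then show "L2_inner \<Omega> (\<lambda>x. (v x + c *\<^sub>R w x) $ i) (pderiv_at j \<phi>)
      = - L2_inner \<Omega> (\<lambda>x. (G x + c *\<^sub>R H x) $ i $ j) \<phi>"
    by simp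
qed

lemma H1_L2: "v \<in> H1 \<Omega> \<Longrightarrow> v \<in> L2 \<Omega>"
  by (simp add: H1_def)

lemma weak_grad:
  assumes "v \<in> H1 \<Omega>" shows "weak_grad \<Omega> v \<in> L2 \<Omega>" "is_weak_grad \<Omega> v (weak_grad \<Omega> v)"
proof -
  have "\<exists>G. G \<in> L2 \<Omega> \<and> is_weak_grad \<Omega> v G"
    using assms by (auto simp: H1_def)
  from someI_ex[OF this] show "weak_grad \<Omega> v \<in> L2 \<Omega>" "is_weak_grad \<Omega> v (weak_grad \<Omega> v)"
    by (auto simp: weak_grad_def)
qed

lemma H1_I: "\<lbrakk>v \<in> L2 \<Omega>; G \<in> L2 \<Omega>; is_weak_grad \<Omega> v G\<rbrakk> \<Longrightarrow> v \<in> H1 \<Omega>"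
  by (auto simp: H1_def)

lemma weak_grad_eq_AE:
  assumes "v \<in> L2 \<Omega>" "G \<in> L2 \<Omega>" "is_weak_grad \<Omega> v G"
  shows "AE x in lebesgue_on \<Omega>. weak_grad \<Omega> v x = G x"
  using assms H1_I weak_grad by (intro is_weak_grad_unique) auto

lemma H1_axpy:
  assumes "v \<in> H1 \<Omega>" "w \<in> H1 \<Omega>" shows "(\<lambda>x. v x + c *\<^sub>R w x) \<in> H1 \<Omega>"
proof -
  note g = weak_grad[OF assms(1)] weak_grad[OF assms(2)] H1_L2[OF assms(1)] H1_L2[OF assms(2)]
  show ?thesis
    by (rule H1_I[OF L2_axpy[OF g(5,6)] L2_axpy[OF g(1,3)] is_weak_grad_axpy[OF g(2,4,5,6,1,3)]])
qed

lemma weak_grad_axpy: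
  assumes "v \<in> H1 \<Omega>" "w \<in> H1 \<Omega>"
  shows "AE x in lebesgue_on \<Omega>.
    weak_grad \<Omega> (\<lambda>x. v x + c *\<^sub>R w x) x = weak_grad \<Omega> v x + c *\<^sub>R weak_grad \<Omega> w x"
  using assms by (intro weak_grad_eq_AE L2_axpy is_weak_grad_axpy weak_grad H1_L2)

text \<open>All inner products below have this form: \<open>p\<close> and \<open>q\<close> are the identity, the symmetric part, or the
  elasticity tensor. Under the integral it does not matter that \<open>weak_grad_axpy\<close> holds only almost
  everywhere.\<close>

lemma weak_grad_form_axpy_left:
  fixes p q :: "real^'n^'n \<Rightarrow> 'b::euclidean_space"
  assumes "linear p" "linear q" and mem: "u \<in> H1 \<Omega>" "v \<in> H1 \<Omega>" "w \<in> H1 \<Omega>"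
  shows "L2_inner \<Omega> (\<lambda>x. p (weak_grad \<Omega> (\<lambda>x. u x + c *\<^sub>R v x) x)) (\<lambda>x. q (weak_grad \<Omega> w x))
    = L2_inner \<Omega> (\<lambda>x. p (weak_grad \<Omega> u x)) (\<lambda>x. q (weak_grad \<Omega> w x))
      + c * L2_inner \<Omega> (\<lambda>x. p (weak_grad \<Omega> v x)) (\<lambda>x. q (weak_grad \<Omega> w x))"
proof -
  note L2s = L2_linear[OF assms(1) weak_grad(1)] L2_linear[OF assms(2) weak_grad(1)]
  have "AE x in lebesgue_on \<Omega>. p (weak_grad \<Omega> (\<lambda>x. u x + c *\<^sub>R v x) x)
      = p (weak_grad \<Omega> u x) + c *\<^sub>R p (weak_grad \<Omega> v x)"
    using weak_grad_axpy[OF mem(1,2), of c]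
    by eventually_elim (simp add: linear_add[OF assms(1)] linear_cmul[OF assms(1)])
  then have "L2_inner \<Omega> (\<lambda>x. p (weak_grad \<Omega> (\<lambda>x. u x + c *\<^sub>R v x) x)) (\<lambda>x. q (weak_grad \<Omega> w x))
    = L2_inner \<Omega> (\<lambda>x. p (weak_grad \<Omega> u x) + c *\<^sub>R p (weak_grad \<Omega> v x)) (\<lambda>x. q (weak_grad \<Omega> w x))"
    using mem by (intro L2_inner_cong_AE L2_axpy L2s H1_axpy) auto
  then show ?thesis
    using mem by (simp add: L2.axpy_left L2s)
qed

section \<open>The spaces \<open>H\<^sup>1\<close> and \<open>H\<^sup>1\<^sub>0\<close>\<close>

definition H1_inner :: "(real^'n \<Rightarrow> real^'n) \<Rightarrow> (real^'n \<Rightarrow> real^'n) \<Rightarrow> real" where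
  "H1_inner v w = L2_inner \<Omega> v w + L2_inner \<Omega> (weak_grad \<Omega> v) (weak_grad \<Omega> w)"

lemma H1_zero: "(\<lambda>x. 0) \<in> H1 \<Omega>"
proof (rule H1_I)
  show "is_weak_grad \<Omega> (\<lambda>x. 0) (\<lambda>x. 0)"
    by (simp add: is_weak_grad_def)
qed (rule L2.closed_zero)+

lemma semi_inner_H1: "semi_inner (H1 \<Omega>) H1_inner"
proof
  show "H1 \<Omega> \<noteq> {}"
    using H1_zero by blast
  show "H1_inner (\<lambda>x. f x + c *\<^sub>R g x) h = H1_inner f h + c * H1_inner g h"
    if "f \<in> H1 \<Omega>" "g \<in> H1 \<Omega>" "h \<in> H1 \<Omega>" for f g h c
    using weak_grad_form_axpy_left[OF linear_id linear_id that, of c] that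
    by (simp add: H1_inner_def L2.axpy_left H1_L2 algebra_simps)
  show "H1_inner f g = H1_inner g f" if "f \<in> H1 \<Omega>" "g \<in> H1 \<Omega>" for f g
    using that by (simp add: H1_inner_def L2.sym H1_L2 weak_grad)
  show "0 \<le> H1_inner f f" if "f \<in> H1 \<Omega>" for f
    using that by (simp add: H1_inner_def L2.nonneg H1_L2 weak_grad)
qed (rule H1_axpy)

sublocale H1: semi_inner "H1 \<Omega>" H1_inner
  rewrites "semi_inner.nrm H1_inner = H1_norm \<Omega>"
proof -
  show "semi_inner (H1 \<Omega>) H1_inner" by (rule semi_inner_H1)
  show "semi_inner.nrm H1_inner = H1_norm \<Omega>"
    by (rule ext) (simp add: semi_inner.nrm_def[OF semi_inner_H1] H1_norm_def H1_inner_def)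
qed

lemma H1_norm_power2:
  "v \<in> H1 \<Omega> \<Longrightarrow> (H1_norm \<Omega> v)\<^sup>2 = (L2_norm \<Omega> v)\<^sup>2 + (L2_norm \<Omega> (weak_grad \<Omega> v))\<^sup>2"
  by (simp add: H1.nrm_power2 H1_inner_def L2.nrm_power2 H1_L2 weak_grad)

lemma L2_norm_le_H1_norm:
  assumes "v \<in> H1 \<Omega>"
  shows "L2_norm \<Omega> v \<le> H1_norm \<Omega> v" "L2_norm \<Omega> (weak_grad \<Omega> v) \<le> H1_norm \<Omega> v"
  using H1_norm_power2[OF assms] H1.nrm_nonneg[OF assms]
  by (auto intro!: power2_le_imp_le[of _ "H1_norm \<Omega> v"])

lemma L2_norm_cong_AE:
  assumes "AE x in lebesgue_on \<Omega>. f x = g x" "f \<in> L2 \<Omega>" "g \<in> L2 \<Omega>"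
  shows "L2_norm \<Omega> f = L2_norm \<Omega> g"
  unfolding L2_norm_def using assms by (simp add: L2_inner_cong_AE[OF assms(1,1)])

lemma L2_norm_weak_grad_diff:
  assumes "v \<in> H1 \<Omega>" "w \<in> H1 \<Omega>"
  shows "L2_norm \<Omega> (weak_grad \<Omega> (\<lambda>x. v x - w x))
    = L2_norm \<Omega> (\<lambda>x. weak_grad \<Omega> v x - weak_grad \<Omega> w x)"
  using weak_grad_axpy[OF assms, of "-1"] assms
  by (intro L2_norm_cong_AE L2.closed_diff weak_grad H1.closed_diff) auto

text \<open>The weak gradient is a closed operator: its definition is a family of identities between continuous
  functionals of \<open>v\<close> and \<open>G\<close>.\<close>

lemma is_weak_grad_limit:
  assumes lim: "(\<lambda>n. L2_norm \<Omega> (\<lambda>x. s n x - v x)) \<longlonglongrightarrow> 0"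
    "(\<lambda>n. L2_norm \<Omega> (\<lambda>x. S n x - G x)) \<longlonglongrightarrow> 0"
    and mem: "\<And>n. s n \<in> L2 \<Omega>" "v \<in> L2 \<Omega>" "\<And>n. S n \<in> L2 \<Omega>" "G \<in> L2 \<Omega>"
    and grad: "\<And>n. is_weak_grad \<Omega> (s n) (S n)"
  shows "is_weak_grad \<Omega> v G"
  unfolding is_weak_grad_iff
proof (intro ballI allI)
  fix \<phi> :: "real^'n \<Rightarrow> real" and i j assume \<phi>: "\<phi> \<in> test_funs \<Omega>"
  have diff: "(\<lambda>x. s n x - v x) \<in> L2 \<Omega>" "(\<lambda>x. S n x - G x) \<in> L2 \<Omega>" for n
    using mem by (auto intro!: L2.closed_diff)
  have le: "L2_norm \<Omega> (\<lambda>x. s n x $ i - v x $ i) \<le> L2_norm \<Omega> (\<lambda>x. s n x - v x)"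
    "L2_norm \<Omega> (\<lambda>x. S n x $ i $ j - G x $ i $ j) \<le> L2_norm \<Omega> (\<lambda>x. S n x - G x)" for n
    using L2_norm_component_le(2)[OF diff(1), where i = i]
      L2_norm_component_le(2)[OF diff(2), where i = i]
      L2_norm_component_le(2)[OF L2_norm_component_le(1)[OF diff(2), where i = i], where i = j]
    by (simp, force intro: order_trans)
  have nn: "0 \<le> L2_norm \<Omega> (\<lambda>x. s n x $ i - v x $ i)"
    "0 \<le> L2_norm \<Omega> (\<lambda>x. S n x $ i $ j - G x $ i $ j)" for n
    using mem by (auto intro!: L2.nrm_nonneg L2.closed_diff L2_component2 L2_norm_component_le(1))
  have "(\<lambda>n. L2_norm \<Omega> (\<lambda>x. s n x $ i - v x $ i)) \<longlonglongrightarrow> 0"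
    by (rule tendsto_sandwich[OF _ _ tendsto_const lim(1)]) (simp_all add: le nn)
  then have 1: "(\<lambda>n. L2_inner \<Omega> (\<lambda>x. s n x $ i) (pderiv_at j \<phi>))
      \<longlonglongrightarrow> L2_inner \<Omega> (\<lambda>x. v x $ i) (pderiv_at j \<phi>)"
    by (intro L2.tendsto_left L2_norm_component_le(1) mem test_funs_L2[OF test_funs_pderiv_at[OF \<phi>]])
  have "(\<lambda>n. L2_norm \<Omega> (\<lambda>x. S n x $ i $ j - G x $ i $ j)) \<longlonglongrightarrow> 0"
    by (rule tendsto_sandwich[OF _ _ tendsto_const lim(2)]) (simp_all add: le nn)
  then have 2: "(\<lambda>n. L2_inner \<Omega> (\<lambda>x. S n x $ i $ j) \<phi>) \<longlonglongrightarrow> L2_inner \<Omega> (\<lambda>x. G x $ i $ j) \<phi>"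
    by (intro L2.tendsto_left L2_component2 mem test_funs_L2[OF \<phi>])
  have "L2_inner \<Omega> (\<lambda>x. s n x $ i) (pderiv_at j \<phi>) = - L2_inner \<Omega> (\<lambda>x. S n x $ i $ j) \<phi>" for n
    using grad \<phi> by (simp add: is_weak_grad_iff)
  then show "L2_inner \<Omega> (\<lambda>x. v x $ i) (pderiv_at j \<phi>) = - L2_inner \<Omega> (\<lambda>x. G x $ i $ j) \<phi>"
    using LIMSEQ_unique[OF 1] tendsto_minus[OF 2] by simp
qed

lemma H1_complete:
  assumes s: "\<And>n. s n \<in> H1 \<Omega>"
    and Cau: "\<And>e. e > 0 \<Longrightarrow> \<exists>N. \<forall>m\<ge>N. \<forall>n\<ge>N. H1_norm \<Omega> (\<lambda>x. s m x - s n x) < e"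
  obtains v where "v \<in> H1 \<Omega>" "(\<lambda>n. H1_norm \<Omega> (\<lambda>x. s n x - v x)) \<longlonglongrightarrow> 0"
proof -
  let ?G = "\<lambda>n. weak_grad \<Omega> (s n)"
  have "L2_norm \<Omega> (\<lambda>x. s m x - s n x) \<le> H1_norm \<Omega> (\<lambda>x. s m x - s n x)"
    "L2_norm \<Omega> (\<lambda>x. ?G m x - ?G n x) \<le> H1_norm \<Omega> (\<lambda>x. s m x - s n x)" for m n
    using L2_norm_le_H1_norm[OF H1.closed_diff[OF s s]] L2_norm_weak_grad_diff[OF s s] by metis+
  then have Cau': "\<exists>N. \<forall>m\<ge>N. \<forall>n\<ge>N. L2_norm \<Omega> (\<lambda>x. s m x - s n x) < e"
    "\<exists>N. \<forall>m\<ge>N. \<forall>n\<ge>N. L2_norm \<Omega> (\<lambda>x. ?G m x - ?G n x) < e" if "e > 0" for e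
    using Cau[OF that] by (meson le_less_trans)+
  have mem: "s n \<in> L2 \<Omega>" "?G n \<in> L2 \<Omega>" "is_weak_grad \<Omega> (s n) (?G n)" for n
    using s by (auto intro: H1_L2 weak_grad)
  obtain v where v: "v \<in> L2 \<Omega>" "(\<lambda>n. L2_norm \<Omega> (\<lambda>x. s n x - v x)) \<longlonglongrightarrow> 0"
    using L2_complete[OF finite_measure_domain mem(1) Cau'(1)] by blast
  obtain G where G: "G \<in> L2 \<Omega>" "(\<lambda>n. L2_norm \<Omega> (\<lambda>x. ?G n x - G x)) \<longlonglongrightarrow> 0"
    using L2_complete[OF finite_measure_domain mem(2) Cau'(2)] by blast
  have wg: "is_weak_grad \<Omega> v G"
    using is_weak_grad_limit[OF v(2) G(2)] mem v(1) G(1) by blast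
  have vH: "v \<in> H1 \<Omega>"
    using v(1) G(1) wg by (rule H1_I)
  have "L2_norm \<Omega> (weak_grad \<Omega> (\<lambda>x. s n x - v x)) = L2_norm \<Omega> (\<lambda>x. ?G n x - G x)" for n
    using weak_grad_eq_AE[OF v(1) G(1) wg] mem G vH s unfolding L2_norm_weak_grad_diff[OF s vH]
    by (intro L2_norm_cong_AE L2.closed_diff weak_grad) auto
  then have eq: "(H1_norm \<Omega> (\<lambda>x. s n x - v x))\<^sup>2
      = (L2_norm \<Omega> (\<lambda>x. s n x - v x))\<^sup>2 + (L2_norm \<Omega> (\<lambda>x. ?G n x - G x))\<^sup>2" for n
    by (simp add: H1_norm_power2 H1.closed_diff s vH)
  have "(\<lambda>n. (H1_norm \<Omega> (\<lambda>x. s n x - v x))\<^sup>2) \<longlonglongrightarrow> 0\<^sup>2 + 0\<^sup>2"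
    unfolding eq by (intro tendsto_intros v G)
  then have "(\<lambda>n. sqrt ((H1_norm \<Omega> (\<lambda>x. s n x - v x))\<^sup>2)) \<longlonglongrightarrow> sqrt 0"
    by (intro tendsto_real_sqrt) simp
  then have "(\<lambda>n. H1_norm \<Omega> (\<lambda>x. s n x - v x)) \<longlonglongrightarrow> 0"
    by (simp add: H1.nrm_nonneg H1.closed_diff s vH)
  with vH show ?thesis by (rule that)
qed

lemma H10_H1: "v \<in> H10 \<Omega> \<Longrightarrow> v \<in> H1 \<Omega>"
  by (simp add: H10_def)

definition classical_grad :: "(real^'n \<Rightarrow> real^'n) \<Rightarrow> real^'n \<Rightarrow> real^'n^'n" where
  "classical_grad \<phi> x = (\<chi> i j. pderiv_at j \<phi> x $ i)"

text \<open>The gradient is a sum over the directions \<open>k\<close> of linear images of \<open>\<partial>\<^sub>k \<phi>\<close>, and each of these is a test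
  function.\<close>

lemma classical_grad_test_fun:
  assumes \<phi>: "\<phi> \<in> test_funs \<Omega>" shows "classical_grad \<phi> \<in> test_funs \<Omega>"
proof -
  define L where "L k v = (\<chi> i j. if j = k then v $ i else 0)" for k :: 'n and v :: "real^'n"
  have "linear (L k)" for k
    by (rule linearI) (simp_all add: L_def vec_eq_iff)
  then have "(\<lambda>x. L k (pderiv_at k \<phi> x)) \<in> test_funs \<Omega>" for k
    using test_funs_linear test_funs_pderiv_at[OF \<phi>] by blast
  then have "(\<lambda>x. \<Sum>k\<in>UNIV. L k (pderiv_at k \<phi> x)) \<in> test_funs \<Omega>"
    by (rule test_funs_sum[OF finite])
  moreover have "(\<lambda>x. \<Sum>k\<in>UNIV. L k (pderiv_at k \<phi> x)) = classical_grad \<phi>"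
    by (rule ext) (simp add: classical_grad_def L_def vec_eq_iff)
  ultimately show ?thesis by simp
qed

lemma classical_grad_component:
  "\<phi> \<in> test_funs \<Omega> \<Longrightarrow> classical_grad \<phi> x $ i $ j = pderiv_at j (\<lambda>x. \<phi> x $ i) x"
  by (simp add: classical_grad_def pderiv_at_component smooth_fun_differentiable test_funs_smooth)

lemma is_weak_grad_classical_grad:
  assumes \<phi>: "\<phi> \<in> test_funs \<Omega>" shows "is_weak_grad \<Omega> \<phi> (classical_grad \<phi>)"
  unfolding is_weak_grad_iff
proof (intro ballI allI)
  fix \<psi> :: "real^'n \<Rightarrow> real" and i j assume \<psi>: "\<psi> \<in> test_funs \<Omega>"
  have \<phi>i: "(\<lambda>x. \<phi> x $ i) \<in> test_funs \<Omega>"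
    by (rule test_funs_component[OF \<phi>])
  have cont: "continuous_on UNIV g" if "g \<in> test_funs \<Omega>" for g :: "real^'n \<Rightarrow> real"
    using that by (intro continuous_on_smooth_fun test_funs_smooth)
  obtain R where R: "\<And>x. norm x > R \<Longrightarrow> \<psi> x = 0"
    using test_funs_bounded_support[OF \<psi>] by blast
  have "L2_inner \<Omega> (\<lambda>x. \<phi> x $ i) (pderiv_at j \<psi>) = (LINT x|lborel. \<phi> x $ i * pderiv_at j \<psi> x)"
    by (rule L2_inner_test_funs(1)[OF cont[OF \<phi>i] test_funs_pderiv_at[OF \<psi>]])
  also have "\<dots> = - (LINT x|lborel. pderiv_at j (\<lambda>x. \<phi> x $ i) x * \<psi> x)"
    by (rule integration_by_parts[where R = R])
      (simp_all add: R smooth_fun_C1_fun test_funs_smooth[OF \<psi>] test_funs_smooth[OF \<phi>i])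
  also have "\<dots> = - L2_inner \<Omega> (\<lambda>x. classical_grad \<phi> x $ i $ j) \<psi>"
    unfolding classical_grad_component[OF \<phi>]
    by (subst L2_inner_test_funs(1)[OF cont[OF test_funs_pderiv_at[OF \<phi>i]] \<psi>]) simp
  finally show "L2_inner \<Omega> (\<lambda>x. \<phi> x $ i) (pderiv_at j \<psi>)
      = - L2_inner \<Omega> (\<lambda>x. classical_grad \<phi> x $ i $ j) \<psi>" .
qed

lemma weak_grad_test_fun:
  "\<phi> \<in> test_funs \<Omega> \<Longrightarrow> AE x in lebesgue_on \<Omega>. weak_grad \<Omega> \<phi> x = classical_grad \<phi> x"
  by (intro weak_grad_eq_AE test_funs_L2 is_weak_grad_classical_grad classical_grad_test_fun)

lemma test_funs_H1: "\<phi> \<in> test_funs \<Omega> \<Longrightarrow> \<phi> \<in> H1 \<Omega>"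
  by (rule H1_I[OF test_funs_L2 test_funs_L2[OF classical_grad_test_fun] is_weak_grad_classical_grad])

lemma H1_norm_zero: "H1_norm \<Omega> (\<lambda>x. 0) = 0"
  using H1.nrm_scale[OF H1_zero, of 0] by simp

lemma test_funs_H10: "\<phi> \<in> test_funs \<Omega> \<Longrightarrow> \<phi> \<in> H10 \<Omega>"
  using test_funs_H1 H1_norm_zero by (auto simp: H10_def intro!: bexI[of _ \<phi>])

lemma H10_approx:
  assumes "v \<in> H10 \<Omega>" "e > 0"
  obtains \<phi> where "\<phi> \<in> test_funs \<Omega>" "H1_norm \<Omega> (\<lambda>x. v x - \<phi> x) < e"
  using assms unfolding H10_def by blast

text \<open>\<open>H\<^sup>1\<^sub>0\<close> is the closure of the test functions, hence closed in \<open>H\<^sup>1\<close>.\<close>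

lemma H10_I_approx:
  assumes "v \<in> H1 \<Omega>" "\<And>e. e > 0 \<Longrightarrow> \<exists>w\<in>H10 \<Omega>. H1_norm \<Omega> (\<lambda>x. v x - w x) < e"
  shows "v \<in> H10 \<Omega>"
proof -
  have "\<exists>\<phi>\<in>test_funs \<Omega>. H1_norm \<Omega> (\<lambda>x. v x - \<phi> x) < e" if "e > 0" for e
  proof -
    obtain w where w: "w \<in> H10 \<Omega>" "H1_norm \<Omega> (\<lambda>x. v x - w x) < e / 2"
      using assms(2)[of "e / 2"] \<open>e > 0\<close> by auto
    obtain \<phi> where \<phi>: "\<phi> \<in> test_funs \<Omega>" "H1_norm \<Omega> (\<lambda>x. w x - \<phi> x) < e / 2"
      using H10_approx[OF w(1), of "e / 2"] \<open>e > 0\<close> by auto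
    have "H1_norm \<Omega> (\<lambda>x. (v x - w x) + (w x - \<phi> x)) < e"
      using H1.nrm_add_le[OF H1.closed_diff[OF assms(1) H10_H1[OF w(1)]]
          H1.closed_diff[OF H10_H1[OF w(1)] test_funs_H1[OF \<phi>(1)]]] w(2) \<phi>(2)
      by linarith
    then show ?thesis
      using \<phi>(1) by auto
  qed
  then show ?thesis
    using assms(1) by (auto simp: H10_def)
qed

lemma H10_axpy:
  assumes v: "v \<in> H10 \<Omega>" and w: "w \<in> H10 \<Omega>"
  shows "(\<lambda>x. v x + c *\<^sub>R w x) \<in> H10 \<Omega>"
proof (rule H10_I_approx)
  show "(\<lambda>x. v x + c *\<^sub>R w x) \<in> H1 \<Omega>"
    using v w by (intro H1_axpy H10_H1)
  fix e :: real assume "e > 0"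
  obtain \<phi> where \<phi>: "\<phi> \<in> test_funs \<Omega>" "H1_norm \<Omega> (\<lambda>x. v x - \<phi> x) < e / 2"
    using H10_approx[OF v, of "e / 2"] \<open>e > 0\<close> by auto
  have "e / (2 * (\<bar>c\<bar> + 1)) > 0"
    using \<open>e > 0\<close> by simp
  then obtain \<psi> where \<psi>: "\<psi> \<in> test_funs \<Omega>" "H1_norm \<Omega> (\<lambda>x. w x - \<psi> x) < e / (2 * (\<bar>c\<bar> + 1))"
    using H10_approx[OF w] by blast
  have d: "(\<lambda>x. v x - \<phi> x) \<in> H1 \<Omega>" "(\<lambda>x. w x - \<psi> x) \<in> H1 \<Omega>"
    using v w \<phi>(1) \<psi>(1) by (blast intro: H1.closed_diff H10_H1 test_funs_H1)+
  have "\<bar>c\<bar> * H1_norm \<Omega> (\<lambda>x. w x - \<psi> x) \<le> (\<bar>c\<bar> + 1) * H1_norm \<Omega> (\<lambda>x. w x - \<psi> x)"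
    using H1.nrm_nonneg[OF d(2)] by (intro mult_right_mono) auto
  also have "\<dots> < e / 2"
    using \<psi>(2) by (simp add: field_simps)
  finally have "H1_norm \<Omega> (\<lambda>x. (v x - \<phi> x) + c *\<^sub>R (w x - \<psi> x)) < e"
    using H1.nrm_add_le[OF d(1) H1.closed_scale[OF d(2), of c]] \<phi>(2)
    unfolding H1.nrm_scale[OF d(2)] by linarith
  moreover have "(\<lambda>x. (v x - \<phi> x) + c *\<^sub>R (w x - \<psi> x))
      = (\<lambda>x. v x + c *\<^sub>R w x - (\<phi> x + c *\<^sub>R \<psi> x))"
    by (simp add: fun_eq_iff algebra_simps)
  ultimately show "\<exists>z\<in>H10 \<Omega>. H1_norm \<Omega> (\<lambda>x. v x + c *\<^sub>R w x - z x) < e"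
    using test_funs_H10[OF test_funs_axpy[OF \<phi>(1) \<psi>(1), of c]]
    by (intro bexI[of _ "\<lambda>x. \<phi> x + c *\<^sub>R \<psi> x"]) simp_all
qed

lemma H10_complete:
  assumes s: "\<And>n. s n \<in> H10 \<Omega>"
    and Cau: "\<And>e. e > 0 \<Longrightarrow> \<exists>N. \<forall>m\<ge>N. \<forall>n\<ge>N. H1_norm \<Omega> (\<lambda>x. s m x - s n x) < e"
  obtains v where "v \<in> H10 \<Omega>" "(\<lambda>n. H1_norm \<Omega> (\<lambda>x. s n x - v x)) \<longlonglongrightarrow> 0"
proof -
  obtain v where v: "v \<in> H1 \<Omega>" "(\<lambda>n. H1_norm \<Omega> (\<lambda>x. s n x - v x)) \<longlonglongrightarrow> 0"
    using H1_complete[OF H10_H1[OF s] Cau] by blast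
  have "v \<in> H10 \<Omega>"
  proof (rule H10_I_approx[OF v(1)])
    fix e :: real assume "e > 0"
    then obtain n where "H1_norm \<Omega> (\<lambda>x. s n x - v x) < e"
      using order_tendstoD(2)[OF v(2)] eventually_happens'[OF sequentially_bot] by blast
    then show "\<exists>w\<in>H10 \<Omega>. H1_norm \<Omega> (\<lambda>x. v x - w x) < e"
      using s[of n] H1.nrm_minus_commute[OF v(1) H10_H1[OF s[of n]]]
      by (intro bexI[of _ "s n"]) simp_all
  qed
  then show ?thesis using v(2) by (rule that)
qed

section \<open>The inequalities of Poincare and Korn\<close>

text \<open>As \<open>\<partial>\<^sub>k x\<^sub>k = 1\<close>, integration by parts gives \<open>\<integral> g\<^sup>2 = - 2 \<integral> x\<^sub>k g \<partial>\<^sub>k g\<close>, and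
  \<open>- 2 x\<^sub>k g \<partial>\<^sub>k g \<le> g\<^sup>2 / 2 + 2 R\<^sup>2 (\<partial>\<^sub>k g)\<^sup>2\<close> on \<open>\<Omega>\<close>; the first term on the right is absorbed.\<close>

lemma Poincare_component:
  fixes g :: "real^'n \<Rightarrow> real"
  assumes g: "g \<in> test_funs \<Omega>" and R: "\<And>x. x \<in> \<Omega> \<Longrightarrow> norm x \<le> R"
  shows "L2_inner \<Omega> g g \<le> 4 * R\<^sup>2 * L2_inner \<Omega> (pderiv_at k g) (pderiv_at k g)"
proof -
  have cont: "continuous_on UNIV g" "continuous_on UNIV (pderiv_at k g)"
    "continuous_on UNIV (\<lambda>x. x $ k * g x)"
    using continuous_on_smooth_fun[OF test_funs_smooth[OF g]]
      continuous_on_smooth_fun[OF smooth_fun_pderiv_at[OF test_funs_smooth[OF g]]]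
    by (auto intro!: continuous_intros)
  have gC: "C1_fun g"
    using g by (intro smooth_fun_C1_fun test_funs_smooth)
  note g' = test_funs_pderiv_at[OF g, of k]
  have g0: "g x = 0" if "norm x > R" for x
    using that R test_funs_outside[OF g] by (metis not_less)
  have pg2: "pderiv_at k (\<lambda>x. g x * g x) x = 2 * (g x * pderiv_at k g x)" for x
    using gC by (subst pderiv_at_mult) (auto simp: C1_fun_def)
  have "L2_inner \<Omega> g g = (LINT x|lborel. g x * g x)"
    by (rule L2_inner_test_funs[OF cont(1) g])
  also have "\<dots> = (LINT x|lborel. pderiv_at k (\<lambda>x. x $ k) x * (g x * g x))"
    by (simp add: pderiv_at_coordinate)
  also have "\<dots> = - (LINT x|lborel. x $ k * pderiv_at k (\<lambda>x. g x * g x) x)"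
    using integration_by_parts[OF C1_fun_coordinate[of k] C1_fun_mult[OF gC gC], of R k]
    by (simp add: g0)
  also have "\<dots> = - (LINT x|lborel. 2 * ((x $ k * g x) * pderiv_at k g x))"
    by (simp only: pg2 mult.left_commute[of _ "2::real"] mult.assoc)
  also have "\<dots> = - 2 * (LINT x|lborel. (x $ k * g x) * pderiv_at k g x)"
    by simp
  also have "\<dots> = - 2 * L2_inner \<Omega> (\<lambda>x. x $ k * g x) (pderiv_at k g)"
    by (subst L2_inner_test_funs(1)[OF cont(3) g']) simp
  also have "\<dots> \<le> integral\<^sup>L (lebesgue_on \<Omega>)
      (\<lambda>x. (g x * g x) / 2 + 2 * R\<^sup>2 * (pderiv_at k g x * pderiv_at k g x))"
  proof -
    have int: "integrable (lebesgue_on \<Omega>) (\<lambda>x. g x * g x)"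
      "integrable (lebesgue_on \<Omega>) (\<lambda>x. pderiv_at k g x * pderiv_at k g x)"
      using integrable_L2_inner[OF test_funs_L2 test_funs_L2] g g' by force+
    have xg: "(\<lambda>x. x $ k * g x) \<in> L2 \<Omega>"
    proof (rule L2_I_bound)
      show "(\<lambda>x. x $ k * g x) \<in> borel_measurable (lebesgue_on \<Omega>)"
        by (rule continuous_imp_measurable_on_sets_lebesgue[OF continuous_on_subset[OF cont(3)] domain_lebesgue]) simp
      show "integrable (lebesgue_on \<Omega>) (\<lambda>x. R\<^sup>2 * (g x * g x))"
        using int(1) by simp
      show "(norm (x $ k * g x))\<^sup>2 \<le> R\<^sup>2 * (g x * g x)" if "x \<in> \<Omega>" for x
      proof -
        have "\<bar>x $ k\<bar> \<le> R"
          using R[OF that] component_le_norm_cart[of x k] by linarith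
        then have "(x $ k)\<^sup>2 \<le> R\<^sup>2"
          using power_mono[of "\<bar>x $ k\<bar>" R 2] by simp
        then show ?thesis
          by (simp add: power_mult_distrib power2_eq_square[of "g x"] mult_right_mono)
      qed
    qed
    have "integral\<^sup>L (lebesgue_on \<Omega>) (\<lambda>x. - 2 * ((x $ k * g x) * pderiv_at k g x))
      \<le> integral\<^sup>L (lebesgue_on \<Omega>)
      (\<lambda>x. (g x * g x) / 2 + 2 * R\<^sup>2 * (pderiv_at k g x * pderiv_at k g x))"
    proof (rule integral_mono)
      show "integrable (lebesgue_on \<Omega>) (\<lambda>x. - 2 * ((x $ k * g x) * pderiv_at k g x))"
        using integrable_L2_inner[OF xg test_funs_L2[OF g']] by simp
      show "integrable (lebesgue_on \<Omega>)
          (\<lambda>x. (g x * g x) / 2 + 2 * R\<^sup>2 * (pderiv_at k g x * pderiv_at k g x))"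
        using int by simp
      fix x assume "x \<in> space (lebesgue_on \<Omega>)"
      then have "x \<in> \<Omega>" by (simp add: space_restrict_space)
      then have "\<bar>x $ k\<bar> \<le> R"
        using R component_le_norm_cart[of x k] order_trans by blast
      then have xk: "(x $ k)\<^sup>2 \<le> R\<^sup>2"
        using power_mono[of "\<bar>x $ k\<bar>" R 2] by simp
      have "0 \<le> (g x + 2 * x $ k * pderiv_at k g x)\<^sup>2" by simp
      then have "- 2 * ((x $ k * g x) * pderiv_at k g x)
          \<le> (g x * g x) / 2 + 2 * (x $ k)\<^sup>2 * (pderiv_at k g x * pderiv_at k g x)"
        by (simp add: power2_eq_square algebra_simps)
      also have "\<dots> \<le> (g x * g x) / 2 + 2 * R\<^sup>2 * (pderiv_at k g x * pderiv_at k g x)"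
        using xk by (intro add_left_mono mult_right_mono mult_left_mono) auto
      finally show "- 2 * ((x $ k * g x) * pderiv_at k g x)
          \<le> (g x * g x) / 2 + 2 * R\<^sup>2 * (pderiv_at k g x * pderiv_at k g x)" .
    qed
    then show ?thesis by (simp add: L2_inner_def)
  qed
  also have "\<dots> = L2_inner \<Omega> g g / 2 + 2 * R\<^sup>2 * L2_inner \<Omega> (pderiv_at k g) (pderiv_at k g)"
  proof -
    have "integrable (lebesgue_on \<Omega>) (\<lambda>x. g x * g x)"
      "integrable (lebesgue_on \<Omega>) (\<lambda>x. pderiv_at k g x * pderiv_at k g x)"
      using integrable_L2_inner[OF test_funs_L2 test_funs_L2] g g' by force+
    then show ?thesis by (simp add: L2_inner_def)
  qed
  finally show ?thesis by simp
qed

end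

definition sym_part :: "real^'n^'n \<Rightarrow> real^'n^'n" where
  "sym_part A = (\<chi> i j. (A $ i $ j + A $ j $ i) / 2)"

definition elastic :: "real \<Rightarrow> real \<Rightarrow> real^'n^'n \<Rightarrow> real^'n^'n" where
  "elastic \<mu> lam A = (2 * \<mu>) *\<^sub>R sym_part A + (lam * trace A) *\<^sub>R mat 1"

lemma linear_sym_part: "linear sym_part"
  by (rule linearI) (simp_all add: sym_part_def vec_eq_iff algebra_simps add_divide_distrib)

lemma linear_elastic: "linear (elastic \<mu> lam)"
  by (rule linearI)
    (simp_all add: elastic_def trace_def linear_add[OF linear_sym_part] linear_cmul[OF linear_sym_part]
      sum.distrib sum_distrib_left algebra_simps)

lemma inner_matrix: "A \<bullet> B = (\<Sum>i\<in>UNIV. \<Sum>j\<in>UNIV. A $ i $ j * (B :: real^'n^'m) $ i $ j)"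
  by (simp add: inner_vec_def)

lemma sym_part_inner:
  "2 * (sym_part A \<bullet> sym_part A) = A \<bullet> A + (\<Sum>i\<in>UNIV. \<Sum>j\<in>UNIV. A $ i $ j * A $ j $ i)"
proof -
  have "4 * (sym_part A \<bullet> sym_part A)
      = (\<Sum>i\<in>UNIV. \<Sum>j\<in>UNIV. A $ i $ j * A $ i $ j + 2 * (A $ i $ j * A $ j $ i) + A $ j $ i * A $ j $ i)"
    unfolding inner_matrix sum_distrib_left
    by (intro sum.cong refl) (simp add: sym_part_def field_simps)
  also have "\<dots> = A \<bullet> A + 2 * (\<Sum>i\<in>UNIV. \<Sum>j\<in>UNIV. A $ i $ j * A $ j $ i)
      + (\<Sum>i\<in>UNIV. \<Sum>j\<in>UNIV. A $ j $ i * A $ j $ i)"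
    by (simp add: inner_matrix sum.distrib sum_distrib_left)
  also have "(\<Sum>i\<in>UNIV. \<Sum>j\<in>UNIV. A $ j $ i * A $ j $ i) = A \<bullet> A"
    unfolding inner_matrix by (rule sum.swap)
  finally show ?thesis by simp
qed

lemma norm_sym_part_le: "norm (sym_part A) \<le> norm A"
proof -
  have "(\<Sum>i\<in>UNIV. \<Sum>j\<in>UNIV. A $ i $ j * A $ j $ i)
      \<le> (\<Sum>i\<in>UNIV. \<Sum>j\<in>UNIV. (A $ i $ j * A $ i $ j + A $ j $ i * A $ j $ i) / 2)"
  proof (intro sum_mono)
    fix i j
    have "0 \<le> (A $ i $ j - A $ j $ i)\<^sup>2" by simp
    then show "A $ i $ j * A $ j $ i \<le> (A $ i $ j * A $ i $ j + A $ j $ i * A $ j $ i) / 2"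
      by (simp add: power2_eq_square algebra_simps)
  qed
  also have "\<dots> = (A \<bullet> A + (\<Sum>i\<in>UNIV. \<Sum>j\<in>UNIV. A $ j $ i * A $ j $ i)) / 2"
    by (simp add: inner_matrix sum.distrib flip: sum_divide_distrib)
  also have "(\<Sum>i\<in>UNIV. \<Sum>j\<in>UNIV. A $ j $ i * A $ j $ i) = A \<bullet> A"
    unfolding inner_matrix by (rule sum.swap)
  finally show ?thesis
    using sym_part_inner[of A] by (simp add: norm_le)
qed

lemma mat_1_inner_sym_part: "mat 1 \<bullet> sym_part A = trace A"
proof -
  have "mat 1 $ i $ j * sym_part A $ i $ j = (if i = j then A $ j $ j else 0)" for i j
    by (simp add: mat_def sym_part_def)
  then show ?thesis
    by (simp add: inner_matrix trace_def)
qed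

lemma elastic_inner:
  "elastic \<mu> lam A \<bullet> sym_part B = 2 * \<mu> * (sym_part A \<bullet> sym_part B) + lam * (trace A * trace B)"
  by (simp add: elastic_def inner_add_left mat_1_inner_sym_part)

context bounded_open
begin

lemma strain_eq: "strain \<Omega> v = (\<lambda>x. sym_part (weak_grad \<Omega> v x))"
  by (rule ext) (simp add: strain_def sym_part_def)

lemma stress_eq: "stress \<Omega> \<mu> lam v = (\<lambda>x. elastic \<mu> lam (weak_grad \<Omega> v x))"
  by (rule ext) (simp add: stress_def strain_eq weak_div_def elastic_def trace_def)

lemma strain_L2: "v \<in> H1 \<Omega> \<Longrightarrow> strain \<Omega> v \<in> L2 \<Omega>"
  unfolding strain_eq by (intro L2_linear[OF linear_sym_part] weak_grad)

lemma stress_L2: "v \<in> H1 \<Omega> \<Longrightarrow> stress \<Omega> \<mu> lam v \<in> L2 \<Omega>"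
  unfolding stress_eq by (intro L2_linear[OF linear_elastic] weak_grad)

lemma L2_inner_vec:
  fixes f g :: "real^'n \<Rightarrow> ('b::euclidean_space)^'m"
  assumes "f \<in> L2 \<Omega>" "g \<in> L2 \<Omega>"
  shows "L2_inner \<Omega> f g = (\<Sum>i\<in>UNIV. L2_inner \<Omega> (\<lambda>x. f x $ i) (\<lambda>x. g x $ i))"
  unfolding L2_inner_def inner_vec_def
  using assms by (intro Bochner_Integration.integral_sum integrable_L2_inner L2_norm_component_le(1))

lemma L2_inner_matrix:
  fixes f g :: "real^'n \<Rightarrow> real^'n^'n"
  assumes "f \<in> L2 \<Omega>" "g \<in> L2 \<Omega>"
  shows "L2_inner \<Omega> f g
    = (\<Sum>i\<in>UNIV. \<Sum>j\<in>UNIV. L2_inner \<Omega> (\<lambda>x. f x $ i $ j) (\<lambda>x. g x $ i $ j))"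
  using assms by (subst L2_inner_vec) (auto intro!: sum.cong L2_inner_vec L2_norm_component_le(1))

lemma Poincare:
  assumes \<phi>: "\<phi> \<in> test_funs \<Omega>" and R: "\<And>x. x \<in> \<Omega> \<Longrightarrow> norm x \<le> R"
  shows "L2_inner \<Omega> \<phi> \<phi> \<le> 4 * R\<^sup>2 * L2_inner \<Omega> (classical_grad \<phi>) (classical_grad \<phi>)"
proof -
  fix k :: 'n
  note \<phi>i = test_funs_component[OF \<phi>]
  let ?d = "\<lambda>i j. pderiv_at j (\<lambda>x. \<phi> x $ i)"
  have "L2_inner \<Omega> \<phi> \<phi> = (\<Sum>i\<in>UNIV. L2_inner \<Omega> (\<lambda>x. \<phi> x $ i) (\<lambda>x. \<phi> x $ i))"
    by (intro L2_inner_vec test_funs_L2 \<phi>)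
  also have "\<dots> \<le> (\<Sum>i\<in>UNIV. 4 * R\<^sup>2 * L2_inner \<Omega> (?d i k) (?d i k))"
    by (intro sum_mono Poincare_component \<phi>i R)
  also have "\<dots> \<le> (\<Sum>i\<in>UNIV. 4 * R\<^sup>2 * (\<Sum>j\<in>UNIV. L2_inner \<Omega> (?d i j) (?d i j)))"
    by (intro sum_mono mult_left_mono member_le_sum[of k UNIV] L2.nonneg test_funs_L2
        test_funs_pderiv_at \<phi>i) auto
  also have "\<dots> = 4 * R\<^sup>2 * L2_inner \<Omega> (classical_grad \<phi>) (classical_grad \<phi>)"
    using \<phi> by (subst L2_inner_matrix)
      (auto simp: sum_distrib_left classical_grad_component classical_grad_test_fun test_funs_L2)
  finally show ?thesis .
qed

text \<open>Integrating by parts twice turns \<open>\<integral> \<partial>\<^sub>j\<phi>\<^sub>i \<partial>\<^sub>i\<phi>\<^sub>j\<close> into \<open>\<integral> \<partial>\<^sub>i\<phi>\<^sub>i \<partial>\<^sub>j\<phi>\<^sub>j\<close>; the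
  cross terms of \<open>\<bar>\<epsilon>(\<phi>)\<bar>\<^sup>2\<close> therefore sum up to \<open>\<integral> (div \<phi>)\<^sup>2 \<ge> 0\<close>.\<close>

lemma Korn:
  assumes \<phi>: "\<phi> \<in> test_funs \<Omega>"
  shows "L2_inner \<Omega> (classical_grad \<phi>) (classical_grad \<phi>)
    \<le> 2 * L2_inner \<Omega> (\<lambda>x. sym_part (classical_grad \<phi> x)) (\<lambda>x. sym_part (classical_grad \<phi> x))"
proof -
  let ?d = "\<lambda>i j. pderiv_at j (\<lambda>x. \<phi> x $ i)"
  let ?G = "classical_grad \<phi>"
  note \<phi>i = test_funs_component[OF \<phi>]
  have d: "?d i j \<in> test_funs \<Omega>" for i j
    by (intro test_funs_pderiv_at \<phi>i)
  have dL: "?d i j \<in> L2 \<Omega>" for i j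
    by (intro test_funs_L2 d)
  have G: "?G \<in> L2 \<Omega>"
    by (intro test_funs_L2 classical_grad_test_fun \<phi>)
  have cont: "continuous_on UNIV (?d i j)" for i j
    by (intro continuous_on_smooth_fun test_funs_smooth[OF d])
  have swap: "L2_inner \<Omega> (?d i j) (?d j i) = L2_inner \<Omega> (?d i i) (?d j j)" for i j
    unfolding L2_inner_test_funs(1)[OF cont d]
    by (intro integral_pderiv_at_swap test_funs_mono[OF \<phi>i]) auto
  have "2 * L2_inner \<Omega> (\<lambda>x. sym_part (?G x)) (\<lambda>x. sym_part (?G x))
      = integral\<^sup>L (lebesgue_on \<Omega>) (\<lambda>x. ?G x \<bullet> ?G x + (\<Sum>i\<in>UNIV. \<Sum>j\<in>UNIV. ?d i j x \<bullet> ?d j i x))"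
    unfolding L2_inner_def Bochner_Integration.integral_mult_right_zero[symmetric] sym_part_inner
    by (simp add: classical_grad_component[OF \<phi>])
  also have "\<dots> = L2_inner \<Omega> ?G ?G + (\<Sum>i\<in>UNIV. \<Sum>j\<in>UNIV. L2_inner \<Omega> (?d i j) (?d j i))"
    unfolding L2_inner_def
    by (simp only: Bochner_Integration.integral_add Bochner_Integration.integral_sum
        integrable_L2_inner[OF G G] integrable_L2_inner[OF dL dL]
        Bochner_Integration.integrable_sum)
  also have "(\<Sum>i\<in>UNIV. \<Sum>j\<in>UNIV. L2_inner \<Omega> (?d i j) (?d j i))
      = integral\<^sup>L (lebesgue_on \<Omega>) (\<lambda>x. (\<Sum>i\<in>UNIV. \<Sum>j\<in>UNIV. ?d i i x \<bullet> ?d j j x))"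
    unfolding swap unfolding L2_inner_def
    by (simp only: Bochner_Integration.integral_sum
        integrable_L2_inner[OF dL dL] Bochner_Integration.integrable_sum)
  also have "\<dots> = integral\<^sup>L (lebesgue_on \<Omega>) (\<lambda>x. (\<Sum>i\<in>UNIV. ?d i i x)\<^sup>2)"
    by (simp add: power2_eq_square sum_product)
  finally show ?thesis
    by simp
qed

lemma strain_form_axpy_left:
  assumes "u \<in> H1 \<Omega>" "v \<in> H1 \<Omega>" "w \<in> H1 \<Omega>"
  shows "L2_inner \<Omega> (strain \<Omega> (\<lambda>x. u x + c *\<^sub>R v x)) (strain \<Omega> w)
    = L2_inner \<Omega> (strain \<Omega> u) (strain \<Omega> w) + c * L2_inner \<Omega> (strain \<Omega> v) (strain \<Omega> w)"
  unfolding strain_eq by (rule weak_grad_form_axpy_left[OF linear_sym_part linear_sym_part assms])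

lemma semi_inner_strain: "semi_inner (H1 \<Omega>) (\<lambda>v w. L2_inner \<Omega> (strain \<Omega> v) (strain \<Omega> w))"
  by standard
    (use H1_zero H1_axpy strain_form_axpy_left in \<open>auto intro!: L2.sym L2.nonneg strain_L2\<close>)

lemma strain_norm_le_H1_norm:
  assumes "v \<in> H1 \<Omega>" shows "L2_norm \<Omega> (strain \<Omega> v) \<le> H1_norm \<Omega> v"
proof -
  have "L2_norm \<Omega> (strain \<Omega> v) \<le> 1 * L2_norm \<Omega> (weak_grad \<Omega> v)"
    unfolding strain_eq using linear_sym_part linear_linear
    by (intro L2_norm_bounded_linear weak_grad assms) (auto simp: norm_sym_part_le)
  then show ?thesis
    using L2_norm_le_H1_norm(2)[OF assms] by simp
qed

text \<open>Both sides are continuous in the \<open>H\<^sup>1\<close> norm, so the inequality extends from test functions to their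
  closure.\<close>

lemma Korn_Poincare:
  obtains K where "K > 0" "\<And>v. v \<in> H10 \<Omega> \<Longrightarrow> H1_norm \<Omega> v \<le> K * L2_norm \<Omega> (strain \<Omega> v)"
proof -
  obtain R where R: "\<And>x. x \<in> \<Omega> \<Longrightarrow> norm x \<le> R"
    using bounded_domain by (auto simp: bounded_iff)
  define K where "K = sqrt (2 * (4 * R\<^sup>2 + 1))"
  have K: "K > 0" "K\<^sup>2 = 2 * (4 * R\<^sup>2 + 1)"
    by (simp_all add: K_def add_nonneg_pos)
  interpret S: semi_inner "H1 \<Omega>" "\<lambda>v w. L2_inner \<Omega> (strain \<Omega> v) (strain \<Omega> w)"
    rewrites "semi_inner.nrm (\<lambda>v w. L2_inner \<Omega> (strain \<Omega> v) (strain \<Omega> w))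
      = (\<lambda>v. L2_norm \<Omega> (strain \<Omega> v))"
  proof -
    show "semi_inner (H1 \<Omega>) (\<lambda>v w. L2_inner \<Omega> (strain \<Omega> v) (strain \<Omega> w))"
      by (rule semi_inner_strain)
    show "semi_inner.nrm (\<lambda>v w. L2_inner \<Omega> (strain \<Omega> v) (strain \<Omega> w))
      = (\<lambda>v. L2_norm \<Omega> (strain \<Omega> v))"
      by (rule ext) (simp add: semi_inner.nrm_def[OF semi_inner_strain] L2_norm_def)
  qed
  have test: "H1_norm \<Omega> \<phi> \<le> K * L2_norm \<Omega> (strain \<Omega> \<phi>)" if \<phi>: "\<phi> \<in> test_funs \<Omega>" for \<phi>
  proof (rule power2_le_imp_le)
    have H: "\<phi> \<in> H1 \<Omega>" by (rule test_funs_H1[OF \<phi>])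
    have G: "classical_grad \<phi> \<in> L2 \<Omega>"
      by (intro test_funs_L2 classical_grad_test_fun \<phi>)
    have G': "(\<lambda>x. sym_part (classical_grad \<phi> x)) \<in> L2 \<Omega>"
      by (rule L2_linear[OF linear_sym_part G])
    have "L2_norm \<Omega> (weak_grad \<Omega> \<phi>) = L2_norm \<Omega> (classical_grad \<phi>)"
      by (rule L2_norm_cong_AE[OF weak_grad_test_fun[OF \<phi>] weak_grad(1)[OF H] G])
    then have "(H1_norm \<Omega> \<phi>)\<^sup>2 = L2_inner \<Omega> \<phi> \<phi> + L2_inner \<Omega> (classical_grad \<phi>) (classical_grad \<phi>)"
      by (simp add: H1_norm_power2 H L2.nrm_power2 test_funs_L2 \<phi> G)
    also have "\<dots> \<le> (4 * R\<^sup>2 + 1) * L2_inner \<Omega> (classical_grad \<phi>) (classical_grad \<phi>)"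
      using Poincare[OF \<phi> R] by (simp add: algebra_simps)
    also have "\<dots> \<le> (4 * R\<^sup>2 + 1) * (2 * L2_inner \<Omega> (\<lambda>x. sym_part (classical_grad \<phi> x))
        (\<lambda>x. sym_part (classical_grad \<phi> x)))"
      using Korn[OF \<phi>] by (intro mult_left_mono) auto
    also have "L2_inner \<Omega> (\<lambda>x. sym_part (classical_grad \<phi> x)) (\<lambda>x. sym_part (classical_grad \<phi> x))
        = (L2_norm \<Omega> (strain \<Omega> \<phi>))\<^sup>2"
    proof -
      have "AE x in lebesgue_on \<Omega>. sym_part (classical_grad \<phi> x) = strain \<Omega> \<phi> x"
        using weak_grad_test_fun[OF \<phi>] by eventually_elim (simp add: strain_eq)
      then show ?thesis
        using L2_norm_cong_AE[OF _ G' strain_L2[OF H]] L2.nrm_power2[OF G'] by simp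
    qed
    also have "(4 * R\<^sup>2 + 1) * (2 * (L2_norm \<Omega> (strain \<Omega> \<phi>))\<^sup>2) = (K * L2_norm \<Omega> (strain \<Omega> \<phi>))\<^sup>2"
      by (simp add: power_mult_distrib K)
    finally show "(H1_norm \<Omega> \<phi>)\<^sup>2 \<le> (K * L2_norm \<Omega> (strain \<Omega> \<phi>))\<^sup>2" .
    show "0 \<le> K * L2_norm \<Omega> (strain \<Omega> \<phi>)"
      using K(1) S.nrm_nonneg[OF H] by simp
  qed
  have "H1_norm \<Omega> v \<le> K * L2_norm \<Omega> (strain \<Omega> v)" if v: "v \<in> H10 \<Omega>" for v
  proof (rule field_le_epsilon)
    fix e :: real assume "e > 0"
    then have "e / (K + 1) > 0" using K(1) by simp
    then obtain \<phi> where \<phi>: "\<phi> \<in> test_funs \<Omega>" "H1_norm \<Omega> (\<lambda>x. v x - \<phi> x) < e / (K + 1)"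
      using H10_approx[OF v] by blast
    have H: "v \<in> H1 \<Omega>" "\<phi> \<in> H1 \<Omega>" "(\<lambda>x. v x - \<phi> x) \<in> H1 \<Omega>"
      using v \<phi>(1) by (auto intro: H10_H1 test_funs_H1 H1.closed_diff)
    have "H1_norm \<Omega> v \<le> H1_norm \<Omega> (\<lambda>x. v x - \<phi> x) + H1_norm \<Omega> \<phi>"
      using H1.nrm_add_le[OF H(3,2)] by simp
    also have "H1_norm \<Omega> \<phi> \<le> K * L2_norm \<Omega> (strain \<Omega> \<phi>)"
      by (rule test[OF \<phi>(1)])
    also have "L2_norm \<Omega> (strain \<Omega> \<phi>) \<le> L2_norm \<Omega> (strain \<Omega> v) + H1_norm \<Omega> (\<lambda>x. v x - \<phi> x)"
      using S.nrm_diff_le[OF H(1,3)] strain_norm_le_H1_norm[OF H(3)] by simp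
    finally have "H1_norm \<Omega> v \<le> K * L2_norm \<Omega> (strain \<Omega> v) + (K + 1) * H1_norm \<Omega> (\<lambda>x. v x - \<phi> x)"
      using K(1) by (simp add: algebra_simps)
    also have "(K + 1) * H1_norm \<Omega> (\<lambda>x. v x - \<phi> x) \<le> e"
      using \<phi>(2) K(1) by (simp add: field_simps)
    finally show "H1_norm \<Omega> v \<le> K * L2_norm \<Omega> (strain \<Omega> v) + e" by simp
  qed
  with K(1) show ?thesis by (rule that)
qed

lemma H1_norm_eq_0_iff:
  assumes "v \<in> H1 \<Omega>"
  shows "H1_norm \<Omega> v = 0 \<longleftrightarrow> (AE x in lebesgue_on \<Omega>. v x = 0)"
proof
  assume "H1_norm \<Omega> v = 0"
  then have "L2_norm \<Omega> v = 0"
    using L2_norm_le_H1_norm(1)[OF assms] L2.nrm_nonneg[OF H1_L2[OF assms]] by simp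
  then show "AE x in lebesgue_on \<Omega>. v x = 0"
    by (simp add: L2_norm_eq_0_iff H1_L2 assms)
next
  assume v: "AE x in lebesgue_on \<Omega>. v x = 0"
  have "is_weak_grad \<Omega> v (\<lambda>x. 0)"
    unfolding is_weak_grad_iff
  proof (intro ballI allI)
    fix \<phi> :: "real^'n \<Rightarrow> real" and i j :: 'n assume "\<phi> \<in> test_funs \<Omega>"
    have "AE x in lebesgue_on \<Omega>. v x $ i = 0"
      using v by eventually_elim simp
    then have "L2_inner \<Omega> (\<lambda>x. v x $ i) (pderiv_at j \<phi>) = L2_inner \<Omega> (\<lambda>x. 0) (pderiv_at j \<phi>)"
      using \<open>\<phi> \<in> test_funs \<Omega>\<close> H1_L2[OF assms] L2.closed_zero
      by (intro L2_inner_cong_AE L2_norm_component_le(1) test_funs_L2[OF test_funs_pderiv_at]) auto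
    then show "L2_inner \<Omega> (\<lambda>x. v x $ i) (pderiv_at j \<phi>) = - L2_inner \<Omega> (\<lambda>x. 0 $ i $ j) \<phi>"
      by (simp add: L2_inner_def)
  qed
  then have "AE x in lebesgue_on \<Omega>. weak_grad \<Omega> v x = 0"
    by (intro weak_grad_eq_AE H1_L2 assms L2.closed_zero)
  then have "L2_norm \<Omega> (weak_grad \<Omega> v) = 0" "L2_norm \<Omega> v = 0"
    using v assms by (simp_all add: L2_norm_eq_0_iff H1_L2 weak_grad)
  then show "H1_norm \<Omega> v = 0"
    using H1_norm_power2[OF assms] by simp
qed

end

section \<open>The energy inner product on \<open>H\<^sup>1\<^sub>0\<close>\<close>

locale elasticity = bounded_open \<Omega> for \<Omega> :: "(real^'n) set" +
  fixes \<mu> lam :: real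
  assumes domain_nonempty: "\<Omega> \<noteq> {}" and mu_pos: "\<mu> > 0" and lam_pos: "lam > 0"
begin

definition energy :: "(real^'n \<Rightarrow> real^'n) \<Rightarrow> (real^'n \<Rightarrow> real^'n) \<Rightarrow> real" where
  "energy v w = L2_inner \<Omega> (stress \<Omega> \<mu> lam v) (strain \<Omega> w)"

text \<open>The identity matrix sees only the trace of the strain, which is the divergence. In this form symmetry
  and coercivity of the energy can be read off.\<close>

lemma energy_eq:
  assumes "v \<in> H1 \<Omega>" "w \<in> H1 \<Omega>"
  shows "energy v w = 2 * \<mu> * L2_inner \<Omega> (strain \<Omega> v) (strain \<Omega> w)
    + lam * L2_inner \<Omega> (\<lambda>x. trace (weak_grad \<Omega> v x)) (\<lambda>x. trace (weak_grad \<Omega> w x))"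
proof -
  have "linear (trace :: real^'n^'n \<Rightarrow> real)"
    by (rule linearI) (simp_all add: trace_def sum.distrib sum_distrib_left)
  then have tr: "(\<lambda>x. trace (weak_grad \<Omega> u x)) \<in> L2 \<Omega>" if "u \<in> H1 \<Omega>" for u
    using weak_grad(1)[OF that] by (rule L2_linear)
  note int = integrable_L2_inner[OF strain_L2 strain_L2, OF assms]
    integrable_L2_inner[OF tr tr, OF assms]
  have "energy v w = integral\<^sup>L (lebesgue_on \<Omega>) (\<lambda>x. 2 * \<mu> * (strain \<Omega> v x \<bullet> strain \<Omega> w x)
      + lam * (trace (weak_grad \<Omega> v x) \<bullet> trace (weak_grad \<Omega> w x)))"
    by (simp add: energy_def L2_inner_def stress_eq strain_eq elastic_inner)
  then show ?thesis
    using int by (simp add: L2_inner_def)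
qed

lemma energy_ge_strain:
  assumes "v \<in> H1 \<Omega>" shows "2 * \<mu> * (L2_norm \<Omega> (strain \<Omega> v))\<^sup>2 \<le> energy v v"
  using lam_pos L2.nrm_power2[OF strain_L2[OF assms]]
  by (simp add: energy_eq assms) (simp add: L2_inner_def)

lemma semi_inner_energy: "semi_inner (H10 \<Omega>) energy"
proof
  show "H10 \<Omega> \<noteq> {}"
    using test_funs_H10[OF test_funs_zero] by blast
  fix u v w :: "real^'n \<Rightarrow> real^'n" assume mem: "u \<in> H10 \<Omega>" "v \<in> H10 \<Omega>"
  then show "(\<lambda>x. u x + c *\<^sub>R v x) \<in> H10 \<Omega>" for c
    by (rule H10_axpy)
  show "energy u v = energy v u"
    using mem by (simp add: energy_eq H10_H1 L2.sym[OF strain_L2 strain_L2])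
      (simp add: L2_inner_def inner_commute mult.commute)
  assume "w \<in> H10 \<Omega>"
  then show "energy (\<lambda>x. u x + c *\<^sub>R v x) w = energy u w + c * energy v w" for c
    using mem weak_grad_form_axpy_left[OF linear_elastic linear_sym_part]
    by (simp add: energy_def stress_eq strain_eq H10_H1)
next
  show "0 \<le> energy v v" if "v \<in> H10 \<Omega>" for v
    using energy_ge_strain[OF H10_H1[OF that]] mu_pos
    by (meson mult_nonneg_nonneg order_trans less_imp_le zero_le_numeral zero_le_power2)
qed

sublocale E: semi_inner "H10 \<Omega>" energy
  rewrites "semi_inner.nrm energy = energy_norm \<Omega> \<mu> lam"
proof -
  show "semi_inner (H10 \<Omega>) energy" by (rule semi_inner_energy)
  show "semi_inner.nrm energy = energy_norm \<Omega> \<mu> lam"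
    by (rule ext) (simp add: semi_inner.nrm_def[OF semi_inner_energy] energy_norm_def energy_def)
qed

lemma H1_norm_le_energy_norm:
  obtains K where "K > 0" "\<And>v. v \<in> H10 \<Omega> \<Longrightarrow> H1_norm \<Omega> v \<le> K * energy_norm \<Omega> \<mu> lam v"
proof -
  obtain K where K: "K > 0" "\<And>v. v \<in> H10 \<Omega> \<Longrightarrow> H1_norm \<Omega> v \<le> K * L2_norm \<Omega> (strain \<Omega> v)"
    using Korn_Poincare by blast
  have "H1_norm \<Omega> v \<le> K / sqrt (2 * \<mu>) * energy_norm \<Omega> \<mu> lam v" if v: "v \<in> H10 \<Omega>" for v
  proof -
    have "sqrt (2 * \<mu> * (L2_norm \<Omega> (strain \<Omega> v))\<^sup>2) \<le> sqrt (energy v v)"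
      using energy_ge_strain[OF H10_H1[OF v]] by (rule real_sqrt_le_mono)
    then have "sqrt (2 * \<mu>) * L2_norm \<Omega> (strain \<Omega> v) \<le> energy_norm \<Omega> \<mu> lam v"
      using L2.nrm_nonneg[OF strain_L2[OF H10_H1[OF v]]]
      by (simp add: real_sqrt_mult energy_norm_def energy_def)
    then have "L2_norm \<Omega> (strain \<Omega> v) \<le> energy_norm \<Omega> \<mu> lam v / sqrt (2 * \<mu>)"
      using mu_pos by (simp add: pos_le_divide_eq mult.commute)
    then have "K * L2_norm \<Omega> (strain \<Omega> v) \<le> K * (energy_norm \<Omega> \<mu> lam v / sqrt (2 * \<mu>))"
      using K(1) by (intro mult_left_mono) auto
    then show ?thesis
      using K(2)[OF v] by simp
  qed
  moreover have "K / sqrt (2 * \<mu>) > 0" using K(1) mu_pos by simp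
  ultimately show ?thesis using that by blast
qed

lemma energy_norm_le_H1_norm:
  obtains K where "K > 0" "\<And>v. v \<in> H10 \<Omega> \<Longrightarrow> energy_norm \<Omega> \<mu> lam v \<le> K * H1_norm \<Omega> v"
proof -
  have bl: "bounded_linear (elastic \<mu> lam :: real^'n^'n \<Rightarrow> real^'n^'n)"
    using linear_elastic linear_linear by blast
  obtain c where c: "c > 0" "\<And>A :: real^'n^'n. norm (elastic \<mu> lam A) \<le> norm A * c"
    using bounded_linear.pos_bounded[OF bl] by blast
  have "energy_norm \<Omega> \<mu> lam v \<le> sqrt c * H1_norm \<Omega> v" if v: "v \<in> H10 \<Omega>" for v
  proof (rule power2_le_imp_le)
    note H = H10_H1[OF v]
    have "energy v v \<le> L2_norm \<Omega> (stress \<Omega> \<mu> lam v) * L2_norm \<Omega> (strain \<Omega> v)"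
      using L2.Cauchy_Schwarz[OF stress_L2[OF H, of \<mu> lam] strain_L2[OF H]]
      by (simp add: energy_def)
    also have "\<dots> \<le> (c * H1_norm \<Omega> v) * H1_norm \<Omega> v"
    proof (intro mult_mono strain_norm_le_H1_norm[OF H])
      have "L2_norm \<Omega> (stress \<Omega> \<mu> lam v) \<le> c * L2_norm \<Omega> (weak_grad \<Omega> v)"
        unfolding stress_eq using c
        by (intro L2_norm_bounded_linear bl weak_grad H) (auto simp: mult.commute)
      also have "\<dots> \<le> c * H1_norm \<Omega> v"
        using c(1) L2_norm_le_H1_norm(2)[OF H] by simp
      finally show "L2_norm \<Omega> (stress \<Omega> \<mu> lam v) \<le> c * H1_norm \<Omega> v" .
    qed (use c(1) H1.nrm_nonneg[OF H] L2.nrm_nonneg[OF strain_L2[OF H]] in auto)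
    also have "\<dots> = (sqrt c * H1_norm \<Omega> v)\<^sup>2"
      using c(1) by (simp add: power_mult_distrib power2_eq_square)
    finally show "(energy_norm \<Omega> \<mu> lam v)\<^sup>2 \<le> (sqrt c * H1_norm \<Omega> v)\<^sup>2"
      by (simp add: E.nrm_power2 v)
    show "0 \<le> sqrt c * H1_norm \<Omega> v"
      using c(1) H1.nrm_nonneg[OF H] by simp
  qed
  moreover have "sqrt c > 0" using c(1) by simp
  ultimately show ?thesis using that by blast
qed

sublocale E: complete_semi_inner "H10 \<Omega>" energy
  rewrites "semi_inner.nrm energy = energy_norm \<Omega> \<mu> lam"
proof -
  show nrm: "semi_inner.nrm energy = energy_norm \<Omega> \<mu> lam"
    by (rule ext) (simp add: semi_inner.nrm_def[OF semi_inner_energy] energy_norm_def energy_def)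
  show "complete_semi_inner (H10 \<Omega>) energy"
    unfolding complete_semi_inner_def complete_semi_inner_axioms_def nrm
  proof (intro conjI semi_inner_energy allI impI)
    fix s :: "nat \<Rightarrow> real^'n \<Rightarrow> real^'n"
    assume s: "\<forall>n. s n \<in> H10 \<Omega>"
      and Cau: "\<forall>e>0. \<exists>N. \<forall>m\<ge>N. \<forall>n\<ge>N. energy_norm \<Omega> \<mu> lam (\<lambda>x. s m x - s n x) < e"
    have d: "(\<lambda>x. s m x - s n x) \<in> H10 \<Omega>" for m n
      using s by (intro E.closed_diff) auto
    obtain K where K: "K > 0" "\<And>v. v \<in> H10 \<Omega> \<Longrightarrow> H1_norm \<Omega> v \<le> K * energy_norm \<Omega> \<mu> lam v"
      using H1_norm_le_energy_norm by blast
    obtain c where c: "c > 0" "\<And>v. v \<in> H10 \<Omega> \<Longrightarrow> energy_norm \<Omega> \<mu> lam v \<le> c * H1_norm \<Omega> v"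
      using energy_norm_le_H1_norm by blast
    have "\<exists>N. \<forall>m\<ge>N. \<forall>n\<ge>N. H1_norm \<Omega> (\<lambda>x. s m x - s n x) < e" if "e > 0" for e
    proof -
      have "e / K > 0" using that K(1) by simp
      then obtain N where N: "\<And>m n. \<lbrakk>m \<ge> N; n \<ge> N\<rbrakk> \<Longrightarrow> energy_norm \<Omega> \<mu> lam (\<lambda>x. s m x - s n x) < e / K"
        using Cau by blast
      have "H1_norm \<Omega> (\<lambda>x. s m x - s n x) < e" if "m \<ge> N" "n \<ge> N" for m n
        using K(2)[OF d[of m n]] N[OF that] K(1) by (simp add: pos_less_divide_eq mult.commute)
      then show ?thesis by blast
    qed
    then obtain v where v: "v \<in> H10 \<Omega>" "(\<lambda>n. H1_norm \<Omega> (\<lambda>x. s n x - v x)) \<longlonglongrightarrow> 0"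
      using H10_complete[of s] s by blast
    have dv: "(\<lambda>x. s n x - v x) \<in> H10 \<Omega>" for n
      using s v(1) by (intro E.closed_diff) auto
    have "(\<lambda>n. c * H1_norm \<Omega> (\<lambda>x. s n x - v x)) \<longlonglongrightarrow> 0"
      using tendsto_mult_left[OF v(2), of c] by simp
    then have "(\<lambda>n. energy_norm \<Omega> \<mu> lam (\<lambda>x. s n x - v x)) \<longlonglongrightarrow> 0"
      by (rule tendsto_sandwich[OF _ _ tendsto_const, rotated 2]) (simp_all add: E.nrm_nonneg c(2) dv)
    then show "\<exists>v\<in>H10 \<Omega>. (\<lambda>n. energy_norm \<Omega> \<mu> lam (\<lambda>x. s n x - v x)) \<longlonglongrightarrow> 0"
      using v(1) by blast
  qed
qed

lemma energy_norm_eq_0_iff: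
  assumes "v \<in> H10 \<Omega>"
  shows "energy_norm \<Omega> \<mu> lam v = 0 \<longleftrightarrow> (AE x in lebesgue_on \<Omega>. v x = 0)"
proof -
  have "energy_norm \<Omega> \<mu> lam v = 0 \<longleftrightarrow> H1_norm \<Omega> v = 0"
    using H1_norm_le_energy_norm energy_norm_le_H1_norm assms E.nrm_nonneg[OF assms]
      H1.nrm_nonneg[OF H10_H1[OF assms]]
    by (metis antisym mult_zero_right)
  then show ?thesis
    using H1_norm_eq_0_iff[OF H10_H1[OF assms]] by simp
qed

text \<open>This makes the set of quotients in the definition of the dual norm nonempty, so that its supremum
  is meaningful.\<close>

lemma H10_nontrivial: "\<exists>v\<in>H10 \<Omega>. \<not> (AE x in lebesgue_on \<Omega>. v x = 0)"
proof -
  obtain z where "z \<in> \<Omega>" using domain_nonempty by blast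
  then obtain a b where ab: "z \<in> box a b" "cbox a b \<subseteq> \<Omega>"
    using open_contains_cbox[of \<Omega>] open_domain by blast
  fix k :: 'n
  define \<phi> where "\<phi> x = box_bump a b 1 x *\<^sub>R axis k (1::real)" for x
  have lin: "linear (\<lambda>t::real. t *\<^sub>R axis k (1::real))"
    by (rule linearI) (simp_all add: scaleR_add_left)
  have "\<phi> \<in> test_funs \<Omega>"
    unfolding \<phi>_def by (rule test_funs_linear[OF lin box_bump_test_fun[OF _ ab(2)]]) simp
  moreover have "\<not> (AE x in lebesgue_on \<Omega>. \<phi> x = 0)"
  proof
    assume "AE x in lebesgue_on \<Omega>. \<phi> x = 0"
    then have "AE x in lebesgue. x \<in> \<Omega> \<longrightarrow> \<phi> x = 0"
      using domain_lebesgue by (simp add: AE_restrict_space_iff)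
    then have "AE x in lebesgue. x \<notin> box a b"
    proof eventually_elim
      case (elim x)
      then show ?case
        using box_bump_pos[of 1 x a b] ab(2) box_subset_cbox[of a b] by (auto simp: \<phi>_def axis_eq_0_iff)
    qed
    then have "negligible (box a b)"
      by (simp add: negligible_iff_null_sets AE_iff_null_sets)
    then show False
      using open_not_negligible[OF open_box] ab(1) by blast
  qed
  ultimately show ?thesis
    using test_funs_H10 by blast
qed

text \<open>Cauchy-Schwarz bounds all quotients by the energy norm of \<open>w\<close>, and the quotient at \<open>w\<close> itself
  attains this bound. If \<open>w\<close> vanishes almost everywhere, then every quotient is \<open>0\<close>.\<close>

lemma dual_norm_eq_energy_norm:
  assumes w: "w \<in> H10 \<Omega>" and g: "\<And>v. v \<in> H10 \<Omega> \<Longrightarrow> g v = energy w v"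
  shows "dual_norm \<Omega> \<mu> lam g = energy_norm \<Omega> \<mu> lam w"
  unfolding dual_norm_def
proof (rule cSup_eq_maximum)
  let ?S = "{\<bar>g v\<bar> / energy_norm \<Omega> \<mu> lam v |v. v \<in> H10 \<Omega> \<and> \<not> (AE x in lebesgue_on \<Omega>. v x = 0)}"
  show "energy_norm \<Omega> \<mu> lam w \<in> ?S"
  proof (cases "AE x in lebesgue_on \<Omega>. w x = 0")
    case True
    then have "energy_norm \<Omega> \<mu> lam w = 0"
      by (simp add: energy_norm_eq_0_iff w)
    moreover obtain v where v: "v \<in> H10 \<Omega>" "\<not> (AE x in lebesgue_on \<Omega>. v x = 0)"
      using H10_nontrivial by blast
    moreover have "g v = 0"
      using E.Cauchy_Schwarz[OF w v(1)] calculation(1) by (simp add: g v)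
    ultimately have "energy_norm \<Omega> \<mu> lam w = \<bar>g v\<bar> / energy_norm \<Omega> \<mu> lam v"
      by simp
    then show ?thesis using v by blast
  next
    case False
    then have "energy_norm \<Omega> \<mu> lam w \<noteq> 0"
      by (simp add: energy_norm_eq_0_iff w)
    then have "energy_norm \<Omega> \<mu> lam w = \<bar>g w\<bar> / energy_norm \<Omega> \<mu> lam w"
      by (simp add: g w E.nonneg power2_eq_square flip: E.nrm_power2)
    then show ?thesis using w False by blast
  qed
  fix r assume "r \<in> ?S"
  then obtain v where v: "v \<in> H10 \<Omega>" "\<not> (AE x in lebesgue_on \<Omega>. v x = 0)"
    and r: "r = \<bar>g v\<bar> / energy_norm \<Omega> \<mu> lam v" by blast
  have "energy_norm \<Omega> \<mu> lam v > 0"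
    using energy_norm_eq_0_iff[OF v(1)] v(2) E.nrm_nonneg[OF v(1)] by (simp add: order_less_le)
  then show "r \<le> energy_norm \<Omega> \<mu> lam w"
    using E.Cauchy_Schwarz[OF w v(1)] by (simp add: r g v pos_divide_le_eq)
qed

end

section \<open>The compliance form\<close>

lemma linear_compliance: "linear (compliance \<mu> lam :: real^'n^'n^'n \<Rightarrow> _)"
proof (rule linearI)
  fix \<Phi> \<Psi> :: "real^'n^'n^'n" and c :: real
  have "tensor_vec (mat 1) (trace3 (\<Phi> + \<Psi>))
      = tensor_vec (mat 1) (trace3 \<Phi>) + tensor_vec (mat 1) (trace3 \<Psi>)"
    by (simp add: vec_eq_iff tensor_vec_def trace3_def sum.distrib distrib_left)
  then show "compliance \<mu> lam (\<Phi> + \<Psi>) = compliance \<mu> lam \<Phi> + compliance \<mu> lam \<Psi>"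
    by (simp add: compliance_def algebra_simps)
  have "tensor_vec (mat 1) (trace3 (c *\<^sub>R \<Phi>)) = c *\<^sub>R tensor_vec (mat 1) (trace3 \<Phi>)"
    by (simp add: vec_eq_iff tensor_vec_def trace3_def mult.left_commute flip: sum_distrib_left)
  then show "compliance \<mu> lam (c *\<^sub>R \<Phi>) = c *\<^sub>R compliance \<mu> lam \<Phi>"
    by (simp add: compliance_def algebra_simps)
qed

lemma inner_tensor3:
  "\<Phi> \<bullet> \<Psi> = (\<Sum>i\<in>UNIV. \<Sum>j\<in>UNIV. \<Sum>k\<in>UNIV. \<Phi> $ i $ j $ k * (\<Psi> :: real^'n^'m^'l) $ i $ j $ k)"
  by (simp add: inner_vec_def)

lemma tensor_vec_mat_1_inner:
  fixes \<Psi> :: "real^'n^'n^'n"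
  shows "tensor_vec (mat 1) v \<bullet> \<Psi> = v \<bullet> trace3 \<Psi>"
proof -
  have "(\<Sum>j\<in>UNIV. \<Sum>k\<in>UNIV. tensor_vec (mat 1) v $ i $ j $ k * \<Psi> $ i $ j $ k)
      = (\<Sum>k\<in>UNIV. v $ k * \<Psi> $ i $ i $ k)" for i
  proof -
    have "(\<Sum>k\<in>UNIV. tensor_vec (mat 1) v $ i $ j $ k * \<Psi> $ i $ j $ k)
        = (if i = j then \<Sum>k\<in>UNIV. v $ k * \<Psi> $ i $ i $ k else 0)" for j
      by (simp add: tensor_vec_def mat_def)
    then show ?thesis by simp
  qed
  then have "tensor_vec (mat 1) v \<bullet> \<Psi> = (\<Sum>i\<in>UNIV. \<Sum>k\<in>UNIV. v $ k * \<Psi> $ i $ i $ k)"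
    by (simp add: inner_tensor3)
  also have "\<dots> = v \<bullet> trace3 \<Psi>"
    by (subst sum.swap) (simp add: inner_vec_def trace3_def sum_distrib_left)
  finally show ?thesis .
qed

lemma compliance_inner:
  fixes \<Phi> \<Psi> :: "real^'n^'n^'n"
  shows "compliance \<mu> lam \<Phi> \<bullet> \<Psi>
    = (\<Phi> \<bullet> \<Psi> - lam / (2 * \<mu> + real CARD('n) * lam) * (trace3 \<Phi> \<bullet> trace3 \<Psi>)) / (2 * \<mu>)"
  by (simp add: compliance_def inner_diff_left tensor_vec_mat_1_inner)

lemma trace3_inner_le: "trace3 \<Psi> \<bullet> trace3 \<Psi> \<le> real CARD('n) * (\<Psi> \<bullet> (\<Psi> :: real^'n^'n^'n))"
proof -
  have "trace3 \<Psi> \<bullet> trace3 \<Psi> = (\<Sum>k\<in>UNIV. (\<Sum>i\<in>UNIV. \<Psi> $ i $ i $ k)\<^sup>2)"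
    by (simp add: inner_vec_def trace3_def power2_eq_square)
  also have "\<dots> \<le> (\<Sum>k\<in>UNIV. (\<Sum>i\<in>UNIV. (\<Psi> $ i $ i $ k)\<^sup>2) * real CARD('n))"
    by (intro sum_mono sum_squared_le_sum_of_squares)
  also have "\<dots> = real CARD('n) * (\<Sum>i\<in>UNIV. \<Sum>k\<in>UNIV. (\<Psi> $ i $ i $ k)\<^sup>2)"
    by (subst sum.swap) (simp add: sum_distrib_left mult.commute)
  also have "\<dots> \<le> real CARD('n) * (\<Sum>i\<in>UNIV. \<Sum>j\<in>UNIV. \<Sum>k\<in>UNIV. (\<Psi> $ i $ j $ k)\<^sup>2)"
  proof (rule mult_left_mono[OF sum_mono])
    fix i :: 'n
    show "(\<Sum>k\<in>UNIV. (\<Psi> $ i $ i $ k)\<^sup>2) \<le> (\<Sum>j\<in>UNIV. \<Sum>k\<in>UNIV. (\<Psi> $ i $ j $ k)\<^sup>2)"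
      by (rule member_le_sum[of i UNIV "\<lambda>j. \<Sum>k\<in>UNIV. (\<Psi> $ i $ j $ k)\<^sup>2"]) (auto intro: sum_nonneg)
  qed simp
  also have "\<dots> = real CARD('n) * (\<Psi> \<bullet> \<Psi>)"
    by (simp add: inner_tensor3 power2_eq_square)
  finally show ?thesis .
qed

text \<open>With \<open>\<bar>tr \<Psi>\<bar>\<^sup>2 \<le> d \<bar>\<Psi>\<bar>\<^sup>2\<close> the subtracted part is at most the fraction \<open>d \<lambda> / (2 \<mu> + d \<lambda>)\<close> of
  \<open>\<bar>\<Psi>\<bar>\<^sup>2\<close>, and what remains is divided by \<open>2 \<mu>\<close>.\<close>

lemma compliance_coercive:
  fixes \<Psi> :: "real^'n^'n^'n"
  assumes "\<mu> > 0" "lam > 0"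
  shows "(norm \<Psi>)\<^sup>2 / (2 * \<mu> + real CARD('n) * lam) \<le> compliance \<mu> lam \<Psi> \<bullet> \<Psi>"
proof -
  define D where "D = 2 * \<mu> + real CARD('n) * lam"
  have D: "D > 0" using assms by (simp add: D_def add_pos_nonneg)
  have "lam / D * (trace3 \<Psi> \<bullet> trace3 \<Psi>) \<le> lam / D * (real CARD('n) * (\<Psi> \<bullet> \<Psi>))"
    using assms D by (intro mult_left_mono trace3_inner_le) auto
  then have "(\<Psi> \<bullet> \<Psi> - lam / D * (real CARD('n) * (\<Psi> \<bullet> \<Psi>))) / (2 * \<mu>) \<le> compliance \<mu> lam \<Psi> \<bullet> \<Psi>"
    unfolding compliance_inner D_def[symmetric] using assms by (intro divide_right_mono) auto
  moreover have "\<Psi> \<bullet> \<Psi> - lam / D * (real CARD('n) * (\<Psi> \<bullet> \<Psi>)) = (\<Psi> \<bullet> \<Psi>) * ((D - real CARD('n) * lam) / D)"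
    using D by (simp add: field_simps)
  moreover have "D - real CARD('n) * lam = 2 * \<mu>" by (simp add: D_def)
  ultimately show ?thesis
    using assms unfolding D_def[symmetric] by (simp add: power2_norm_eq_inner)
qed

lemma closed_sym_tensor3: "closed (sym_tensor3 :: (real^'n^'n^'n) set)"
proof -
  have "sym_tensor3 = (\<Inter>i j k. {\<Psi> :: real^'n^'n^'n. \<Psi> $ i $ j $ k = \<Psi> $ j $ i $ k})"
    by (auto simp: sym_tensor3_def)
  moreover have "closed {\<Psi> :: real^'n^'n^'n. \<Psi> $ i $ j $ k = \<Psi> $ j $ i $ k}" for i j k
    by (intro closed_Collect_eq continuous_intros)
  ultimately show ?thesis
    by (metis (no_types, lifting) closed_INT)
qed

section \<open>The space \<open>H\<^sup>-\<^sup>1(div div)\<close>\<close>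

context bounded_open
begin

definition hessian :: "(real^'n \<Rightarrow> real^'n) \<Rightarrow> real^'n \<Rightarrow> real^'n^'n^'n" where
  "hessian \<phi> x = (\<chi> i j k. pderiv_at k (classical_grad \<phi>) x $ i $ j)"

lemma hessian_L2:
  assumes "\<phi> \<in> test_funs \<Omega>" shows "hessian \<phi> \<in> L2 \<Omega>"
proof -
  define L where "L l A = (\<chi> i j k. if k = l then A $ i $ j else 0)" for l :: 'n and A :: "real^'n^'n"
  have "linear (L l)" for l
    by (rule linearI) (simp_all add: L_def vec_eq_iff)
  then have "(\<lambda>x. L l (pderiv_at l (classical_grad \<phi>) x)) \<in> test_funs \<Omega>" for l
    using test_funs_linear test_funs_pderiv_at[OF classical_grad_test_fun[OF assms]] by blast
  then have "(\<lambda>x. \<Sum>l\<in>UNIV. L l (pderiv_at l (classical_grad \<phi>) x)) \<in> test_funs \<Omega>"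
    by (rule test_funs_sum[OF finite])
  moreover have "(\<lambda>x. \<Sum>l\<in>UNIV. L l (pderiv_at l (classical_grad \<phi>) x)) = hessian \<phi>"
    by (rule ext) (simp add: hessian_def L_def vec_eq_iff)
  ultimately show ?thesis
    using test_funs_L2 by metis
qed

lemma is_divdiv_iff:
  "is_divdiv \<Omega> \<Psi> g \<longleftrightarrow> (\<forall>\<phi>\<in>test_funs \<Omega>. g \<phi> = L2_inner \<Omega> \<Psi> (hessian \<phi>))"
  by (simp add: is_divdiv_def dist_div2_def dist_div3_def hessian_def[abs_def] classical_grad_def[abs_def])

lemma Hdivdiv_L2: "\<Psi> \<in> Hdivdiv \<Omega> \<Longrightarrow> \<Psi> \<in> L2 \<Omega>"
  by (simp add: Hdivdiv_def)

lemma divdiv: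
  assumes "\<Psi> \<in> Hdivdiv \<Omega>"
  shows "divdiv \<Omega> \<Psi> \<in> Hm1 \<Omega>" "is_divdiv \<Omega> \<Psi> (divdiv \<Omega> \<Psi>)"
proof -
  have "\<exists>g. g \<in> Hm1 \<Omega> \<and> is_divdiv \<Omega> \<Psi> g"
    using assms by (auto simp: Hdivdiv_def)
  from someI_ex[OF this] show "divdiv \<Omega> \<Psi> \<in> Hm1 \<Omega>" "is_divdiv \<Omega> \<Psi> (divdiv \<Omega> \<Psi>)"
    by (auto simp: divdiv_def)
qed

lemma Hm1_axpy:
  assumes "g \<in> Hm1 \<Omega>" "v \<in> H10 \<Omega>" "w \<in> H10 \<Omega>"
  shows "g (\<lambda>x. v x + c *\<^sub>R w x) = g v + c * g w"
proof -
  have "(\<lambda>x. c *\<^sub>R w x) \<in> H10 \<Omega>"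
    using H10_axpy[OF test_funs_H10[OF test_funs_zero] assms(3), of c] by simp
  then have "g (\<lambda>x. v x + c *\<^sub>R w x) = g v + g (\<lambda>x. c *\<^sub>R w x)"
    using assms by (simp add: Hm1_def)
  then show ?thesis
    using assms by (simp add: Hm1_def)
qed

lemma Hm1_bound:
  assumes "g \<in> Hm1 \<Omega>"
  obtains C where "C \<ge> 0" "\<And>v. v \<in> H10 \<Omega> \<Longrightarrow> \<bar>g v\<bar> \<le> C * H1_norm \<Omega> v"
proof -
  obtain C where C: "\<And>v. v \<in> H10 \<Omega> \<Longrightarrow> \<bar>g v\<bar> \<le> C * H1_norm \<Omega> v"
    using assms unfolding Hm1_def by blast
  have "\<bar>g v\<bar> \<le> \<bar>C\<bar> * H1_norm \<Omega> v" if "v \<in> H10 \<Omega>" for v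
    using C[OF that] mult_right_mono[OF abs_ge_self[of C] H1.nrm_nonneg[OF H10_H1[OF that]]]
    by linarith
  then show ?thesis using that[of "\<bar>C\<bar>"] by simp
qed

text \<open>By density; in particular the functional chosen in the definition of \<open>divdiv\<close> is determined on \<open>H\<^sup>1\<^sub>0\<close> by the
  distribution \<open>div div \<Psi>\<close>.\<close>

lemma Hm1_eqI:
  assumes g: "g \<in> Hm1 \<Omega>" and h: "h \<in> Hm1 \<Omega>"
    and eq: "\<And>\<phi>. \<phi> \<in> test_funs \<Omega> \<Longrightarrow> g \<phi> = h \<phi>" and v: "v \<in> H10 \<Omega>"
  shows "g v = h v"
proof -
  obtain C D where C: "C \<ge> 0" "\<And>v. v \<in> H10 \<Omega> \<Longrightarrow> \<bar>g v\<bar> \<le> C * H1_norm \<Omega> v"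
    and D: "D \<ge> 0" "\<And>v. v \<in> H10 \<Omega> \<Longrightarrow> \<bar>h v\<bar> \<le> D * H1_norm \<Omega> v"
    using Hm1_bound[OF g] Hm1_bound[OF h] by metis
  have "\<bar>g v - h v\<bar> \<le> 0 + e" if "e > 0" for e
  proof -
    have "e / (C + D + 1) > 0" using that C(1) D(1) by simp
    then obtain \<phi> where \<phi>: "\<phi> \<in> test_funs \<Omega>" "H1_norm \<Omega> (\<lambda>x. v x - \<phi> x) < e / (C + D + 1)"
      using H10_approx[OF v] by blast
    have d: "(\<lambda>x. v x - \<phi> x) \<in> H10 \<Omega>"
      using H10_axpy[OF v test_funs_H10[OF \<phi>(1)], of "-1"] by simp
    have "g v - h v = g (\<lambda>x. v x - \<phi> x) - h (\<lambda>x. v x - \<phi> x)"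
      using Hm1_axpy[OF g v test_funs_H10[OF \<phi>(1)], of "-1"]
        Hm1_axpy[OF h v test_funs_H10[OF \<phi>(1)], of "-1"] eq[OF \<phi>(1)] by simp
    then have "\<bar>g v - h v\<bar> \<le> (C + D) * H1_norm \<Omega> (\<lambda>x. v x - \<phi> x)"
      using C(2)[OF d] D(2)[OF d] by (simp add: distrib_right)
    also have "\<dots> \<le> (C + D + 1) * H1_norm \<Omega> (\<lambda>x. v x - \<phi> x)"
      using H1.nrm_nonneg[OF H10_H1[OF d]] by (intro mult_right_mono) auto
    also have "\<dots> \<le> e"
      using \<phi>(2) C(1) D(1) by (simp add: pos_less_divide_eq mult.commute)
    finally show ?thesis by simp
  qed
  then have "\<bar>g v - h v\<bar> \<le> 0"
    by (rule field_le_epsilon)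
  then show ?thesis by simp
qed

end

context elasticity
begin

lemma energy_Hm1:
  assumes "w \<in> H10 \<Omega>" shows "energy w \<in> Hm1 \<Omega>"
  unfolding Hm1_def
proof (intro CollectI conjI ballI allI)
  fix u v assume "u \<in> H10 \<Omega>" "v \<in> H10 \<Omega>"
  then show "energy w (\<lambda>x. u x + v x) = energy w u + energy w v"
    using E.axpy_right[of u v w 1] assms by simp
next
  fix c v assume "v \<in> H10 \<Omega>"
  then show "energy w (\<lambda>x. c *\<^sub>R v x) = c * energy w v"
    using E.axpy_right[OF E.closed_zero _ assms, of v c] E.zero_left[OF assms]
      E.sym[OF E.closed_zero assms] by simp
next
  obtain K where K: "K > 0" "\<And>v. v \<in> H10 \<Omega> \<Longrightarrow> energy_norm \<Omega> \<mu> lam v \<le> K * H1_norm \<Omega> v"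
    using energy_norm_le_H1_norm by blast
  have "\<bar>energy w v\<bar> \<le> (energy_norm \<Omega> \<mu> lam w * K) * H1_norm \<Omega> v" if "v \<in> H10 \<Omega>" for v
    using E.Cauchy_Schwarz[OF assms that] mult_left_mono[OF K(2)[OF that] E.nrm_nonneg[OF assms]]
    by (simp add: mult.assoc)
  then show "\<exists>C. \<forall>v\<in>H10 \<Omega>. \<bar>energy w v\<bar> \<le> C * H1_norm \<Omega> v" by blast
qed

lemma Hm1_Riesz:
  assumes g: "g \<in> Hm1 \<Omega>"
  obtains w where "w \<in> H10 \<Omega>" "\<And>v. v \<in> H10 \<Omega> \<Longrightarrow> g v = energy w v"
proof -
  obtain K where K: "K > 0" "\<And>v. v \<in> H10 \<Omega> \<Longrightarrow> H1_norm \<Omega> v \<le> K * energy_norm \<Omega> \<mu> lam v"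
    using H1_norm_le_energy_norm by blast
  obtain C where C: "C \<ge> 0" "\<And>v. v \<in> H10 \<Omega> \<Longrightarrow> \<bar>g v\<bar> \<le> C * H1_norm \<Omega> v"
    using Hm1_bound[OF g] by blast
  have "\<bar>g v\<bar> \<le> (C * K) * energy_norm \<Omega> \<mu> lam v" if "v \<in> H10 \<Omega>" for v
    using C(2)[OF that] mult_left_mono[OF K(2)[OF that] C(1)] by (simp add: mult.assoc)
  then obtain w where "w \<in> H10 \<Omega>" "\<And>v. v \<in> H10 \<Omega> \<Longrightarrow> energy w v = g v"
    using E.Riesz[of g "C * K"] Hm1_axpy[OF g] by blast
  then show ?thesis using that by metis
qed

lemma L2_inner_Hm1:
  assumes f: "f \<in> L2 \<Omega>" shows "L2_inner \<Omega> f \<in> Hm1 \<Omega>"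
  unfolding Hm1_def
proof (intro CollectI conjI ballI allI)
  fix u v assume "u \<in> H10 \<Omega>" "v \<in> H10 \<Omega>"
  then show "L2_inner \<Omega> f (\<lambda>x. u x + v x) = L2_inner \<Omega> f u + L2_inner \<Omega> f v"
    using L2.axpy_right[of u \<Omega> v f 1] f by (simp add: H10_H1 H1_L2)
next
  fix c v assume "v \<in> H10 \<Omega>"
  then show "L2_inner \<Omega> f (\<lambda>x. c *\<^sub>R v x) = c * L2_inner \<Omega> f v"
    by (simp add: L2_inner_def)
next
  have "\<bar>L2_inner \<Omega> f v\<bar> \<le> L2_norm \<Omega> f * H1_norm \<Omega> v" if "v \<in> H10 \<Omega>" for v
    using L2.Cauchy_Schwarz[OF f H1_L2[OF H10_H1[OF that]]]
      mult_left_mono[OF L2_norm_le_H1_norm(1)[OF H10_H1[OF that]] L2.nrm_nonneg[OF f]] by linarith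
  then show "\<exists>C. \<forall>v\<in>H10 \<Omega>. \<bar>L2_inner \<Omega> f v\<bar> \<le> C * H1_norm \<Omega> v" by blast
qed

text \<open>The Riesz representative of \<open>div div \<Psi>\<close> in the energy inner product, written \<open>T \<Psi>\<close> above.\<close>

definition lift :: "(real^'n \<Rightarrow> real^'n^'n^'n) \<Rightarrow> real^'n \<Rightarrow> real^'n" where
  "lift \<Psi> = (SOME w. w \<in> H10 \<Omega> \<and> (\<forall>v\<in>H10 \<Omega>. divdiv \<Omega> \<Psi> v = energy w v))"

lemma lift:
  assumes "\<Psi> \<in> Hdivdiv \<Omega>"
  shows "lift \<Psi> \<in> H10 \<Omega>" "\<And>v. v \<in> H10 \<Omega> \<Longrightarrow> divdiv \<Omega> \<Psi> v = energy (lift \<Psi>) v"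
proof -
  have "\<exists>w. w \<in> H10 \<Omega> \<and> (\<forall>v\<in>H10 \<Omega>. divdiv \<Omega> \<Psi> v = energy w v)"
    using Hm1_Riesz[OF divdiv(1)[OF assms]] by metis
  from someI_ex[OF this] show "lift \<Psi> \<in> H10 \<Omega>"
    "\<And>v. v \<in> H10 \<Omega> \<Longrightarrow> divdiv \<Omega> \<Psi> v = energy (lift \<Psi>) v"
    by (auto simp: lift_def)
qed

text \<open>To recognise \<open>w\<close> as the representative of \<open>div div \<Psi>\<close> it is enough to test with smooth functions, where
  both derivatives can be moved onto the test function.\<close>

lemma
  assumes \<Psi>: "\<Psi> \<in> L2 \<Omega>" "AE x in lebesgue_on \<Omega>. \<Psi> x \<in> sym_tensor3" and w: "w \<in> H10 \<Omega>"
    and eq: "\<And>\<phi>. \<phi> \<in> test_funs \<Omega> \<Longrightarrow> energy w \<phi> = L2_inner \<Omega> \<Psi> (hessian \<phi>)"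
  shows HdivdivI: "\<Psi> \<in> Hdivdiv \<Omega>"
    and divdiv_eq: "v \<in> H10 \<Omega> \<Longrightarrow> divdiv \<Omega> \<Psi> v = energy w v"
proof -
  have "is_divdiv \<Omega> \<Psi> (energy w)"
    using eq by (simp add: is_divdiv_iff)
  then show H: "\<Psi> \<in> Hdivdiv \<Omega>"
    using \<Psi> energy_Hm1[OF w] by (auto simp: Hdivdiv_def)
  show "divdiv \<Omega> \<Psi> v = energy w v" if "v \<in> H10 \<Omega>"
    using divdiv[OF H] eq by (intro Hm1_eqI[OF _ energy_Hm1[OF w] _ that]) (auto simp: is_divdiv_iff)
qed

lemma lift_test_fun:
  assumes "\<Psi> \<in> Hdivdiv \<Omega>" "\<phi> \<in> test_funs \<Omega>"
  shows "energy (lift \<Psi>) \<phi> = L2_inner \<Omega> \<Psi> (hessian \<phi>)"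
  using lift(2)[OF assms(1) test_funs_H10[OF assms(2)]] divdiv(2)[OF assms(1)] assms(2)
  by (simp add: is_divdiv_iff)

lemma
  assumes \<Phi>: "\<Phi> \<in> Hdivdiv \<Omega>" and \<Psi>: "\<Psi> \<in> Hdivdiv \<Omega>"
  shows Hdivdiv_axpy: "(\<lambda>x. \<Phi> x + c *\<^sub>R \<Psi> x) \<in> Hdivdiv \<Omega>"
    and divdiv_axpy: "v \<in> H10 \<Omega> \<Longrightarrow>
      divdiv \<Omega> (\<lambda>x. \<Phi> x + c *\<^sub>R \<Psi> x) v = divdiv \<Omega> \<Phi> v + c * divdiv \<Omega> \<Psi> v"
proof -
  note lifts = lift(1)[OF \<Phi>] lift(1)[OF \<Psi>]
  note L2s = Hdivdiv_L2[OF \<Phi>] Hdivdiv_L2[OF \<Psi>]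
  have "AE x in lebesgue_on \<Omega>. \<Phi> x \<in> sym_tensor3" "AE x in lebesgue_on \<Omega>. \<Psi> x \<in> sym_tensor3"
    using \<Phi> \<Psi> by (simp_all add: Hdivdiv_def)
  then have sym: "AE x in lebesgue_on \<Omega>. \<Phi> x + c *\<^sub>R \<Psi> x \<in> sym_tensor3"
    by eventually_elim (auto simp: sym_tensor3_def)
  have eq: "energy (\<lambda>x. lift \<Phi> x + c *\<^sub>R lift \<Psi> x) \<phi> = L2_inner \<Omega> (\<lambda>x. \<Phi> x + c *\<^sub>R \<Psi> x) (hessian \<phi>)"
    if "\<phi> \<in> test_funs \<Omega>" for \<phi>
    using that by (simp add: E.axpy_left L2.axpy_left lifts L2s test_funs_H10 hessian_L2
        lift_test_fun \<Phi> \<Psi>)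
  show "(\<lambda>x. \<Phi> x + c *\<^sub>R \<Psi> x) \<in> Hdivdiv \<Omega>"
    by (rule HdivdivI[OF L2_axpy[OF L2s] sym H10_axpy[OF lifts] eq])
  show "divdiv \<Omega> (\<lambda>x. \<Phi> x + c *\<^sub>R \<Psi> x) v = divdiv \<Omega> \<Phi> v + c * divdiv \<Omega> \<Psi> v" if "v \<in> H10 \<Omega>"
    using divdiv_eq[OF L2_axpy[OF L2s] sym H10_axpy[OF lifts] eq that]
    by (simp add: E.axpy_left lifts that lift(2) \<Phi> \<Psi>)
qed

lemma dual_norm_divdiv:
  assumes "\<Psi> \<in> Hdivdiv \<Omega>" "w \<in> H10 \<Omega>" "\<And>v. v \<in> H10 \<Omega> \<Longrightarrow> divdiv \<Omega> \<Psi> v = energy w v"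
  shows "energy_norm \<Omega> \<mu> lam (lift \<Psi>) = energy_norm \<Omega> \<mu> lam w"
  using dual_norm_eq_energy_norm[OF assms(2,3)] dual_norm_eq_energy_norm[OF lift, OF assms(1,1)]
  by simp

end

section \<open>Well-posedness of the mixed problem\<close>

locale mixed_problem = elasticity \<Omega> \<mu> lam for \<Omega> :: "(real^'n) set" and \<mu> lam :: real +
  fixes \<iota> :: real
  assumes iota_pos: "\<iota> > 0"
begin

definition form :: "(real^'n \<Rightarrow> real^'n^'n^'n) \<Rightarrow> (real^'n \<Rightarrow> real^'n^'n^'n) \<Rightarrow> real" where
  "form \<Phi> \<Psi> = L2_inner \<Omega> (\<lambda>x. compliance \<mu> lam (\<Phi> x)) \<Psi> / \<iota>\<^sup>2"

lemma compliance_L2: "\<Phi> \<in> L2 \<Omega> \<Longrightarrow> (\<lambda>x. compliance \<mu> lam (\<Phi> x)) \<in> L2 \<Omega>"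
  by (rule L2_linear[OF linear_compliance])

lemma form_axpy_left:
  assumes "\<Phi> \<in> L2 \<Omega>" "\<Psi> \<in> L2 \<Omega>" "\<Theta> \<in> L2 \<Omega>"
  shows "form (\<lambda>x. \<Phi> x + c *\<^sub>R \<Psi> x) \<Theta> = form \<Phi> \<Theta> + c * form \<Psi> \<Theta>"
  using assms
  by (simp add: form_def linear_add[OF linear_compliance] linear_cmul[OF linear_compliance]
      L2.axpy_left compliance_L2 add_divide_distrib)

lemma form_sym: "form \<Phi> \<Psi> = form \<Psi> \<Phi>"
proof -
  have "compliance \<mu> lam A \<bullet> B = compliance \<mu> lam B \<bullet> A" for A B :: "real^'n^'n^'n"
    unfolding compliance_inner by (simp add: inner_commute)
  then show ?thesis by (simp add: form_def L2_inner_def)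
qed

lemma form_coercive:
  obtains c where "c > 0" "\<And>\<Psi>. \<Psi> \<in> L2 \<Omega> \<Longrightarrow> c * (L2_norm \<Omega> \<Psi>)\<^sup>2 \<le> form \<Psi> \<Psi>"
proof
  define D where "D = 2 * \<mu> + real CARD('n) * lam"
  have D: "D > 0" using mu_pos lam_pos by (simp add: D_def add_pos_nonneg)
  show "1 / (D * \<iota>\<^sup>2) > 0" using D iota_pos by simp
  fix \<Psi> :: "real^'n \<Rightarrow> real^'n^'n^'n" assume \<Psi>: "\<Psi> \<in> L2 \<Omega>"
  have "integral\<^sup>L (lebesgue_on \<Omega>) (\<lambda>x. (norm (\<Psi> x))\<^sup>2 / D)
      \<le> integral\<^sup>L (lebesgue_on \<Omega>) (\<lambda>x. compliance \<mu> lam (\<Psi> x) \<bullet> \<Psi> x)"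
    using compliance_coercive[OF mu_pos lam_pos] L2_square_integrable[OF \<Psi>]
      integrable_L2_inner[OF compliance_L2[OF \<Psi>] \<Psi>]
    by (intro integral_mono) (auto simp: D_def)
  then have "(L2_norm \<Omega> \<Psi>)\<^sup>2 / D / \<iota>\<^sup>2 \<le> form \<Psi> \<Psi>"
    unfolding form_def L2_norm_power2_integral L2_inner_def
    by (intro divide_right_mono) simp_all
  then show "1 / (D * \<iota>\<^sup>2) * (L2_norm \<Omega> \<Psi>)\<^sup>2 \<le> form \<Psi> \<Psi>" by simp
qed

lemma form_nonneg:
  assumes "\<Psi> \<in> L2 \<Omega>" shows "0 \<le> form \<Psi> \<Psi>"
proof -
  obtain c where "c > 0" "c * (L2_norm \<Omega> \<Psi>)\<^sup>2 \<le> form \<Psi> \<Psi>"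
    using form_coercive assms by blast
  moreover from this have "0 \<le> c * (L2_norm \<Omega> \<Psi>)\<^sup>2" by simp
  ultimately show ?thesis by linarith
qed

lemma form_bounded:
  obtains K where "\<And>\<Psi>. \<Psi> \<in> L2 \<Omega> \<Longrightarrow> form \<Psi> \<Psi> \<le> K * (L2_norm \<Omega> \<Psi>)\<^sup>2"
proof -
  have bl: "bounded_linear (compliance \<mu> lam :: real^'n^'n^'n \<Rightarrow> real^'n^'n^'n)"
    using linear_compliance linear_linear by blast
  obtain k where k: "k > 0" "\<And>A :: real^'n^'n^'n. norm (compliance \<mu> lam A) \<le> norm A * k"
    using bounded_linear.pos_bounded[OF bl] by blast
  have "form \<Psi> \<Psi> \<le> (k / \<iota>\<^sup>2) * (L2_norm \<Omega> \<Psi>)\<^sup>2" if \<Psi>: "\<Psi> \<in> L2 \<Omega>" for \<Psi>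
  proof -
    have "L2_inner \<Omega> (\<lambda>x. compliance \<mu> lam (\<Psi> x)) \<Psi>
        \<le> L2_norm \<Omega> (\<lambda>x. compliance \<mu> lam (\<Psi> x)) * L2_norm \<Omega> \<Psi>"
      using L2.Cauchy_Schwarz[OF compliance_L2[OF \<Psi>] \<Psi>] by linarith
    also have "\<dots> \<le> (k * L2_norm \<Omega> \<Psi>) * L2_norm \<Omega> \<Psi>"
      using k by (intro mult_right_mono L2_norm_bounded_linear bl \<Psi> L2.nrm_nonneg)
        (auto simp: mult.commute)
    finally show ?thesis
      using iota_pos by (simp add: form_def divide_right_mono power2_eq_square mult.assoc)
  qed
  then show ?thesis by (rule that)
qed

text \<open>The inner product of the norm \<open>Hdivdiv_norm\<close> (\<open>S_nrm_eq_Hdivdiv_norm\<close>): the dual norm of \<open>div div \<Psi>\<close> is the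
  energy norm of its representative.\<close>

definition graph_inner :: "(real^'n \<Rightarrow> real^'n^'n^'n) \<Rightarrow> (real^'n \<Rightarrow> real^'n^'n^'n) \<Rightarrow> real" where
  "graph_inner \<Phi> \<Psi> = form \<Phi> \<Psi> + energy (lift \<Phi>) (lift \<Psi>)"

lemma semi_inner_graph: "semi_inner (Hdivdiv \<Omega>) graph_inner"
proof
  have "(\<lambda>x. 0) \<in> Hdivdiv \<Omega>"
  proof (rule HdivdivI[OF L2.closed_zero _ E.closed_zero])
    show "AE x in lebesgue_on \<Omega>. 0 \<in> (sym_tensor3 :: (real^'n^'n^'n) set)"
      by (simp add: sym_tensor3_def)
    show "energy (\<lambda>x. 0) \<phi> = L2_inner \<Omega> (\<lambda>x. 0) (hessian \<phi>)" if "\<phi> \<in> test_funs \<Omega>" for \<phi>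
      using that by (simp add: E.zero_left L2.zero_left test_funs_H10 hessian_L2)
  qed
  then show "Hdivdiv \<Omega> \<noteq> {}" by blast
  show "0 \<le> graph_inner \<Psi> \<Psi>" if "\<Psi> \<in> Hdivdiv \<Omega>" for \<Psi>
    using that by (simp add: graph_inner_def form_nonneg Hdivdiv_L2 E.nonneg lift)
  fix \<Phi> \<Psi> :: "real^'n \<Rightarrow> real^'n^'n^'n" assume \<Phi>: "\<Phi> \<in> Hdivdiv \<Omega>" and \<Psi>: "\<Psi> \<in> Hdivdiv \<Omega>"
  show "(\<lambda>x. \<Phi> x + c *\<^sub>R \<Psi> x) \<in> Hdivdiv \<Omega>" for c
    by (rule Hdivdiv_axpy[OF \<Phi> \<Psi>])
  show "graph_inner \<Phi> \<Psi> = graph_inner \<Psi> \<Phi>"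
    using E.sym[OF lift(1) lift(1), OF \<Phi> \<Psi>] form_sym by (simp add: graph_inner_def)
  fix \<Theta> c assume \<Theta>: "\<Theta> \<in> Hdivdiv \<Omega>"
  show "graph_inner (\<lambda>x. \<Phi> x + c *\<^sub>R \<Psi> x) \<Theta> = graph_inner \<Phi> \<Theta> + c * graph_inner \<Psi> \<Theta>"
    using divdiv_axpy[OF \<Phi> \<Psi> lift(1)[OF \<Theta>], of c]
      form_axpy_left[OF Hdivdiv_L2 Hdivdiv_L2 Hdivdiv_L2, OF \<Phi> \<Psi> \<Theta>, of c]
    by (simp add: graph_inner_def lift(2)[symmetric] lift(1) Hdivdiv_axpy \<Phi> \<Psi> \<Theta> algebra_simps)
qed

sublocale S: semi_inner "Hdivdiv \<Omega>" graph_inner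
  by (rule semi_inner_graph)

lemma S_nrm_power2:
  assumes "\<Psi> \<in> Hdivdiv \<Omega>"
  shows "(S.nrm \<Psi>)\<^sup>2 = form \<Psi> \<Psi> + (energy_norm \<Omega> \<mu> lam (lift \<Psi>))\<^sup>2"
  using assms by (simp add: S.nrm_power2 graph_inner_def E.nrm_power2 lift)

lemma S_nrm_eq_Hdivdiv_norm:
  assumes "\<Psi> \<in> Hdivdiv \<Omega>" shows "S.nrm \<Psi> = Hdivdiv_norm \<Omega> \<mu> lam \<iota> \<Psi>"
proof -
  have "dual_norm \<Omega> \<mu> lam (divdiv \<Omega> \<Psi>) = energy_norm \<Omega> \<mu> lam (lift \<Psi>)"
    by (rule dual_norm_eq_energy_norm[OF lift, OF assms assms])
  moreover have "(compliance_norm \<Omega> \<mu> lam \<Psi>)\<^sup>2 / \<iota>\<^sup>2 = form \<Psi> \<Psi>"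
    using form_nonneg[OF Hdivdiv_L2[OF assms]] iota_pos
    by (simp add: compliance_norm_def form_def zero_le_divide_iff)
  ultimately have "Hdivdiv_norm \<Omega> \<mu> lam \<iota> \<Psi> = sqrt ((S.nrm \<Psi>)\<^sup>2)"
    by (simp add: Hdivdiv_norm_def S_nrm_power2 assms)
  then show ?thesis
    by (simp add: S.nrm_nonneg assms)
qed

lemma energy_norm_lift_le:
  assumes "\<Psi> \<in> Hdivdiv \<Omega>" shows "energy_norm \<Omega> \<mu> lam (lift \<Psi>) \<le> S.nrm \<Psi>"
proof (rule power2_le_imp_le)
  show "(energy_norm \<Omega> \<mu> lam (lift \<Psi>))\<^sup>2 \<le> (S.nrm \<Psi>)\<^sup>2"
    using form_nonneg[OF Hdivdiv_L2[OF assms]] by (simp add: S_nrm_power2 assms)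
qed (rule S.nrm_nonneg[OF assms])

text \<open>In the limit of a Cauchy sequence the tensors converge in \<open>L\<^sup>2\<close>, by coercivity of the compliance,
  and the representatives of their \<open>div div\<close> converge in the energy norm. The two limits belong
  together because \<open>div div\<close> is defined by duality with test functions.\<close>

sublocale S: complete_semi_inner "Hdivdiv \<Omega>" graph_inner
proof
  fix s :: "nat \<Rightarrow> real^'n \<Rightarrow> real^'n^'n^'n"
  assume s: "\<And>n. s n \<in> Hdivdiv \<Omega>"
    and Cau: "\<And>e. e > 0 \<Longrightarrow> \<exists>N. \<forall>m\<ge>N. \<forall>n\<ge>N. S.nrm (\<lambda>x. s m x - s n x) < e"
  note sL2 = Hdivdiv_L2[OF s]
  have d: "(\<lambda>x. s m x - s n x) \<in> Hdivdiv \<Omega>" for m n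
    by (intro S.closed_diff s)
  have lift_diff: "energy_norm \<Omega> \<mu> lam (lift (\<lambda>x. \<Phi> x - \<Psi> x))
      = energy_norm \<Omega> \<mu> lam (\<lambda>x. lift \<Phi> x - w x)"
    if "\<Phi> \<in> Hdivdiv \<Omega>" "\<Psi> \<in> Hdivdiv \<Omega>" "w \<in> H10 \<Omega>" "\<And>v. v \<in> H10 \<Omega> \<Longrightarrow> divdiv \<Omega> \<Psi> v = energy w v"
    for \<Phi> \<Psi> w
    using that divdiv_axpy[OF that(1,2), of _ "-1"]
    by (intro dual_norm_divdiv S.closed_diff E.closed_diff lift) (auto simp: E.diff_left lift)
  obtain c where c: "c > 0" "\<And>\<Psi>. \<Psi> \<in> L2 \<Omega> \<Longrightarrow> c * (L2_norm \<Omega> \<Psi>)\<^sup>2 \<le> form \<Psi> \<Psi>"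
    using form_coercive by blast
  have L2_le: "sqrt c * L2_norm \<Omega> \<Psi> \<le> S.nrm \<Psi>" if "\<Psi> \<in> Hdivdiv \<Omega>" for \<Psi>
  proof (rule power2_le_imp_le)
    show "(sqrt c * L2_norm \<Omega> \<Psi>)\<^sup>2 \<le> (S.nrm \<Psi>)\<^sup>2"
      using c(1) c(2)[OF Hdivdiv_L2[OF that]]
      by (simp add: S_nrm_power2 that power_mult_distrib add_increasing2)
  qed (rule S.nrm_nonneg[OF that])
  have L2_Cau: "\<exists>N. \<forall>m\<ge>N. \<forall>n\<ge>N. L2_norm \<Omega> (\<lambda>x. s m x - s n x) < e" if "e > 0" for e
  proof -
    have "sqrt c * e > 0" using c(1) that by simp
    then obtain N where N: "\<And>m n. \<lbrakk>m \<ge> N; n \<ge> N\<rbrakk> \<Longrightarrow> S.nrm (\<lambda>x. s m x - s n x) < sqrt c * e"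
      using Cau by blast
    have "L2_norm \<Omega> (\<lambda>x. s m x - s n x) < e" if "m \<ge> N" "n \<ge> N" for m n
    proof -
      have "sqrt c * L2_norm \<Omega> (\<lambda>x. s m x - s n x) < sqrt c * e"
        using L2_le[OF d[of m n]] N[OF that] by linarith
      then show ?thesis using c(1) by simp
    qed
    then show ?thesis by blast
  qed
  obtain \<Psi> where \<Psi>: "\<Psi> \<in> L2 \<Omega>" "(\<lambda>n. L2_norm \<Omega> (\<lambda>x. s n x - \<Psi> x)) \<longlonglongrightarrow> 0"
    and closed: "\<And>S. \<lbrakk>closed S; \<And>n. AE x in lebesgue_on \<Omega>. s n x \<in> S\<rbrakk> \<Longrightarrow> AE x in lebesgue_on \<Omega>. \<Psi> x \<in> S"
  proof (rule L2_complete[of \<Omega> s, OF finite_measure_domain sL2 L2_Cau])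
    fix f assume "f \<in> L2 \<Omega>" "(\<lambda>n. L2_norm \<Omega> (\<lambda>x. s n x - f x)) \<longlonglongrightarrow> 0"
      and "\<And>S. \<lbrakk>closed S; \<And>n. AE x in lebesgue_on \<Omega>. s n x \<in> S\<rbrakk> \<Longrightarrow> AE x in lebesgue_on \<Omega>. f x \<in> S"
    then show thesis by (rule that)
  qed
  have sym: "AE x in lebesgue_on \<Omega>. \<Psi> x \<in> sym_tensor3"
    using s by (intro closed closed_sym_tensor3) (simp add: Hdivdiv_def)
  have "energy_norm \<Omega> \<mu> lam (\<lambda>x. lift (s m) x - lift (s n) x) \<le> S.nrm (\<lambda>x. s m x - s n x)" for m n
    using energy_norm_lift_le[OF d[of m n]] lift_diff[of "s m" "s n" "lift (s n)"] s lift by simp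
  then have "\<exists>N. \<forall>m\<ge>N. \<forall>n\<ge>N. energy_norm \<Omega> \<mu> lam (\<lambda>x. lift (s m) x - lift (s n) x) < e" if "e > 0" for e
    using Cau[OF that] by (meson le_less_trans)
  then obtain w where w: "w \<in> H10 \<Omega>" "(\<lambda>n. energy_norm \<Omega> \<mu> lam (\<lambda>x. lift (s n) x - w x)) \<longlonglongrightarrow> 0"
    using E.complete[of "\<lambda>n. lift (s n)"] lift(1)[OF s] by blast
  have eq: "energy w \<phi> = L2_inner \<Omega> \<Psi> (hessian \<phi>)" if \<phi>: "\<phi> \<in> test_funs \<Omega>" for \<phi>
  proof (rule LIMSEQ_unique)
    show "(\<lambda>n. energy (lift (s n)) \<phi>) \<longlonglongrightarrow> energy w \<phi>"
      by (intro E.tendsto_left lift s w test_funs_H10 \<phi>)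
    show "(\<lambda>n. energy (lift (s n)) \<phi>) \<longlonglongrightarrow> L2_inner \<Omega> \<Psi> (hessian \<phi>)"
      unfolding lift_test_fun[OF s \<phi>] by (intro L2.tendsto_left sL2 \<Psi> hessian_L2 \<phi>)
  qed
  have \<Psi>H: "\<Psi> \<in> Hdivdiv \<Omega>"
    by (rule HdivdivI[OF \<Psi>(1) sym w(1) eq])
  have w_eq: "divdiv \<Omega> \<Psi> v = energy w v" if "v \<in> H10 \<Omega>" for v
    by (rule divdiv_eq[OF \<Psi>(1) sym w(1) eq that])
  obtain K where K: "\<And>\<Psi>. \<Psi> \<in> L2 \<Omega> \<Longrightarrow> form \<Psi> \<Psi> \<le> K * (L2_norm \<Omega> \<Psi>)\<^sup>2"
    using form_bounded by blast
  have dn: "(\<lambda>x. s n x - \<Psi> x) \<in> Hdivdiv \<Omega>" for n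
    by (intro S.closed_diff s \<Psi>H)
  have "(\<lambda>n. K * (L2_norm \<Omega> (\<lambda>x. s n x - \<Psi> x))\<^sup>2 + (energy_norm \<Omega> \<mu> lam (\<lambda>x. lift (s n) x - w x))\<^sup>2)
      \<longlonglongrightarrow> K * 0\<^sup>2 + 0\<^sup>2"
    by (intro tendsto_intros \<Psi> w)
  then have lim: "(\<lambda>n. K * (L2_norm \<Omega> (\<lambda>x. s n x - \<Psi> x))\<^sup>2
      + (energy_norm \<Omega> \<mu> lam (\<lambda>x. lift (s n) x - w x))\<^sup>2) \<longlonglongrightarrow> 0"
    by simp
  have "(S.nrm (\<lambda>x. s n x - \<Psi> x))\<^sup>2
      \<le> K * (L2_norm \<Omega> (\<lambda>x. s n x - \<Psi> x))\<^sup>2 + (energy_norm \<Omega> \<mu> lam (\<lambda>x. lift (s n) x - w x))\<^sup>2" for n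
    using K[OF Hdivdiv_L2[OF dn]] by (simp add: S_nrm_power2 dn lift_diff[OF s \<Psi>H w(1) w_eq])
  then have "(\<lambda>n. (S.nrm (\<lambda>x. s n x - \<Psi> x))\<^sup>2) \<longlonglongrightarrow> 0"
    by (intro tendsto_sandwich[OF _ _ tendsto_const lim]) auto
  then have "(\<lambda>n. sqrt ((S.nrm (\<lambda>x. s n x - \<Psi> x))\<^sup>2)) \<longlonglongrightarrow> sqrt 0"
    by (rule tendsto_real_sqrt)
  then have "(\<lambda>n. S.nrm (\<lambda>x. s n x - \<Psi> x)) \<longlonglongrightarrow> 0"
    by (simp add: S.nrm_nonneg dn)
  then show "\<exists>\<Psi>\<in>Hdivdiv \<Omega>. (\<lambda>n. S.nrm (\<lambda>x. s n x - \<Psi> x)) \<longlonglongrightarrow> 0"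
    using \<Psi>H by blast
qed

lemma mixed_solution_iff:
  "mixed_solution \<Omega> \<mu> lam \<iota> f \<Phi> u \<longleftrightarrow> \<Phi> \<in> Hdivdiv \<Omega> \<and> u \<in> H10 \<Omega> \<and>
     (\<forall>\<Psi>\<in>Hdivdiv \<Omega>. form \<Phi> \<Psi> = energy (lift \<Psi>) u) \<and>
     (\<forall>v\<in>H10 \<Omega>. energy (lift \<Phi>) v + energy u v = L2_inner \<Omega> f v)"
  unfolding mixed_solution_def form_def[symmetric] energy_def[symmetric]
  by (intro conj_cong refl ball_cong) (auto simp: lift(2))

text \<open>Testing the difference of the first equations with \<open>\<Phi>' - \<Phi>\<close>, that of the second with \<open>u' - u\<close>, and
  adding, the mixed terms cancel and two nonnegative terms with sum \<open>0\<close> remain.\<close>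

lemma mixed_solution_unique:
  assumes "mixed_solution \<Omega> \<mu> lam \<iota> f \<Phi> u" "mixed_solution \<Omega> \<mu> lam \<iota> f \<Phi>' u'"
  shows "AE x in lebesgue_on \<Omega>. \<Phi>' x = \<Phi> x" "AE x in lebesgue_on \<Omega>. u' x = u x"
proof -
  let ?\<Phi> = "\<lambda>x. \<Phi>' x - \<Phi> x" and ?u = "\<lambda>x. u' x - u x"
  have mem: "\<Phi> \<in> Hdivdiv \<Omega>" "\<Phi>' \<in> Hdivdiv \<Omega>" "u \<in> H10 \<Omega>" "u' \<in> H10 \<Omega>"
    using assms by (auto simp: mixed_solution_iff)
  have d: "?\<Phi> \<in> Hdivdiv \<Omega>" "?u \<in> H10 \<Omega>"
    using mem by (auto intro: S.closed_diff E.closed_diff)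
  have "form ?\<Phi> ?\<Phi> = form \<Phi>' ?\<Phi> - form \<Phi> ?\<Phi>"
    using form_axpy_left[of \<Phi>' \<Phi> ?\<Phi> "-1"] mem d by (simp add: Hdivdiv_L2)
  also have "\<dots> = energy (lift ?\<Phi>) ?u"
    using assms d(1) by (simp add: mixed_solution_iff E.diff_right mem lift)
  also have "\<dots> = energy (lift \<Phi>') ?u - energy (lift \<Phi>) ?u"
    using divdiv_axpy[OF mem(2,1) d(2), of "-1"] by (simp add: lift(2) mem d)
  also have "\<dots> = energy u ?u - energy u' ?u"
    using assms d(2) unfolding mixed_solution_iff by (smt (verit))
  also have "\<dots> = - energy ?u ?u"
    by (simp add: E.diff_left mem d(2))
  finally have eq: "form ?\<Phi> ?\<Phi> + energy ?u ?u = 0" by simp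
  then have zero: "form ?\<Phi> ?\<Phi> = 0" "energy ?u ?u = 0"
    using form_nonneg[OF Hdivdiv_L2[OF d(1)]] E.nonneg[OF d(2)] by linarith+
  obtain c where "c > 0" "c * (L2_norm \<Omega> ?\<Phi>)\<^sup>2 \<le> form ?\<Phi> ?\<Phi>"
    using form_coercive Hdivdiv_L2[OF d(1)] by blast
  then have "L2_norm \<Omega> ?\<Phi> = 0"
    using zero(1) by (simp add: mult_le_0_iff)
  then have "AE x in lebesgue_on \<Omega>. ?\<Phi> x = 0"
    using L2_norm_eq_0_iff[OF Hdivdiv_L2[OF d(1)]] by simp
  then show "AE x in lebesgue_on \<Omega>. \<Phi>' x = \<Phi> x" by simp
  have "energy_norm \<Omega> \<mu> lam ?u = 0"
    using zero(2) by (simp add: energy_norm_def energy_def)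
  then have "AE x in lebesgue_on \<Omega>. ?u x = 0"
    using energy_norm_eq_0_iff[OF d(2)] by simp
  then show "AE x in lebesgue_on \<Omega>. u' x = u x" by simp
qed

text \<open>By the second equation \<open>u = F - T \<Phi>\<close>; inserted into the first, it turns the system into
  the Riesz problem for \<open>graph_inner\<close> with right-hand side \<open>e(F, T \<Psi>)\<close>.\<close>

lemma mixed_solution_exists:
  fixes f :: "real^'n \<Rightarrow> real^'n"
  assumes "f \<in> L2 \<Omega>"
  obtains \<Phi> u where "mixed_solution \<Omega> \<mu> lam \<iota> f \<Phi> u"
    "Hdivdiv_norm \<Omega> \<mu> lam \<iota> \<Phi> + energy_norm \<Omega> \<mu> lam u \<le> 3 * dual_norm \<Omega> \<mu> lam (L2_inner \<Omega> f)"
proof -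
  obtain F where F: "F \<in> H10 \<Omega>" "\<And>v. v \<in> H10 \<Omega> \<Longrightarrow> L2_inner \<Omega> f v = energy F v"
    using Hm1_Riesz[OF L2_inner_Hm1[OF assms]] by blast
  let ?F = "energy_norm \<Omega> \<mu> lam F"
  have "energy F (lift (\<lambda>x. \<Phi> x + c *\<^sub>R \<Psi> x)) = energy F (lift \<Phi>) + c * energy F (lift \<Psi>)"
    if "\<Phi> \<in> Hdivdiv \<Omega>" "\<Psi> \<in> Hdivdiv \<Omega>" for \<Phi> \<Psi> c
    using divdiv_axpy[OF that F(1), of c] that F(1)
    by (simp add: lift Hdivdiv_axpy E.sym[OF F(1)])
  moreover have bdd: "\<bar>energy F (lift \<Psi>)\<bar> \<le> ?F * S.nrm \<Psi>" if "\<Psi> \<in> Hdivdiv \<Omega>" for \<Psi>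
    using E.Cauchy_Schwarz[OF F(1) lift(1)[OF that]]
      mult_left_mono[OF energy_norm_lift_le[OF that] E.nrm_nonneg[OF F(1)]] by linarith
  ultimately obtain \<Phi> where \<Phi>: "\<Phi> \<in> Hdivdiv \<Omega>"
    "\<And>\<Psi>. \<Psi> \<in> Hdivdiv \<Omega> \<Longrightarrow> graph_inner \<Phi> \<Psi> = energy F (lift \<Psi>)"
    using S.Riesz[of "\<lambda>\<Psi>. energy F (lift \<Psi>)" ?F] by blast
  define u where "u = (\<lambda>x. F x - lift \<Phi> x)"
  note T = lift(1)[OF \<Phi>(1)]
  have u: "u \<in> H10 \<Omega>"
    unfolding u_def by (intro E.closed_diff F T)
  have "form \<Phi> \<Psi> = energy (lift \<Psi>) u" if "\<Psi> \<in> Hdivdiv \<Omega>" for \<Psi>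
    using \<Phi>(2)[OF that] lift(1)[OF that]
    by (simp add: graph_inner_def u_def E.diff_right F T E.sym[of "lift \<Psi>"])
  moreover have "energy (lift \<Phi>) v + energy u v = L2_inner \<Omega> f v" if "v \<in> H10 \<Omega>" for v
    using that by (simp add: u_def E.diff_left F T)
  ultimately have sol: "mixed_solution \<Omega> \<mu> lam \<iota> f \<Phi> u"
    using \<Phi>(1) u by (simp add: mixed_solution_iff)
  have "(S.nrm \<Phi>)\<^sup>2 \<le> ?F * S.nrm \<Phi>"
    using \<Phi>(2)[OF \<Phi>(1)] bdd[OF \<Phi>(1)] by (simp add: S.nrm_power2 \<Phi>(1))
  then have N: "S.nrm \<Phi> \<le> ?F"
    using S.nrm_nonneg[OF \<Phi>(1)] E.nrm_nonneg[OF F(1)]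
    by (cases "S.nrm \<Phi> = 0") (auto simp: power2_eq_square)
  moreover have "energy_norm \<Omega> \<mu> lam u \<le> ?F + energy_norm \<Omega> \<mu> lam (lift \<Phi>)"
    unfolding u_def by (rule E.nrm_diff_le[OF F(1) T])
  moreover have "energy_norm \<Omega> \<mu> lam (lift \<Phi>) \<le> S.nrm \<Phi>"
    by (rule energy_norm_lift_le[OF \<Phi>(1)])
  moreover have "dual_norm \<Omega> \<mu> lam (L2_inner \<Omega> f) = ?F"
    by (rule dual_norm_eq_energy_norm[OF F])
  ultimately have "Hdivdiv_norm \<Omega> \<mu> lam \<iota> \<Phi> + energy_norm \<Omega> \<mu> lam u
      \<le> 3 * dual_norm \<Omega> \<mu> lam (L2_inner \<Omega> f)"
    unfolding S_nrm_eq_Hdivdiv_norm[OF \<Phi>(1), symmetric] by linarith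
  with sol show ?thesis by (rule that)
qed

end

theorem theorem2p2:
  fixes \<Omega> :: "(real^'n) set" and \<mu> :: real
  assumes "CARD('n) \<ge> 2"
    and "polytopal_domain \<Omega>" and "bounded \<Omega>"
    and "\<mu> > 0"
  shows "\<exists>C>0. \<forall>lam>0. \<forall>\<iota>\<in>{0<..1}. \<forall>f\<in>L2 \<Omega>.
           \<exists>\<Phi> u. mixed_solution \<Omega> \<mu> lam \<iota> f \<Phi> u \<and>
             (\<forall>\<Phi>' u'. mixed_solution \<Omega> \<mu> lam \<iota> f \<Phi>' u' \<longrightarrow>
                (AE x in lebesgue_on \<Omega>. \<Phi>' x = \<Phi> x) \<and> (AE x in lebesgue_on \<Omega>. u' x = u x)) \<and>
             Hdivdiv_norm \<Omega> \<mu> lam \<iota> \<Phi> + energy_norm \<Omega> \<mu> lam u \<le>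
               C * dual_norm \<Omega> \<mu> lam (L2_inner \<Omega> f)"
proof (intro exI[of _ 3] conjI allI impI ballI)
  fix lam \<iota> :: real and f :: "real^'n \<Rightarrow> real^'n" assume "lam > 0" "\<iota> \<in> {0<..1}" and f: "f \<in> L2 \<Omega>"
  then interpret mixed_problem \<Omega> \<mu> lam \<iota>
    using assms by unfold_locales (auto simp: polytopal_domain_def)
  obtain \<Phi> u where sol: "mixed_solution \<Omega> \<mu> lam \<iota> f \<Phi> u"
    "Hdivdiv_norm \<Omega> \<mu> lam \<iota> \<Phi> + energy_norm \<Omega> \<mu> lam u \<le> 3 * dual_norm \<Omega> \<mu> lam (L2_inner \<Omega> f)"
    using mixed_solution_exists[OF f] by blast
  then show "\<exists>\<Phi> u. mixed_solution \<Omega> \<mu> lam \<iota> f \<Phi> u \<and>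
             (\<forall>\<Phi>' u'. mixed_solution \<Omega> \<mu> lam \<iota> f \<Phi>' u' \<longrightarrow>
                (AE x in lebesgue_on \<Omega>. \<Phi>' x = \<Phi> x) \<and> (AE x in lebesgue_on \<Omega>. u' x = u x)) \<and>
             Hdivdiv_norm \<Omega> \<mu> lam \<iota> \<Phi> + energy_norm \<Omega> \<mu> lam u \<le>
               3 * dual_norm \<Omega> \<mu> lam (L2_inner \<Omega> f)"
    using mixed_solution_unique[OF sol(1)] by blast
qed simp

end
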